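(* Let $E$ be a Banach space, let $\theta_A,\theta_B\in[0,\pi)$ with $\theta_A+\theta_B>\pi$, and let $A\in\mathcal{P}(\theta_A)$, $B\in\mathcal{P}(\theta_B)$ be resolvent commuting closed linear operators in $E$. Suppose that one of the two operators is $T$-sectorial and the other one admits a bounded $H^\infty$-calculus; that is, suppose that either $A\in\mathcal{T}(\theta_A)$ and $B$ (as an element of $\mathcal{P}(\theta_B)$) admits a bounded $H^\infty$-calculus, or $B\in\mathcal{T}(\theta_B)$ and $A$ (as an element of $\mathcal{P}(\theta_A)$) admits a bounded $H^\infty$-calculus. Then $A+B$ with domain $\mathcal{D}(A)\cap\mathcal{D}(B)$ is closed and $0\in\rho(A+B)$.
   Context: Banach spaces are complex; $\mathcal{D}(\cdot)$ denotes the domain and $\rho(\cdot)$ the resolvent set of an operator. Sectorial operators. For $\theta\in[0,\pi)$ let $\Lambda_\theta=\{z\in\mathbb{C}\mid |\arg z|\le\theta\}\cup\{0\}$. For $K\ge 1$, $\mathcal{P}_K(\theta)$ is the class of closed densely defined linear operators $A$ in $E$ such that $\Lambda_\theta\subset\rho(-A)$ and $(1+|z|)\|(A+z)^{-1}\|\le K$ for all $z\in\Lambda_\theta$. Set $\mathcal{P}(\theta)=\bigcup_{K\ge1}\mathcal{P}_K(\theta)$; its elements are called sectorial operators of angle $\theta$. $T$-sectorial operators. For $\theta\in[0,\pi)$, $\mathcal{T}(\theta)$ is the class of those $A\in\mathcal{P}(\theta)$ with the following property: for some fixed $p\in(1,\infty)$ and for every $\phi\in[-\theta,\theta]$ there is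 a constant $C_A^{p,\phi}>0$ (depending only on $A,p,\phi$) such that for every $n\in\mathbb{N}$, $r\in[\frac1e,1]$ and $x_0,\dots,x_n\in E$ there exist $a_0,\dots,a_n\in L^\infty(0,2\pi)$ with $\|a_k\|_\infty\le1$ (allowed to depend on $A,n,\phi,r,x_0,\dots,x_n$) satisfying $$\Big\|\sum_{k=0}^n e^{ikt}(I+re^{-k+i\phi}A)^{-1}x_k\Big\|_{L^p(0,2\pi;E)}\le C_A^{p,\phi}\Big\|\sum_{k=0}^n a_k(t)x_k\Big\|_{L^p(0,2\pi;E)},$$ the norms being taken in the variable $t$. The elements of $\mathcal{T}(\theta)$ are called $T$-sectorial operators of angle $\theta$. Bounded $H^\infty$-calculus. Let $A\in\mathcal{P}(\theta)$, $\theta\in(0,\pi)$. Let $H_0^\infty(\theta)$ be the space of bounded holomorphic functions $f:\mathbb{C}\setminus\Lambda_\theta\to\mathbb{C}$ such that $|f(\lambda)|\le c\big(\frac{|\lambda|}{1+|\lambda|^2}\big)^\eta$ for all $\lambda\in\mathbb{C}\setminus\Lambda_\theta$ and some $c,\eta>0$ depending on $f$. Such $f$ extends to non-tangential values on $\partial\Lambda_\theta$ and defines $f(-A)=\frac{1}{2\pi i}\int_{\Gamma_\theta}f(\lambda)(A+\lambda)^{-1}d\lambda\in\mathcal{L}(E)$, where $\Gamma_\theta$ is the positively oriented path $\{re^{\pm i\theta}\mid r\ge0\}$. The operator $A$ admits a bounded $H^\infty$-calculus if there is $C_A>0$ depending only on $A$ with $\|f(-A)\|\le C_A\sup_{\lambda\in\mathbb{C}\setminus\Lambda_\theta}|f(\lambda)|$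 for all $f\in H_0^\infty(\theta)$. Resolvent commuting. Two closed linear operators $A,B$ in $E$ are resolvent commuting if there exist $\lambda\in\rho(-A)$ and $\mu\in\rho(-B)$ such that $[(A+\lambda)^{-1},(B+\mu)^{-1}]=0$. *)

theory Defs
  imports "HOL-Analysis.Analysis"
begin

(* The distribution only provides real Banach spaces. *)
class complex_banach = banach +
  fixes scaleC :: "complex \<Rightarrow> 'a \<Rightarrow> 'a"  (infixr \<open>*\<^sub>C\<close> 75)
  assumes scaleC_add_right: "c *\<^sub>C (x + y) = c *\<^sub>C x + c *\<^sub>C y"
    and scaleC_add_left: "(c + d) *\<^sub>C x = c *\<^sub>C x + d *\<^sub>C x"
    and scaleC_scaleC: "c *\<^sub>C d *\<^sub>C x = (c * d) *\<^sub>C x"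
    and scaleR_scaleC: "r *\<^sub>R x = complex_of_real r *\<^sub>C x"
    and norm_scaleC: "norm (c *\<^sub>C x) = cmod c * norm x"

instantiation complex :: complex_banach
begin

definition scaleC_complex :: "complex \<Rightarrow> complex \<Rightarrow> complex" where
  "scaleC_complex = (*)"

instance
  by standard (simp_all add: scaleC_complex_def algebra_simps norm_mult scaleR_conv_of_real)

end


(* Unbounded operators. The values of op_app outside op_dom are irrelevant. *)
datatype 'a operator = Operator (op_dom: "'a set") (op_app: "'a \<Rightarrow> 'a")

definition op_id :: "'a operator" where
  "op_id = Operator UNIV (\<lambda>x. x)"

definition op_scale :: "complex \<Rightarrow> 'a::complex_banach operator \<Rightarrow> 'a operator" where
  "op_scale c T = Operator (op_dom T) (\<lambda>x. c *\<^sub>C op_app T x)"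

definition op_neg :: "'a::complex_banach operator \<Rightarrow> 'a operator" where
  "op_neg T = Operator (op_dom T) (\<lambda>x. - op_app T x)"

definition op_add :: "'a::complex_banach operator \<Rightarrow> 'a operator \<Rightarrow> 'a operator" where
  "op_add S T = Operator (op_dom S \<inter> op_dom T) (\<lambda>x. op_app S x + op_app T x)"

(* The inverse as a total function; it is only meaningful when T maps op_dom T
   bijectively onto the whole space. *)
definition op_inv :: "'a operator \<Rightarrow> 'a \<Rightarrow> 'a" where
  "op_inv T = inv_into (op_dom T) (op_app T)"

definition linear_operator :: "'a::complex_banach operator \<Rightarrow> bool" where
  "linear_operator T \<longleftrightarrow>
     0 \<in> op_dom T \<and>
     (\<forall>x\<in>op_dom T. \<forall>y\<in>op_dom T.
        x + y \<in> op_dom T \<and> op_app T (x + y) = op_app T x + op_app T y) \<and>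
     (\<forall>c. \<forall>x\<in>op_dom T. c *\<^sub>C x \<in> op_dom T \<and> op_app T (c *\<^sub>C x) = c *\<^sub>C op_app T x)"

definition op_graph :: "'a operator \<Rightarrow> ('a \<times> 'a) set" where
  "op_graph T = {(x, op_app T x) | x. x \<in> op_dom T}"

definition closed_operator :: "'a::complex_banach operator \<Rightarrow> bool" where
  "closed_operator T \<longleftrightarrow> closed (op_graph T)"

definition densely_defined :: "'a::complex_banach operator \<Rightarrow> bool" where
  "densely_defined T \<longleftrightarrow> closure (op_dom T) = UNIV"

(* For complex-linear T the inverse is automatically complex-linear, so that
   real bounded linearity is enough to express that it belongs to L(E). *)
definition resolvent_set :: "'a::complex_banach operator \<Rightarrow> complex set" where
  "resolvent_set T =
     {z. let S = op_add (op_scale z op_id) (op_neg T) in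
           bij_betw (op_app S) (op_dom S) UNIV \<and> bounded_linear (op_inv S)}"

(* (A + z)^{-1} *)
definition shifted_inv :: "'a::complex_banach operator \<Rightarrow> complex \<Rightarrow> 'a \<Rightarrow> 'a" where
  "shifted_inv A z = op_inv (op_add A (op_scale z op_id))"

definition resolvent_commuting ::
  "'a::complex_banach operator \<Rightarrow> 'a operator \<Rightarrow> bool" where
  "resolvent_commuting A B \<longleftrightarrow>
     (\<exists>l \<in> resolvent_set (op_neg A). \<exists>m \<in> resolvent_set (op_neg B).
        shifted_inv A l \<circ> shifted_inv B m = shifted_inv B m \<circ> shifted_inv A l)"


definition sector :: "real \<Rightarrow> complex set" where
  "sector \<theta> = {z. \<bar>Arg z\<bar> \<le> \<theta>} \<union> {0}"

definition sectorial_bound :: "real \<Rightarrow> real \<Rightarrow> 'a::complex_banach operator set" where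
  "sectorial_bound K \<theta> =
     {A. linear_operator A \<and> closed_operator A \<and> densely_defined A \<and>
         sector \<theta> \<subseteq> resolvent_set (op_neg A) \<and>
         (\<forall>z \<in> sector \<theta>. (1 + cmod z) * onorm (shifted_inv A z) \<le> K)}"

definition sectorial :: "real \<Rightarrow> 'a::complex_banach operator set" where
  "sectorial \<theta> = (\<Union>K\<in>{1..}. sectorial_bound K \<theta>)"


definition Lp_norm :: "real \<Rightarrow> (real \<Rightarrow> 'a::real_normed_vector) \<Rightarrow> real" where
  "Lp_norm p g =
     (\<integral>t. norm (g t) powr p \<partial>lebesgue_on {0<..<2*pi}) powr (1 / p)"

definition Linf_unit_ball :: "(real \<Rightarrow> complex) set" where
  "Linf_unit_ball =
     {a \<in> borel_measurable (lebesgue_on {0<..<2*pi}).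
        AE t in lebesgue_on {0<..<2*pi}. cmod (a t) \<le> 1}"

definition T_sectorial :: "real \<Rightarrow> 'a::complex_banach operator set" where
  "T_sectorial \<theta> =
     {A \<in> sectorial \<theta>.
        \<exists>p>1. \<forall>\<phi>\<in>{-\<theta>..\<theta>}. \<exists>C>0.
          \<forall>(n::nat). \<forall>r\<in>{exp (-1)..1}. \<forall>x :: nat \<Rightarrow> 'a.
            \<exists>a :: nat \<Rightarrow> real \<Rightarrow> complex.
              (\<forall>k\<le>n. a k \<in> Linf_unit_ball) \<and>
              Lp_norm p (\<lambda>t. \<Sum>k\<le>n. cis (real k * t) *\<^sub>C
                  op_inv (op_add op_id
                    (op_scale (complex_of_real (r * exp (- real k)) * cis \<phi>) A)) (x k))
              \<le> C * Lp_norm p (\<lambda>t. \<Sum>k\<le>n. a k t *\<^sub>C x k)}"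


definition H0_inf :: "real \<Rightarrow> (complex \<Rightarrow> complex) set" where
  "H0_inf \<theta> =
     {f. f holomorphic_on - sector \<theta> \<and> bounded (f ` (- sector \<theta>)) \<and>
         (\<exists>c>0. \<exists>\<eta>>0. \<forall>z \<in> - sector \<theta>.
            cmod (f z) \<le> c * (cmod z / (1 + (cmod z)\<^sup>2)) powr \<eta>)}"

(* The limit of f at the boundary point z of the open set S along all approach regions
   of the form |w - z| <= M dist(w, boundary of S), M > 1. For bounded holomorphic f on the
   complement of a sector it exists at almost every boundary point (Fatou). *)
definition nontangential_limit ::
  "complex set \<Rightarrow> (complex \<Rightarrow> complex) \<Rightarrow> complex \<Rightarrow> complex" where
  "nontangential_limit S f z =
     (THE l. \<forall>M>1. (f \<longlongrightarrow> l) (at z within {w \<in> S. dist w z \<le> M * infdist w (- S)}))"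

(* Contribution of the outward oriented ray {r e^{i t} | r >= 0} to the integral defining
   f(-A) x, where \<theta> is the angle of the sector and t = \<theta> or t = -\<theta>. The Henstock-Kurzweil
   integral is used since the library's Bochner integral requires a separable space; both
   agree for the absolutely convergent integrals arising here. *)
definition ray_integral ::
  "real \<Rightarrow> (complex \<Rightarrow> complex) \<Rightarrow> 'a::complex_banach operator \<Rightarrow> real \<Rightarrow> 'a \<Rightarrow> 'a" where
  "ray_integral \<theta> f A t x =
     integral {0..} (\<lambda>r.
       (nontangential_limit (- sector \<theta>) f (complex_of_real r * cis t) * cis t) *\<^sub>C
         shifted_inv A (complex_of_real r * cis t) x)"

(* The path runs from infinity to 0 along the lower ray and then from 0 to infinity along the
   upper ray, so that the complement of the sector, which contains the spectrum of -A,
   lies to its left. *)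
definition H_calculus ::
  "real \<Rightarrow> (complex \<Rightarrow> complex) \<Rightarrow> 'a::complex_banach operator \<Rightarrow> 'a \<Rightarrow> 'a" where
  "H_calculus \<theta> f A x =
     (1 / (2 * complex_of_real pi * \<i>)) *\<^sub>C
       (ray_integral \<theta> f A \<theta> x - ray_integral \<theta> f A (- \<theta>) x)"

definition bounded_H_inf_calculus :: "real \<Rightarrow> 'a::complex_banach operator \<Rightarrow> bool" where
  "bounded_H_inf_calculus \<theta> A \<longleftrightarrow>
     (\<exists>C>0. \<forall>f \<in> H0_inf \<theta>.
        onorm (H_calculus \<theta> f A) \<le> C * (SUP z \<in> - sector \<theta>. cmod (f z)))"

end

theory Submission
  imports Defs
begin

text \<open>
  Let \<open>A\<close> be the T-sectorial operator, \<open>B\<close> the one with the bounded calculus.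
  The inverse of \<open>A + B\<close> is a contour integral of products of resolvents
  \<open>(A + z)^{-1} (B - z)^{-1}\<close> over the two rays at angle \<open>\<theta>\<^sub>A\<close>;
  what has to be shown is that it maps into \<open>D(B)\<close>.
  The kernel decays too slowly for this, so the integrals are regrouped. The resolvents
  \<open>(B - z)^{-1}\<close> on the two rays are the ends \<open>e = pi\<close> and \<open>e = - pi\<close> of
  a family \<open>(B + cis e * z)^{-1}\<close>, \<open>z = r * cis (- \<theta>\<^sub>A * e / pi)\<close>, along which the
  resolvents of \<open>A\<close> and \<open>B\<close> stay in their sectors. The difference of the ends is
  split into \<open>N\<close> steps of angle \<open>2 * pi / N\<close>. With \<open>\<omega> = cis (2 * pi / N)\<close>,
  the polynomial \<open>X^N - 1\<close> is a multiple of \<open>(X - 1) (X - \<omega>) (X - 1 / \<omega>)\<close>, and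
  the corresponding third order difference in \<open>e\<close> of the resolvents of \<open>B\<close> is a rational
  function of \<open>B / r\<close> which vanishes to second order at zero and at infinity, hence is a
  product of two functions vanishing to first order at both ends. Rotating a ray to give the
  terms of one difference the same \<open>z\<close> costs only an arc at infinity, that is, a multiple
  of the identity.

  The regrouped integrals are split into blocks \<open>r = q * exp k\<close>. By orthogonality of
  the exponentials a sum \<open>\<Sum>k. T\<^sub>k f\<^sub>k(B) g\<^sub>k(B) y\<close>, where
  \<open>T\<^sub>k = z\<^sub>k (A + z\<^sub>k)^{-1}\<close>, is the mean over \<open>t\<close> of
  \<open>\<Sum>j. cis (- j t) g\<^sub>j(B)\<close> applied to \<open>\<Sum>k. cis (k t) T\<^sub>k f\<^sub>k(B) y\<close>.
  The first factor is bounded by the calculus of \<open>B\<close>, the second one by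
  T-sectoriality of \<open>A\<close> followed by the calculus of \<open>B\<close>.
\<close>

subsection \<open>Contour integrals along rays\<close>

text \<open>The obstacle is that the truncated contour integral approximates
  \<open>B (A + B)^{-1}\<close> up to a multiple of the identity with an integrand of size
  \<open>1 / r\<close> only, so that resolvent estimates alone bound it by a logarithm of the
  truncation radius. Each scale \<open>exp k\<close> must therefore bring two factors in
  \<open>B\<close> that are small away from that scale: one is summed under T-sectoriality, the
  other takes the place of a duality pairing. A first difference of resolvents supplies one such
  factor, and halving it would call for a square root; a third difference is the shortest one with a
  double zero at both ends. With rational functions the calculus is evaluated only on finite sums of
  differences of Cauchy kernels, where it can be computed by hand, and its multiplicativity is never
  invoked. The slack \<open>\<theta>A + \<theta>B - pi\<close> pays for keeping all four directions
  of a difference strictly inside the sector of \<open>B\<close>.\<close>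

lemma scaleC_one: "1 *\<^sub>C x = (x :: 'a::complex_banach)"
  using scaleR_scaleC[of 1 x] by simp

interpretation scaleC: bounded_bilinear "scaleC :: complex \<Rightarrow> 'a \<Rightarrow> 'a::complex_banach"
proof
  show "(r *\<^sub>R a) *\<^sub>C b = r *\<^sub>R (a *\<^sub>C b)" for r a and b :: 'a
    by (simp add: scaleR_scaleC[of r "a *\<^sub>C b"] scaleC_scaleC scaleR_conv_of_real)
  show "a *\<^sub>C (r *\<^sub>R b) = r *\<^sub>R (a *\<^sub>C b)" for r a and b :: 'a
    by (simp add: scaleR_scaleC scaleC_scaleC mult.commute)
  show "\<exists>K. \<forall>a b. norm (a *\<^sub>C (b :: 'a)) \<le> norm a * norm b * K"
    by (intro exI[of _ 1]) (simp add: norm_scaleC)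
qed (simp_all add: scaleC_add_left scaleC_add_right)

lemmas scaleC_simps = scaleC.diff_left scaleC.diff_right scaleC.add_left scaleC.add_right
  scaleC.minus_left scaleC.minus_right scaleC_scaleC scaleC_one scaleC.zero_left scaleC.zero_right

declare scaleC_one [simp] scaleC.zero_left [simp] scaleC.zero_right [simp]

lemma scaleC_cancel_left: "c *\<^sub>C x = c *\<^sub>C y \<longleftrightarrow> c = 0 \<or> x = (y :: 'a::complex_banach)"
proof -
  have "c *\<^sub>C x = c *\<^sub>C y \<longleftrightarrow> norm (c *\<^sub>C (x - y)) = 0"
    by (simp add: scaleC.diff_right)
  then show ?thesis
    by (auto simp: norm_scaleC)
qed

text \<open>A difference quotient that extends continuously to \<open>w\<close> yields the
  derivative there. Resolvent identities provide such quotients in closed form, and they do so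
  within closed sectors, including the boundary rays and the apex.\<close>

lemma has_derivative_scaleC_quotient:
  fixes P Q :: "complex \<Rightarrow> 'a::complex_banach"
  assumes eq: "\<And>z. z \<in> T \<Longrightarrow> P z - P w = (z - w) *\<^sub>C Q z"
    and Q: "continuous_on T Q" and w: "w \<in> T"
  shows "(P has_derivative (\<lambda>h. h *\<^sub>C Q w)) (at w within T)"
proof -
  have "((\<lambda>z. norm (Q z - Q w)) \<longlongrightarrow> 0) (at w within T)"
    using Q w by (simp add: continuous_on_def tendsto_norm_zero_iff LIM_zero_iff)
  moreover have "eventually (\<lambda>z. norm (Q z - Q w) =
      norm (P z - P w - (z - w) *\<^sub>C Q w) / norm (z - w)) (at w within T)"
    unfolding eventually_at_filter
    by (rule always_eventually)
      (auto simp: eq norm_scaleC scaleC.diff_right[symmetric])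
  ultimately have "((\<lambda>z. norm (P z - P w - (z - w) *\<^sub>C Q w) / norm (z - w)) \<longlongrightarrow> 0) (at w within T)"
    by (rule Lim_transform_eventually)
  then show ?thesis
    by (simp add: has_derivative_iff_norm scaleC.bounded_linear_left)
qed

text \<open>Described by angles rather than by \<open>Arg\<close>, so that an angle may exceed pi:
  the closure of the complement of a sector is
  \<open>wedge \<theta> (2 * pi - \<theta>)\<close>.\<close>

definition wedge :: "real \<Rightarrow> real \<Rightarrow> complex set" where
  "wedge \<alpha> \<beta> = {complex_of_real r * cis s | r s. 0 \<le> r \<and> s \<in> {\<alpha>..\<beta>}}"

lemma wedgeI: "0 \<le> r \<Longrightarrow> s \<in> {\<alpha>..\<beta>} \<Longrightarrow> complex_of_real r * cis s \<in> wedge \<alpha> \<beta>"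
  unfolding wedge_def by blast

lemma cis_has_vector_derivative:
  "((\<lambda>s. cis s) has_vector_derivative \<i> * cis s) (at s within S)"
  unfolding has_vector_derivative_def
  by (auto intro!: derivative_eq_intros simp: scaleR_conv_of_real)

lemma wedge_chain:
  fixes g D :: "complex \<Rightarrow> 'a::complex_banach"
  assumes "(g has_derivative (\<lambda>h. h *\<^sub>C D (f x))) (at (f x) within W)"
    and f: "(f has_vector_derivative f') (at x within S)" and "f ` S \<subseteq> W"
  shows "((\<lambda>x. g (f x)) has_vector_derivative f' *\<^sub>C D (f x)) (at x within S)"
proof -
  have "(g has_derivative (\<lambda>h. h *\<^sub>C D (f x))) (at (f x) within f ` S)"
    using assms(1,3) by (rule has_derivative_subset)
  from has_derivative_in_compose[OF f[unfolded has_vector_derivative_def] this]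
  show ?thesis
    by (simp add: has_vector_derivative_def scaleC.scaleR_left)
qed

text \<open>The form \<open>g dz\<close> is closed: in polar coordinates the
  \<open>s\<close>-derivative of \<open>cis s * g\<close> is \<open>i\<close> times the
  \<open>r\<close>-derivative of \<open>r * cis s * g\<close>, the latter being \<open>E\<close>.
  Integrating over the rectangle in both orders leaves the two rays on one side and the arc on the
  other.\<close>

lemma ray_rotation:
  fixes g D :: "complex \<Rightarrow> 'a::complex_banach"
  assumes "\<alpha> \<le> \<beta>" "0 \<le> b"
    and der: "\<And>w. w \<in> wedge \<alpha> \<beta> \<Longrightarrow> (g has_derivative (\<lambda>h. h *\<^sub>C D w)) (at w within wedge \<alpha> \<beta>)"
    and D: "continuous_on (wedge \<alpha> \<beta>) D"
  shows "integral {0..b} (\<lambda>r. cis \<beta> *\<^sub>C g (complex_of_real r * cis \<beta>))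
       - integral {0..b} (\<lambda>r. cis \<alpha> *\<^sub>C g (complex_of_real r * cis \<alpha>))
       = \<i> *\<^sub>C integral {\<alpha>..\<beta>} (\<lambda>s. (complex_of_real b * cis s) *\<^sub>C g (complex_of_real b * cis s))"
proof -
  define E where "E r s = cis s *\<^sub>C g (complex_of_real r * cis s)
    + (complex_of_real r * cis s * cis s) *\<^sub>C D (complex_of_real r * cis s)" for r s
  have g: "continuous_on (wedge \<alpha> \<beta>) g"
    by (rule has_derivative_continuous_on) (rule der)
  have ray: "continuous_on {0..b} (\<lambda>r. cis s *\<^sub>C g (complex_of_real r * cis s))" if "s \<in> {\<alpha>..\<beta>}" for s
    using that by (intro scaleC.continuous_on continuous_intros continuous_on_compose2[OF g])
      (auto intro: wedgeI)
  have E_cont: "continuous_on ({0..b} \<times> {\<alpha>..\<beta>}) (\<lambda>(r, s). E r s)"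
    unfolding E_def split_def
    by (intro continuous_intros scaleC.continuous_on continuous_on_compose2[OF g]
        continuous_on_compose2[OF D]) (auto intro: wedgeI)
  have ds: "((\<lambda>s. \<i> *\<^sub>C E r s) has_integral
      cis \<beta> *\<^sub>C g (complex_of_real r * cis \<beta>) - cis \<alpha> *\<^sub>C g (complex_of_real r * cis \<alpha>)) {\<alpha>..\<beta>}"
    if "r \<in> {0..b}" for r
  proof (rule fundamental_theorem_of_calculus[OF \<open>\<alpha> \<le> \<beta>\<close>])
    fix s assume s: "s \<in> {\<alpha>..\<beta>}"
    have 0: "complex_of_real r * cis s \<in> wedge \<alpha> \<beta>"
      using s that by (auto intro: wedgeI)
    have 1: "((\<lambda>s. complex_of_real r * cis s) has_vector_derivative complex_of_real r * (\<i> * cis s))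
        (at s within {\<alpha>..\<beta>})"
      by (intro has_vector_derivative_mult_right cis_has_vector_derivative)
    have "((\<lambda>s. g (complex_of_real r * cis s)) has_vector_derivative
        (complex_of_real r * (\<i> * cis s)) *\<^sub>C D (complex_of_real r * cis s)) (at s within {\<alpha>..\<beta>})"
      by (rule wedge_chain[of g D "\<lambda>s. complex_of_real r * cis s" s, OF der[OF 0] 1])
        (use that in \<open>auto intro: wedgeI\<close>)
    from scaleC.has_vector_derivative[OF cis_has_vector_derivative this]
    show "((\<lambda>s. cis s *\<^sub>C g (complex_of_real r * cis s)) has_vector_derivative \<i> *\<^sub>C E r s)
        (at s within {\<alpha>..\<beta>})"
      by (simp add: E_def scaleC_simps mult_ac add.commute)
  qed
  have dr: "((\<lambda>r. E r s) has_integral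
      (complex_of_real b * cis s) *\<^sub>C g (complex_of_real b * cis s)) {0..b}" if "s \<in> {\<alpha>..\<beta>}" for s
  proof -
    have "((\<lambda>r. E r s) has_integral
      (complex_of_real b * cis s) *\<^sub>C g (complex_of_real b * cis s)
      - (complex_of_real 0 * cis s) *\<^sub>C g (complex_of_real 0 * cis s)) {0..b}"
    proof (rule fundamental_theorem_of_calculus[OF \<open>0 \<le> b\<close>])
      fix r assume r: "r \<in> {0..b}"
      have 0: "complex_of_real r * cis s \<in> wedge \<alpha> \<beta>"
        using r that by (auto intro: wedgeI)
      have 1: "((\<lambda>r. complex_of_real r * cis s) has_vector_derivative cis s) (at r within {0..b})"
        by (auto intro!: derivative_eq_intros simp: has_vector_derivative_def scaleR_conv_of_real)
      have "((\<lambda>r. g (complex_of_real r * cis s)) has_vector_derivative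
          cis s *\<^sub>C D (complex_of_real r * cis s)) (at r within {0..b})"
        by (rule wedge_chain[of g D "\<lambda>r. complex_of_real r * cis s" r, OF der[OF 0] 1])
          (use that in \<open>auto intro: wedgeI\<close>)
      from scaleC.has_vector_derivative[OF 1 this]
      show "((\<lambda>r. (complex_of_real r * cis s) *\<^sub>C g (complex_of_real r * cis s))
          has_vector_derivative E r s) (at r within {0..b})"
        by (simp add: E_def scaleC_simps mult_ac add.commute)
    qed
    then show ?thesis by simp
  qed
  have "integral {0..b} (\<lambda>r. cis \<beta> *\<^sub>C g (complex_of_real r * cis \<beta>))
       - integral {0..b} (\<lambda>r. cis \<alpha> *\<^sub>C g (complex_of_real r * cis \<alpha>))
      = integral {0..b} (\<lambda>r. cis \<beta> *\<^sub>C g (complex_of_real r * cis \<beta>)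
          - cis \<alpha> *\<^sub>C g (complex_of_real r * cis \<alpha>))"
    using \<open>\<alpha> \<le> \<beta>\<close> by (intro integral_diff[symmetric] integrable_continuous_real ray) auto
  also have "\<dots> = integral {0..b} (\<lambda>r. integral {\<alpha>..\<beta>} (\<lambda>s. \<i> *\<^sub>C E r s))"
    by (intro integral_cong) (metis ds integral_unique)
  also have "\<dots> = integral {\<alpha>..\<beta>} (\<lambda>s. integral {0..b} (\<lambda>r. \<i> *\<^sub>C E r s))"
    using integral_swap_continuous[of 0 \<alpha> b \<beta> "\<lambda>r s. \<i> *\<^sub>C E r s"] E_cont
    by (simp add: cbox_Pair_eq scaleC.continuous_on split_def)
  also have "\<dots> = integral {\<alpha>..\<beta>} (\<lambda>s. \<i> *\<^sub>C ((complex_of_real b * cis s) *\<^sub>C g (complex_of_real b * cis s)))"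
    by (intro integral_cong integral_unique
        has_integral_linear[OF dr scaleC.bounded_linear_right, unfolded o_def])
  also have "\<dots> = \<i> *\<^sub>C integral {\<alpha>..\<beta>} (\<lambda>s. (complex_of_real b * cis s) *\<^sub>C g (complex_of_real b * cis s))"
    using \<open>0 \<le> b\<close>
    by (intro integral_linear[OF _ scaleC.bounded_linear_right, unfolded o_def]
        integrable_continuous_real scaleC.continuous_on continuous_intros continuous_on_compose2[OF g])
      (auto intro: wedgeI)
  finally show ?thesis .
qed

text \<open>Far out on the arc \<open>z * g z\<close> is nearly \<open>v\<close>, so the arc
  contributes its angle times \<open>v\<close>. The difference is kept inside the limit because a
  function of size \<open>1 / r\<close> need not have a convergent integral along a single
  ray.\<close>

lemma ray_rotation_limit:
  fixes g D :: "complex \<Rightarrow> 'a::complex_banach"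
  assumes "\<alpha> \<le> \<beta>"
    and der: "\<And>w. w \<in> wedge \<alpha> \<beta> \<Longrightarrow> (g has_derivative (\<lambda>h. h *\<^sub>C D w)) (at w within wedge \<alpha> \<beta>)"
    and D: "continuous_on (wedge \<alpha> \<beta>) D"
    and lim: "((\<lambda>z. z *\<^sub>C g z) \<longlongrightarrow> v) (inf at_infinity (principal (wedge \<alpha> \<beta>)))"
  shows "((\<lambda>b. integral {0..b} (\<lambda>r. cis \<beta> *\<^sub>C g (complex_of_real r * cis \<beta>))
       - integral {0..b} (\<lambda>r. cis \<alpha> *\<^sub>C g (complex_of_real r * cis \<alpha>)))
     \<longlongrightarrow> (\<i> * complex_of_real (\<beta> - \<alpha>)) *\<^sub>C v) at_top"
proof (rule tendstoI)
  fix e :: real assume "0 < e"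
  \<comment> \<open>The summand 1 keeps the denominator positive when the two rays coincide.\<close>
  define e' where "e' = e / (2 * (\<beta> - \<alpha> + 1))"
  have e': "0 < e'" and e'_e: "e' * (\<beta> - \<alpha>) < e"
    using \<open>0 < e\<close> \<open>\<alpha> \<le> \<beta>\<close> by (auto simp: e'_def pos_divide_less_eq)
  obtain b0 where b0: "norm (z *\<^sub>C g z - v) < e'" if "b0 \<le> norm z" "z \<in> wedge \<alpha> \<beta>" for z
    using tendstoD[OF lim e'] by (auto simp: eventually_inf_principal eventually_at_infinity dist_norm)
  have g: "continuous_on (wedge \<alpha> \<beta>) g"
    by (rule has_derivative_continuous_on) (rule der)
  have "dist (integral {0..b} (\<lambda>r. cis \<beta> *\<^sub>C g (complex_of_real r * cis \<beta>))
       - integral {0..b} (\<lambda>r. cis \<alpha> *\<^sub>C g (complex_of_real r * cis \<alpha>)))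
     ((\<i> * complex_of_real (\<beta> - \<alpha>)) *\<^sub>C v) < e" if b: "max 0 b0 \<le> b" for b
  proof -
    let ?P = "\<lambda>s. (complex_of_real b * cis s) *\<^sub>C g (complex_of_real b * cis s)"
    have P: "continuous_on {\<alpha>..\<beta>} ?P"
      using b by (intro scaleC.continuous_on continuous_intros continuous_on_compose2[OF g])
        (auto intro: wedgeI)
    have "integral {\<alpha>..\<beta>} ?P - (\<beta> - \<alpha>) *\<^sub>R v = integral {\<alpha>..\<beta>} (\<lambda>s. ?P s - v)"
      using \<open>\<alpha> \<le> \<beta>\<close> by (subst integral_diff) (auto intro: integrable_continuous_real[OF P])
    also have "norm \<dots> \<le> integral {\<alpha>..\<beta>} (\<lambda>s. e')"
    proof (rule integral_norm_bound_integral)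
      fix s assume "s \<in> {\<alpha>..\<beta>}"
      then have "complex_of_real b * cis s \<in> wedge \<alpha> \<beta>"
        using b by (intro wedgeI) auto
      then show "norm (?P s - v) \<le> e'"
        using b b0[of "complex_of_real b * cis s"] by (auto simp: norm_mult)
    qed (auto intro!: integrable_continuous_real continuous_intros P)
    also have "\<dots> < e"
      using \<open>\<alpha> \<le> \<beta>\<close> e'_e by (simp add: mult.commute)
    finally have *: "norm (integral {\<alpha>..\<beta>} ?P - (\<beta> - \<alpha>) *\<^sub>R v) < e" .
    have "(\<i> * complex_of_real (\<beta> - \<alpha>)) *\<^sub>C v = \<i> *\<^sub>C ((\<beta> - \<alpha>) *\<^sub>R v)"
      by (simp only: scaleR_scaleC scaleC_scaleC)
    with * show ?thesis
      using b by (subst ray_rotation[OF \<open>\<alpha> \<le> \<beta>\<close> _ der D])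
        (auto simp: dist_norm scaleC.diff_right[symmetric] norm_scaleC)
  qed
  then show "eventually (\<lambda>b. dist (integral {0..b} (\<lambda>r. cis \<beta> *\<^sub>C g (complex_of_real r * cis \<beta>))
       - integral {0..b} (\<lambda>r. cis \<alpha> *\<^sub>C g (complex_of_real r * cis \<alpha>)))
     ((\<i> * complex_of_real (\<beta> - \<alpha>)) *\<^sub>C v) < e) at_top"
    unfolding eventually_at_top_linorder by blast
qed

subsection \<open>Resolvents of sectorial operators\<close>

lemma sector_polarI:
  assumes "0 \<le> r" "\<bar>s\<bar> \<le> \<theta>" "\<theta> < pi"
  shows "complex_of_real r * cis s \<in> sector \<theta>"
proof (cases "r = 0")
  case False
  moreover have "s \<in> {-pi<..pi}"
    using assms by auto
  ultimately have "Arg (complex_of_real r * cis s) = s"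
    using assms by (simp add: Arg_times_of_real Arg_cis)
  with assms show ?thesis by (simp add: sector_def)
qed (simp add: sector_def)

lemma wedge_subset_sector: "- \<theta> \<le> \<alpha> \<Longrightarrow> \<beta> \<le> \<theta> \<Longrightarrow> \<theta> < pi \<Longrightarrow> wedge \<alpha> \<beta> \<subseteq> sector \<theta>"
  by (auto simp: wedge_def intro!: sector_polarI)

lemma shifted_inv_eq:
  "shifted_inv A z = inv_into (op_dom A) (\<lambda>x. op_app A x + z *\<^sub>C x)"
  by (simp add: shifted_inv_def op_inv_def op_add_def op_scale_def op_id_def)

lemma resolvent_set_op_neg:
  "z \<in> resolvent_set (op_neg A) \<longleftrightarrow>
     bij_betw (\<lambda>x. op_app A x + z *\<^sub>C x) (op_dom A) UNIV \<and> bounded_linear (shifted_inv A z)"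
  by (simp add: resolvent_set_def shifted_inv_eq op_inv_def op_add_def op_scale_def op_id_def
      op_neg_def add.commute)

lemma
  assumes "z \<in> resolvent_set (op_neg A)"
  shows shifted_inv_in_dom: "shifted_inv A z x \<in> op_dom A"
    and app_shifted_inv: "op_app A (shifted_inv A z x) + z *\<^sub>C shifted_inv A z x = x"
    and shifted_inv_app: "x \<in> op_dom A \<Longrightarrow> shifted_inv A z (op_app A x + z *\<^sub>C x) = x"
  using assms bij_betw_inv_into_right[of _ "op_dom A" UNIV x]
    bij_betw_inv_into_left[of "\<lambda>x. op_app A x + z *\<^sub>C x" "op_dom A" UNIV x]
    bij_betwE[OF bij_betw_inv_into, of "\<lambda>x. op_app A x + z *\<^sub>C x" "op_dom A" UNIV]
  by (fastforce simp: resolvent_set_op_neg shifted_inv_eq)+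

lemma linear_operatorD:
  assumes "linear_operator A" "x \<in> op_dom A" "y \<in> op_dom A"
  shows "x + y \<in> op_dom A" "op_app A (x + y) = op_app A x + op_app A y"
    "c *\<^sub>C x \<in> op_dom A" "op_app A (c *\<^sub>C x) = c *\<^sub>C op_app A x"
    "x - y \<in> op_dom A" "op_app A (x - y) = op_app A x - op_app A y"
proof -
  show "x + y \<in> op_dom A" "op_app A (x + y) = op_app A x + op_app A y"
    "c *\<^sub>C x \<in> op_dom A" "op_app A (c *\<^sub>C x) = c *\<^sub>C op_app A x"
    using assms by (auto simp: linear_operator_def)
  have *: "(-1) *\<^sub>C y \<in> op_dom A" "op_app A ((-1) *\<^sub>C y) = (-1) *\<^sub>C op_app A y"
    using assms by (auto simp: linear_operator_def)
  with assms(1,2) have "x + (-1) *\<^sub>C y \<in> op_dom A"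
    "op_app A (x + (-1) *\<^sub>C y) = op_app A x + (-1) *\<^sub>C op_app A y"
    by (simp_all add: linear_operator_def)
  then show "x - y \<in> op_dom A" "op_app A (x - y) = op_app A x - op_app A y"
    by (simp_all add: scaleC_simps)
qed

lemma shifted_inv_unique:
  assumes "z \<in> resolvent_set (op_neg A)" "u \<in> op_dom A" "op_app A u + z *\<^sub>C u = x"
  shows "shifted_inv A z x = u"
  using shifted_inv_app[OF assms(1,2)] assms(3) by simp

lemma shifted_inv_scaleC:
  assumes "linear_operator A" "z \<in> resolvent_set (op_neg A)"
  shows "shifted_inv A z (c *\<^sub>C x) = c *\<^sub>C shifted_inv A z x"
proof (rule shifted_inv_unique[OF assms(2)])
  let ?u = "shifted_inv A z x"
  have u: "?u \<in> op_dom A"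
    by (rule shifted_inv_in_dom[OF assms(2)])
  then show "c *\<^sub>C ?u \<in> op_dom A"
    using assms by (simp add: linear_operatorD)
  have "c *\<^sub>C (op_app A ?u + z *\<^sub>C ?u) = c *\<^sub>C x"
    by (simp add: app_shifted_inv[OF assms(2)])
  then show "op_app A (c *\<^sub>C ?u) + z *\<^sub>C (c *\<^sub>C ?u) = c *\<^sub>C x"
    using assms u by (simp add: linear_operatorD scaleC_simps mult.commute)
qed

text \<open>Commuting with one resolvent forces \<open>T\<close> to preserve the domain and to
  commute with \<open>A\<close> there, which no longer refers to the resolvent point.\<close>

lemma shifted_inv_commute:
  assumes lin: "linear_operator A" and l: "l \<in> resolvent_set (op_neg A)"
    and z: "z \<in> resolvent_set (op_neg A)"
    and T: "\<And>x y. T (x - y) = T x - T y" "\<And>c x. T (c *\<^sub>C x) = c *\<^sub>C T x"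
    and comm: "\<And>x. T (shifted_inv A l x) = shifted_inv A l (T x)"
  shows "T (shifted_inv A z x) = shifted_inv A z (T x)"
proof -
  have dom: "T u \<in> op_dom A \<and> op_app A (T u) = T (op_app A u)" if u: "u \<in> op_dom A" for u
  proof -
    define v where "v = op_app A u + l *\<^sub>C u"
    have u_eq: "u = shifted_inv A l v"
      using shifted_inv_app[OF l u] by (simp add: v_def)
    then have "T u = shifted_inv A l (T v)"
      by (simp add: comm)
    then have "T u \<in> op_dom A" "op_app A (T u) + l *\<^sub>C T u = T v"
      using shifted_inv_in_dom[OF l] app_shifted_inv[OF l] by auto
    moreover have "op_app A u = v - l *\<^sub>C u"
      by (simp add: v_def)
    then have "T (op_app A u) = T v - l *\<^sub>C T u"
      by (simp add: T)
    ultimately show ?thesis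
      by (metis add_right_cancel diff_add_cancel)
  qed
  let ?u = "shifted_inv A z x"
  have "T x = T (op_app A ?u - (- z) *\<^sub>C ?u)"
    using app_shifted_inv[OF z, of x] by (simp add: scaleC.minus_left)
  also have "\<dots> = T (op_app A ?u) - (- z) *\<^sub>C T ?u"
    by (simp only: T)
  also have "\<dots> = op_app A (T ?u) + z *\<^sub>C T ?u"
    using dom[OF shifted_inv_in_dom[OF z]] by (simp add: scaleC.minus_left)
  finally show ?thesis
    using dom[OF shifted_inv_in_dom[OF z]] by (intro shifted_inv_unique[OF z, symmetric]) auto
qed

locale sectorial_operator =
  fixes A :: "'a::complex_banach operator" and \<theta> K :: real
  assumes sectorial: "A \<in> sectorial_bound K \<theta>" and K: "1 \<le> K" and \<theta>: "0 \<le> \<theta>" "\<theta> < pi"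
begin

abbreviation R :: "complex \<Rightarrow> 'a \<Rightarrow> 'a" where "R \<equiv> shifted_inv A"
text \<open>For nonzero \<open>z\<close> this is the operator \<open>(I + A / z)^{-1}\<close> of
  T-sectoriality. It is bounded by \<open>K\<close> on the whole sector and tends strongly to the
  identity at infinity.\<close>

abbreviation J :: "complex \<Rightarrow> 'a \<Rightarrow> 'a" where "J z x \<equiv> z *\<^sub>C R z x"

lemma linear: "linear_operator A"
  and dense: "closure (op_dom A) = UNIV"
  and sector_resolvent: "z \<in> sector \<theta> \<Longrightarrow> z \<in> resolvent_set (op_neg A)"
  using sectorial by (auto simp: sectorial_bound_def densely_defined_def)

lemma zero_in_sector: "0 \<in> sector \<theta>"
  by (simp add: sector_def)

lemma R_bounded_linear: "z \<in> sector \<theta> \<Longrightarrow> bounded_linear (R z)"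
  using sector_resolvent by (simp add: resolvent_set_op_neg)

lemmas R_add = linear_add[OF bounded_linear.linear[OF R_bounded_linear]]
  and R_diff = linear_diff[OF bounded_linear.linear[OF R_bounded_linear]]
  and R_sum = linear_sum[OF bounded_linear.linear[OF R_bounded_linear]]
  and R_zero = linear_0[OF bounded_linear.linear[OF R_bounded_linear]]

lemma R_scaleC: "z \<in> sector \<theta> \<Longrightarrow> R z (c *\<^sub>C x) = c *\<^sub>C R z x"
  by (intro shifted_inv_scaleC linear sector_resolvent)

lemma R_dom: "z \<in> sector \<theta> \<Longrightarrow> R z x \<in> op_dom A"
  by (intro shifted_inv_in_dom sector_resolvent)

lemma app_R: "z \<in> sector \<theta> \<Longrightarrow> op_app A (R z x) = x - J z x"
  using app_shifted_inv[OF sector_resolvent] by (simp add: eq_diff_eq)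

lemma R_app: "z \<in> sector \<theta> \<Longrightarrow> x \<in> op_dom A \<Longrightarrow> R z (op_app A x) = x - J z x"
  using shifted_inv_app[OF sector_resolvent, of z x] by (simp add: eq_diff_eq R_add R_scaleC)

lemma norm_R: "z \<in> sector \<theta> \<Longrightarrow> norm (R z x) \<le> K / (1 + cmod z) * norm x"
proof -
  assume z: "z \<in> sector \<theta>"
  have "(1 + cmod z) * onorm (R z) \<le> K"
    using sectorial z by (simp add: sectorial_bound_def)
  then have "onorm (R z) \<le> K / (1 + cmod z)"
    by (simp add: pos_le_divide_eq add_pos_nonneg mult.commute)
  then show ?thesis
    using onorm[OF R_bounded_linear[OF z], of x] by (meson mult_right_mono norm_ge_zero order_trans)
qed

lemma norm_R_le: "z \<in> sector \<theta> \<Longrightarrow> norm (R z x) \<le> K * norm x"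
proof -
  assume "z \<in> sector \<theta>"
  have "K / (1 + cmod z) \<le> K / 1"
    using K by (intro divide_left_mono) (auto simp: add_pos_nonneg)
  then have "K / (1 + cmod z) * norm x \<le> K * norm x"
    by (intro mult_right_mono) auto
  with norm_R[OF \<open>z \<in> sector \<theta>\<close>, of x] show ?thesis
    by linarith
qed

lemma norm_J: "z \<in> sector \<theta> \<Longrightarrow> norm (J z x) \<le> K * norm x"
proof -
  assume z: "z \<in> sector \<theta>"
  have "norm (J z x) \<le> cmod z * (K / (1 + cmod z) * norm x)"
    unfolding norm_scaleC by (intro mult_left_mono norm_R z) auto
  also have "\<dots> = cmod z / (1 + cmod z) * (K * norm x)"
    by simp
  also have "\<dots> \<le> 1 * (K * norm x)"
    using K by (intro mult_right_mono) (auto simp: divide_le_eq_1 add_pos_nonneg)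
  finally show ?thesis by simp
qed

lemma resolvent_identity:
  assumes z: "z \<in> sector \<theta>" and w: "w \<in> sector \<theta>"
  shows "R z x - R w x = (w - z) *\<^sub>C R z (R w x)"
proof -
  have "R z x = R z (op_app A (R w x) + w *\<^sub>C R w x)"
    by (simp add: app_R w)
  also have "\<dots> = R w x - J z (R w x) + w *\<^sub>C R z (R w x)"
    using z w by (simp add: R_add R_scaleC R_app R_dom)
  finally show ?thesis
    by (simp add: scaleC_simps)
qed

lemma R_commute:
  assumes z: "z \<in> sector \<theta>" and w: "w \<in> sector \<theta>"
  shows "R z (R w x) = R w (R z x)"
proof (cases "z = w")
  case False
  have "(w - z) *\<^sub>C R z (R w x) = - (R w x - R z x)"
    by (simp add: resolvent_identity[OF z w, symmetric])
  also have "\<dots> = (w - z) *\<^sub>C R w (R z x)"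
    by (simp add: resolvent_identity[OF w z] flip: scaleC.minus_left)
  finally have "(w - z) *\<^sub>C R z (R w x) = (w - z) *\<^sub>C R w (R z x)" .
  with False show ?thesis
    by (simp add: scaleC_cancel_left)
qed simp

text \<open>Continuity in the point and the vector jointly, so that it can be iterated: in later
  integrands the vector is itself a resolvent of the other operator. It follows from the resolvent
  identity and the bound \<open>K\<close>, uniform over the sector.\<close>

lemma continuous_on_R:
  fixes g :: "'b::topological_space \<Rightarrow> complex"
  assumes g: "continuous_on T g" and sub: "\<And>t. t \<in> T \<Longrightarrow> g t \<in> sector \<theta>"
    and v: "continuous_on T v"
  shows "continuous_on T (\<lambda>t. R (g t) (v t))"
  unfolding continuous_on_def
proof
  fix w assume w: "w \<in> T"
  let ?F = "at w within T"
  have "((\<lambda>t. K * norm (v t - v w) + cmod (g w - g t) * (K * (K * norm (v w)))) \<longlongrightarrow>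
      K * norm (v w - v w) + cmod (g w - g w) * (K * (K * norm (v w)))) ?F"
    using g v w by (intro tendsto_intros) (auto simp: continuous_on_def)
  then have lim: "((\<lambda>t. K * norm (v t - v w) + cmod (g w - g t) * (K * (K * norm (v w)))) \<longlongrightarrow> 0) ?F"
    by simp
  have le: "norm (R (g t) (v t) - R (g w) (v w))
      \<le> K * norm (v t - v w) + cmod (g w - g t) * (K * (K * norm (v w)))" if t: "t \<in> T" for t
  proof -
    have "R (g t) (v t) - R (g w) (v w)
        = R (g t) (v t - v w) + (R (g t) (v w) - R (g w) (v w))"
      using t sub by (simp add: R_diff)
    also have "\<dots> = R (g t) (v t - v w) + (g w - g t) *\<^sub>C R (g t) (R (g w) (v w))"
      using t w sub by (simp add: resolvent_identity)
    also have "norm \<dots> \<le> K * norm (v t - v w) + cmod (g w - g t) * (K * (K * norm (v w)))"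
    proof (intro norm_triangle_mono)
      show "norm (R (g t) (v t - v w)) \<le> K * norm (v t - v w)"
        using t sub by (intro norm_R_le) auto
      have "norm (R (g t) (R (g w) (v w))) \<le> K * norm (R (g w) (v w))"
        using t sub by (intro norm_R_le) auto
      also have "\<dots> \<le> K * (K * norm (v w))"
        using w sub K by (intro mult_left_mono norm_R_le) auto
      finally show "norm ((g w - g t) *\<^sub>C R (g t) (R (g w) (v w)))
          \<le> cmod (g w - g t) * (K * (K * norm (v w)))"
        unfolding norm_scaleC by (intro mult_left_mono) auto
    qed
    finally show ?thesis .
  qed
  have "((\<lambda>t. R (g t) (v t) - R (g w) (v w)) \<longlongrightarrow> 0) ?F"
    by (rule Lim_null_comparison[OF _ lim]) (use le in \<open>auto simp: eventually_at_filter\<close>)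
  then show "((\<lambda>t. R (g t) (v t)) \<longlongrightarrow> R (g w) (v w)) ?F"
    by (rule LIM_zero_cancel)
qed

lemma R_has_derivative:
  assumes T: "T \<subseteq> sector \<theta>" and w: "w \<in> T"
  shows "((\<lambda>z. R z x) has_derivative (\<lambda>h. h *\<^sub>C (- R w (R w x)))) (at w within T)"
proof (rule has_derivative_scaleC_quotient[where Q = "\<lambda>z. - R z (R w x)", OF _ _ w])
  show "R z x - R w x = (z - w) *\<^sub>C (- R z (R w x))" if "z \<in> T" for z
    using that T w
    by (subst resolvent_identity) (auto simp: scaleC.minus_right simp flip: scaleC.minus_left)
  show "continuous_on T (\<lambda>z. - R z (R w x))"
    using T by (intro continuous_intros continuous_on_R) auto
qed

text \<open>For \<open>u\<close> in the domain, \<open>u - J z u = R z (A u)\<close> is of size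
  \<open>1 / |z|\<close>; the uniform bound on \<open>J\<close> and the density of the domain carry
  this over to all vectors.\<close>

lemma J_tendsto: "((\<lambda>z. J z x) \<longlongrightarrow> x) (inf at_infinity (principal (sector \<theta>)))"
proof (rule tendstoI)
  fix e :: real assume e: "0 < e"
  obtain u where u: "u \<in> op_dom A" "dist u x < e / (2 * (K + 1))"
  proof -
    have "x \<in> closure (op_dom A)" "0 < e / (2 * (K + 1))"
      using dense e K by auto
    then show ?thesis
      using that unfolding closure_approachable by blast
  qed
  define b where "b = 2 * K * norm (op_app A u) / e"
  have "dist (J z x) x < e" if z: "z \<in> sector \<theta>" "b \<le> cmod z" for z
  proof -
    have "x - J z x = (x - u) - J z (x - u) + (u - J z u)"
      using z by (simp add: R_diff scaleC_simps algebra_simps)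
    also have "\<dots> = (x - u) - J z (x - u) + R z (op_app A u)"
      using z u by (simp add: R_app)
    also have "norm \<dots> \<le> norm (x - u) + K * norm (x - u) + norm (R z (op_app A u))"
      using z by (intro norm_triangle_mono norm_triangle_le_diff add_left_mono norm_J) auto
    also have "norm (x - u) + K * norm (x - u) = (K + 1) * dist u x"
      by (simp add: dist_norm norm_minus_commute algebra_simps)
    also have "\<dots> < e / 2"
      using u(2) K by (simp add: field_simps)
    also have "norm (R z (op_app A u)) \<le> K / (1 + cmod z) * norm (op_app A u)"
      using z by (intro norm_R)
    also have "\<dots> \<le> e / 2"
    proof -
      have "K * norm (op_app A u) * 2 \<le> e * cmod z"
        using z e by (simp add: b_def pos_divide_le_eq mult_ac)
      also have "\<dots> \<le> e * (1 + cmod z)"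
        using e by simp
      finally show ?thesis
        by (simp add: field_simps add_pos_nonneg)
    qed
    finally show ?thesis
      by (simp add: dist_norm norm_minus_commute)
  qed
  then show "\<forall>\<^sub>F z in inf at_infinity (principal (sector \<theta>)). dist (J z x) x < e"
    by (auto simp: eventually_inf_principal eventually_at_infinity)
qed

lemma R_rotation:
  assumes "\<alpha> \<le> \<beta>" "- \<theta> \<le> \<alpha>" "\<beta> \<le> \<theta>"
  shows "((\<lambda>b. integral {0..b} (\<lambda>r. cis \<beta> *\<^sub>C R (complex_of_real r * cis \<beta>) x)
       - integral {0..b} (\<lambda>r. cis \<alpha> *\<^sub>C R (complex_of_real r * cis \<alpha>) x))
     \<longlongrightarrow> (\<i> * complex_of_real (\<beta> - \<alpha>)) *\<^sub>C x) at_top"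
proof (rule ray_rotation_limit[OF assms(1), where D = "\<lambda>w. - R w (R w x)"])
  have sub: "wedge \<alpha> \<beta> \<subseteq> sector \<theta>"
    using assms \<theta> by (intro wedge_subset_sector) auto
  show "((\<lambda>z. R z x) has_derivative (\<lambda>h. h *\<^sub>C - R w (R w x))) (at w within wedge \<alpha> \<beta>)"
    if "w \<in> wedge \<alpha> \<beta>" for w
    by (intro R_has_derivative sub that)
  show "continuous_on (wedge \<alpha> \<beta>) (\<lambda>w. - R w (R w x))"
    using sub by (intro continuous_intros continuous_on_R) auto
  show "((\<lambda>z. z *\<^sub>C R z x) \<longlongrightarrow> x) (inf at_infinity (principal (wedge \<alpha> \<beta>)))"
    using sub by (intro filterlim_mono[OF J_tendsto order_refl] inf_mono) auto
qed

end

lemma sectorialE: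
  assumes "A \<in> sectorial \<theta>" "\<theta> \<in> {0..<pi}"
  obtains K where "sectorial_operator A \<theta> K"
  using assms by (auto simp: sectorial_def sectorial_operator_def)

subsection \<open>The functional calculus on differences of Cauchy kernels\<close>

lemma cos_le_cosI:
  assumes "0 \<le> \<gamma>" "\<gamma> \<le> \<bar>x\<bar>" "\<bar>x\<bar> \<le> 2 * pi - \<gamma>"
  shows "cos x \<le> cos \<gamma>"
proof (cases "\<bar>x\<bar> \<le> pi")
  case True
  then show ?thesis
    using assms cos_monotone_0_pi_le[of \<gamma> "\<bar>x\<bar>"] by (simp add: cos_abs_real)
next
  case False
  then have "cos (2 * pi - \<bar>x\<bar>) \<le> cos \<gamma>"
    using assms by (intro cos_monotone_0_pi_le) auto
  then show ?thesis
    by (simp add: cos_diff cos_abs_real)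
qed

lemma cmod_polar_diff_squared:
  "(cmod (complex_of_real r * cis s - complex_of_real q * cis t))\<^sup>2
     = r\<^sup>2 + q\<^sup>2 - 2 * r * q * cos (s - t)"
proof -
  have "(r * cos s - q * cos t)\<^sup>2 + (r * sin s - q * sin t)\<^sup>2
      = r\<^sup>2 * ((cos s)\<^sup>2 + (sin s)\<^sup>2) + q\<^sup>2 * ((cos t)\<^sup>2 + (sin t)\<^sup>2)
        - 2 * r * q * (cos s * cos t + sin s * sin t)"
    by algebra
  then show ?thesis
    unfolding cmod_power2 by (simp add: cos_diff)
qed

text \<open>With \<open>\<gamma> = \<theta> - |\<beta>|\<close> the directions differ by at least
  \<open>\<gamma>\<close> modulo 2 pi, and \<open>r^2 + q^2 - 2 r q cos \<gamma> = (1 - cos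
  \<gamma>) / 2 * (r + q)^2 + (1 + cos \<gamma>) / 2 * (r - q)^2\<close>. The range of
  \<open>\<psi>\<close> beyond pi serves rays that are turned through the complement of the
  sector.\<close>

lemma polar_distance_lower_bound:
  assumes "\<bar>\<beta>\<bar> < \<theta>" "\<theta> \<le> pi"
  obtains c where "0 < c"
    and "\<And>r q \<psi>. 0 \<le> r \<Longrightarrow> 0 \<le> q \<Longrightarrow> \<theta> \<le> \<bar>\<psi>\<bar> \<Longrightarrow> \<bar>\<psi>\<bar> \<le> 2 * pi - \<theta> \<Longrightarrow>
      c * (r + q) \<le> cmod (complex_of_real r * cis \<beta> - complex_of_real q * cis \<psi>)"
proof
  define \<gamma> where "\<gamma> = \<theta> - \<bar>\<beta>\<bar>"
  have \<gamma>: "0 < \<gamma>" "\<gamma> \<le> pi"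
    using assms by (auto simp: \<gamma>_def)
  have "cos \<gamma> < cos 0"
    using \<gamma> by (intro cos_monotone_0_pi) auto
  then have cos: "cos \<gamma> < 1" by simp
  then show "0 < sqrt ((1 - cos \<gamma>) / 2)" by simp
  fix r q \<psi> :: real
  assume rq: "0 \<le> r" "0 \<le> q" and \<psi>: "\<theta> \<le> \<bar>\<psi>\<bar>" "\<bar>\<psi>\<bar> \<le> 2 * pi - \<theta>"
  have "cos (\<beta> - \<psi>) \<le> cos \<gamma>"
    using \<gamma> \<psi> by (intro cos_le_cosI) (auto simp: \<gamma>_def)
  then have "2 * r * q * cos (\<beta> - \<psi>) \<le> 2 * r * q * cos \<gamma>"
    using rq by (intro mult_left_mono) auto
  moreover have "0 \<le> (1 + cos \<gamma>) * (r - q)\<^sup>2"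
    using cos_ge_minus_one[of \<gamma>] by (intro mult_nonneg_nonneg zero_le_power2) linarith
  ultimately have "(1 - cos \<gamma>) / 2 * (r + q)\<^sup>2
      \<le> (cmod (complex_of_real r * cis \<beta> - complex_of_real q * cis \<psi>))\<^sup>2"
    unfolding cmod_polar_diff_squared by (simp add: power2_eq_square field_simps)
  then have "sqrt ((1 - cos \<gamma>) / 2 * (r + q)\<^sup>2)
      \<le> cmod (complex_of_real r * cis \<beta> - complex_of_real q * cis \<psi>)"
    by (rule real_le_lsqrt[OF norm_ge_zero])
  then show "sqrt ((1 - cos \<gamma>) / 2) * (r + q)
      \<le> cmod (complex_of_real r * cis \<beta> - complex_of_real q * cis \<psi>)"
    using rq unfolding real_sqrt_mult by simp
qed

lemma polar_decomposition: "z = complex_of_real (cmod z) * cis (Arg z)"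
  using rcis_cmod_Arg[of z] by (simp add: rcis_def)

lemma not_in_sectorD: "z \<notin> sector \<theta> \<Longrightarrow> z \<noteq> 0 \<and> \<theta> < \<bar>Arg z\<bar> \<and> \<bar>Arg z\<bar> \<le> pi"
  using mpi_less_Arg[of z] Arg_le_pi[of z] by (auto simp: sector_def)

text \<open>By continuity the value of \<open>f\<close> is a limit; the work lies in the uniqueness
  demanded by \<open>THE\<close>, for which the boundary point has to be a limit point of some
  approach region.\<close>

lemma nontangential_limit_ray:
  assumes f: "isCont f (complex_of_real r * cis t)" and "0 < r" "\<bar>t\<bar> = \<theta>" "0 < \<theta>" "\<theta> < pi"
  shows "nontangential_limit (- sector \<theta>) f (complex_of_real r * cis t)
       = f (complex_of_real r * cis t)"
  unfolding nontangential_limit_def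
proof (rule the_equality)
  let ?z = "complex_of_real r * cis t"
  let ?T = "\<lambda>M. {w \<in> - sector \<theta>. dist w ?z \<le> M * infdist w (- (- sector \<theta>))}"
  show *: "\<forall>M>1. (f \<longlongrightarrow> f ?z) (at ?z within ?T M)"
    using tendsto_within_subset[OF f[unfolded isCont_def] subset_UNIV] by blast
  have "?z islimpt ?T 2"
    unfolding islimpt_approachable
  proof (intro allI impI)
    fix e :: real assume "0 < e"
    \<comment> \<open>The witness is the boundary point turned outward by \<open>d\<close>. The
      bound 1 makes \<open>cos d\<close> nonnegative, so that
      \<open>1 - cos d <= 2 * (sin d)^2\<close>; staying below \<open>pi - \<theta>\<close> keeps
      the witness outside the sector; \<open>e / (4 * r)\<close> brings it within
      \<open>e\<close>.\<close>
    define d where "d = min (min 1 ((pi - \<theta>) / 2)) (e / (4 * r))"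
    have d: "0 < d" "d \<le> 1"
      using assms \<open>0 < e\<close> by (auto simp: d_def)
    have "d \<le> (pi - \<theta>) / 2" "d \<le> e / (4 * r)"
      unfolding d_def by linarith+
    then have "d < pi - \<theta>" "d * (4 * r) \<le> e"
      using assms(2,5) by (simp_all add: pos_le_divide_eq)
    moreover have "2 * r * d = d * (4 * r) / 2"
      by simp
    ultimately have d': "d < pi - \<theta>" "2 * r * d < e"
      using \<open>0 < e\<close> by linarith+
    note d = d d'
    have cos0: "0 \<le> cos d"
      using d pi_gt3 by (intro cos_ge_zero) auto
    have sin0: "0 < sin d"
      using d pi_gt3 by (intro sin_gt_zero) auto
    define t' where "t' = (if 0 \<le> t then t + d else t - d)"
    define w where "w = complex_of_real r * cis t'"
    have t': "\<bar>t'\<bar> = \<theta> + d" "\<bar>t' - t\<bar> = d"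
      using assms(2-5) d by (auto simp: t'_def)
    then have "Arg w = t'"
      using d assms unfolding w_def by (subst Arg_times_of_real) (auto intro!: Arg_cis)
    moreover have "w \<noteq> 0"
      using assms(2-5) by (simp add: w_def)
    ultimately have w: "w \<notin> sector \<theta>"
      using t' d by (auto simp: sector_def)
    have cos_t': "cos (t' - t) = cos d"
      using t' by (metis cos_abs_real)
    have "(dist w ?z)\<^sup>2 = 2 * r\<^sup>2 * (1 - cos d)"
      unfolding dist_norm w_def cmod_polar_diff_squared cos_t' by (simp add: power2_eq_square algebra_simps)
    also have "\<dots> \<le> 2 * r\<^sup>2 * ((1 - cos d) * (2 * (1 + cos d)))"
      using cos0 mult_left_mono[of 1 "2 * (1 + cos d)" "1 - cos d"] by (intro mult_left_mono) auto
    also have "\<dots> = (2 * r * sin d)\<^sup>2"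
      by (simp add: power_mult_distrib sin_squared_eq) (simp add: power2_eq_square algebra_simps)
    finally have dist: "dist w ?z \<le> 2 * r * sin d"
      by (rule power2_le_imp_le) (use sin0 assms(2) in simp)
    also have "\<dots> \<le> 2 * r * d"
      using sin_x_le_x[of d] d assms(2-5) by (intro mult_left_mono) auto
    finally have dist_e: "dist w ?z < e"
      using d by simp
    \<comment> \<open>Every point of the sector is at least \<open>r * sin d\<close> away, half the
      bound just found for the distance to the boundary point; hence the aperture 2.\<close>
    have "r * sin d \<le> dist w p" if p: "p \<in> sector \<theta>" for p
    proof (rule power2_le_imp_le)
      define q s where "q = cmod p" and "s = (if p = 0 then 0 else Arg p)"
      have q: "p = complex_of_real q * cis s" "0 \<le> q" "\<bar>s\<bar> \<le> \<theta>"
        using p polar_decomposition[of p] assms by (auto simp: q_def s_def sector_def)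
      have "cos (t' - s) \<le> cos d"
        using t' q d assms(2-5) by (intro cos_le_cosI) auto
      then have "2 * r * q * cos (t' - s) \<le> 2 * r * q * cos d"
        using q assms(2-5) by (intro mult_left_mono) auto
      moreover have "(r * sin d)\<^sup>2 + (q - r * cos d)\<^sup>2
          = r\<^sup>2 * ((sin d)\<^sup>2 + (cos d)\<^sup>2) + q\<^sup>2 - 2 * r * q * cos d"
        by algebra
      then have "(r * sin d)\<^sup>2 \<le> r\<^sup>2 + q\<^sup>2 - 2 * r * q * cos d"
        using zero_le_power2[of "q - r * cos d"] unfolding sin_cos_squared_add by linarith
      ultimately show "(r * sin d)\<^sup>2 \<le> (dist w p)\<^sup>2"
        unfolding dist_norm w_def q(1) cmod_polar_diff_squared by linarith
    qed simp
    moreover have "sector \<theta> \<noteq> {}"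
      by (auto simp: sector_def)
    ultimately have "r * sin d \<le> infdist w (sector \<theta>)"
      unfolding infdist_def by (auto intro: cINF_greatest)
    with dist w have "w \<in> ?T 2" by simp
    moreover have "w \<noteq> ?z"
      using sector_polarI[of r t \<theta>] w assms(2-5) by auto
    ultimately show "\<exists>w\<in>?T 2. w \<noteq> ?z \<and> dist w ?z < e"
      using dist_e by blast
  qed
  then have nontriv: "at ?z within ?T 2 \<noteq> bot"
    by (simp add: trivial_limit_within)
  show "l = f ?z" if "\<forall>M>1. (f \<longlongrightarrow> l) (at ?z within ?T M)" for l
    using tendsto_unique[OF nontriv that[rule_format] *[rule_format]] by simp
qed

text \<open>Contour rotation controls truncated integrals, whereas \<open>ray_integral\<close> runs
  over the half line. Integrability comes from the majorant, whose primitive is an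
  arctangent.\<close>

lemma improper_integral_limit:
  fixes f :: "real \<Rightarrow> 'a::banach"
  assumes f: "continuous_on {0..} f" and bound: "\<And>r. 0 \<le> r \<Longrightarrow> norm (f r) \<le> C / (1 + r\<^sup>2)"
  shows "((\<lambda>b. integral {0..b} f) \<longlongrightarrow> integral {0..} f) at_top"
proof -
  have int0: "(\<lambda>x. if x \<in> {0..} then f x else 0) integrable_on {a..b}" for a b
  proof -
    have "f integrable_on {max 0 a..b}"
      by (intro integrable_continuous_real continuous_on_subset[OF f]) auto
    moreover have "{0..} \<inter> {a..b} = {max 0 a..b}" by auto
    ultimately show ?thesis
      by (subst integrable_restrict_Int) simp
  qed
  have arctan: "((\<lambda>r. C / (1 + r\<^sup>2)) has_integral C * arctan b - C * arctan 0) {0..b}" if "0 \<le> b" for b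
  proof (rule fundamental_theorem_of_calculus[OF that])
    fix r
    show "((\<lambda>r. C * arctan r) has_vector_derivative C / (1 + r\<^sup>2)) (at r within {0..b})"
      using DERIV_cmult[OF has_field_derivative_at_within[OF DERIV_arctan]]
      by (simp add: divide_inverse has_real_derivative_iff_has_vector_derivative[symmetric])
  qed
  have C: "0 \<le> C"
    using order_trans[OF norm_ge_zero bound[of 0]] by simp
  have "((\<lambda>b. C * arctan b) \<longlongrightarrow> C * (pi / 2)) at_top"
    by (intro tendsto_intros tendsto_arctan_at_top)
  moreover have "eventually (\<lambda>b. C * arctan b = integral {0..b} (\<lambda>r. C / (1 + r\<^sup>2))) at_top"
    using arctan by (auto simp: eventually_at_top_linorder intro!: exI[of _ 0] integral_unique[symmetric])
  ultimately have "((\<lambda>b. integral {0..b} (\<lambda>r. C / (1 + r\<^sup>2))) \<longlongrightarrow> C * (pi / 2)) at_top"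
    by (rule Lim_transform_eventually)
  moreover have "(\<lambda>r. C / (1 + r\<^sup>2)) integrable_on {0..b}" for b
    by (cases "0 \<le> b") (use arctan in \<open>auto simp: integrable_on_def\<close>)
  ultimately have "((\<lambda>r. C / (1 + r\<^sup>2)) has_integral C * (pi / 2)) {0..}"
    using C by (intro has_integral_to_inf) auto
  then have g: "(\<lambda>r. C / (1 + r\<^sup>2)) integrable_on {0..}"
    by (rule has_integral_integrable)
  have "f integrable_on {0..}"
    by (rule integrable_on_all_intervals_integrable_bound[OF _ bound g]) (use int0 in simp_all)
  then have "(f has_integral integral {0..} f) {0..}"
    by (rule integrable_integral)
  then have lim: "\<exists>B>0. \<forall>a b. ball 0 B \<subseteq> cbox a b \<longrightarrow>
      norm (integral (cbox a b) (\<lambda>x. if x \<in> {0..} then f x else 0) - integral {0..} f) < e" if "0 < e" for e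
    using that unfolding has_integral_alt' by blast
  show ?thesis
  proof (rule tendstoI)
    fix e :: real assume "0 < e"
    then obtain B where B: "0 < B" "\<And>a b. ball 0 B \<subseteq> {a..b} \<Longrightarrow>
        norm (integral {a..b} (\<lambda>x. if x \<in> {0..} then f x else 0) - integral {0..} f) < e"
      using lim[of e] by auto
    have "dist (integral {0..b} f) (integral {0..} f) < e" if "B \<le> b" for b
    proof -
      have 1: "ball 0 B \<subseteq> {-b..b}"
        using that by (auto simp: dist_norm)
      have 2: "{0..} \<inter> {-b..b} = {0..b}"
        using that B(1) by auto
      have "integral {-b..b} (\<lambda>x. if x \<in> {0..} then f x else 0) = integral {0..b} f"
        unfolding integral_restrict_Int 2 by (rule refl)
      with B(2)[OF 1] show ?thesis
        by (simp only: dist_norm)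
    qed
    then show "eventually (\<lambda>b. dist (integral {0..b} f) (integral {0..} f) < e) at_top"
      unfolding eventually_at_top_linorder by blast
  qed
qed

text \<open>At \<open>-A\<close> this gives \<open>J \<sigma> - J \<rho>\<close>. A single kernel
  has the value 1 at the origin; the difference equals
  \<open>z * (\<rho> - \<sigma>) / ((\<sigma> - z) * (\<rho> - z))\<close> and so decays at zero and
  at infinity.\<close>

definition pair_fun :: "complex \<Rightarrow> complex \<Rightarrow> complex \<Rightarrow> complex" where
  "pair_fun \<sigma> \<rho> z = \<sigma> / (\<sigma> - z) - \<rho> / (\<rho> - z)"

text \<open>Poles of equal modulus \<open>p\<close> give a bound that depends on
  \<open>q / p\<close> only, so poles along a geometric sequence act on almost separate
  scales.\<close>

lemma pair_fun_bound:
  assumes "\<bar>\<beta>0\<bar> < \<theta>" "\<bar>\<beta>1\<bar> < \<theta>" "\<theta> \<le> pi"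
  obtains M where "0 < M" and "\<And>p q \<psi>. 0 < p \<Longrightarrow> 0 \<le> q \<Longrightarrow> \<theta> \<le> \<bar>\<psi>\<bar> \<Longrightarrow> \<bar>\<psi>\<bar> \<le> pi \<Longrightarrow>
    cmod (pair_fun (complex_of_real p * cis \<beta>1) (complex_of_real p * cis \<beta>0) (complex_of_real q * cis \<psi>))
      \<le> M * (p * q / (p + q)\<^sup>2)"
proof -
  obtain c0 where c0: "0 < c0" "\<And>r q \<psi>. 0 \<le> r \<Longrightarrow> 0 \<le> q \<Longrightarrow> \<theta> \<le> \<bar>\<psi>\<bar> \<Longrightarrow> \<bar>\<psi>\<bar> \<le> 2 * pi - \<theta> \<Longrightarrow>
      c0 * (r + q) \<le> cmod (complex_of_real r * cis \<beta>0 - complex_of_real q * cis \<psi>)"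
    using polar_distance_lower_bound[OF assms(1,3)] by blast
  obtain c1 where c1: "0 < c1" "\<And>r q \<psi>. 0 \<le> r \<Longrightarrow> 0 \<le> q \<Longrightarrow> \<theta> \<le> \<bar>\<psi>\<bar> \<Longrightarrow> \<bar>\<psi>\<bar> \<le> 2 * pi - \<theta> \<Longrightarrow>
      c1 * (r + q) \<le> cmod (complex_of_real r * cis \<beta>1 - complex_of_real q * cis \<psi>)"
    using polar_distance_lower_bound[OF assms(2,3)] by blast
  show ?thesis
  proof
    show "0 < 2 / (c0 * c1)" using c0 c1 by simp
    fix p q \<psi> :: real
    assume pq: "0 < p" "0 \<le> q" and \<psi>: "\<theta> \<le> \<bar>\<psi>\<bar>" "\<bar>\<psi>\<bar> \<le> pi"
    define z \<rho> \<sigma> where "z = complex_of_real q * cis \<psi>" and "\<rho> = complex_of_real p * cis \<beta>0"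
      and "\<sigma> = complex_of_real p * cis \<beta>1"
    have lo0: "c0 * (p + q) \<le> cmod (\<rho> - z)" and lo1: "c1 * (p + q) \<le> cmod (\<sigma> - z)"
      unfolding z_def \<rho>_def \<sigma>_def using pq \<psi> assms(3) by (intro c0 c1; simp)+
    have pos: "0 < c0 * (p + q)" "0 < c1 * (p + q)"
      using c0 c1 pq by simp_all
    then have ne: "\<rho> - z \<noteq> 0" "\<sigma> - z \<noteq> 0"
      using lo0 lo1 by auto
    have "pair_fun \<sigma> \<rho> z = z * (\<rho> - \<sigma>) / ((\<sigma> - z) * (\<rho> - z))"
      using ne by (simp add: pair_fun_def field_simps)
    then have "cmod (pair_fun \<sigma> \<rho> z) = q * cmod (\<rho> - \<sigma>) / (cmod (\<sigma> - z) * cmod (\<rho> - z))"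
      using pq by (simp add: norm_mult norm_divide z_def)
    also have "\<dots> \<le> q * (2 * p) / ((c1 * (p + q)) * (c0 * (p + q)))"
    proof (intro frac_le mult_mono mult_left_mono lo0 lo1)
      show "cmod (\<rho> - \<sigma>) \<le> 2 * p"
        using norm_triangle_ineq4[of \<rho> \<sigma>] pq by (simp add: \<rho>_def \<sigma>_def norm_mult)
    qed (use pq pos in \<open>auto intro: mult_nonneg_nonneg less_imp_le\<close>)
    also have "\<dots> = 2 / (c0 * c1) * (p * q / (p + q)\<^sup>2)"
      by (simp add: power2_eq_square mult_ac)
    finally show "cmod (pair_fun (complex_of_real p * cis \<beta>1) (complex_of_real p * cis \<beta>0)
        (complex_of_real q * cis \<psi>)) \<le> 2 / (c0 * c1) * (p * q / (p + q)\<^sup>2)"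
      by (simp add: z_def \<rho>_def \<sigma>_def)
  qed
qed

text \<open>The summands are dominated by the increments of \<open>t / (t + q)\<close> along the
  geometric sequence \<open>t = p * exp k\<close>.\<close>

lemma dyadic_sum_bound:
  fixes p q :: real
  assumes "0 < p" "0 \<le> q"
  shows "(\<Sum>k\<le>n. (p * exp (real k)) * q / (p * exp (real k) + q)\<^sup>2) \<le> 2"
proof -
  define t where "t k = p * exp (real k)" for k :: nat
  define x where "x k = t k / (t k + q)" for k
  have t: "0 < t k" "t (Suc k) = exp 1 * t k" for k
    using assms by (auto simp: t_def exp_add algebra_simps)
  have e: "2 \<le> exp (1::real)"
    using exp_ge_add_one_self[of "1::real"] by simp
  have "t k * q / (t k + q)\<^sup>2 \<le> 2 * (x (Suc k) - x k)" for k
  proof -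
    have pos: "0 < t k + q" "0 < exp 1 * t k + q"
      using t[of k] assms(2) by (auto intro!: add_pos_nonneg)
    have "x (Suc k) - x k = (exp 1 - 1) * (t k * q) / ((exp 1 * t k + q) * (t k + q))"
      unfolding x_def t(2) using pos by (subst diff_frac_eq) (auto simp: algebra_simps)
    moreover have "t k * q / (t k + q)\<^sup>2 \<le> 2 * ((exp 1 - 1) * (t k * q) / ((exp 1 * t k + q) * (t k + q)))"
    proof -
      \<comment> \<open>The increment of \<open>x\<close> carries the denominator
        \<open>(exp 1 * t k + q) * (t k + q)\<close>; comparing it with the square of
        \<open>t k + q\<close> costs the factor \<open>E\<close>, and \<open>exp 1 >= 2\<close>
        gives \<open>exp 1 <= E\<close>.\<close>
      define E :: real where "E = 2 * (exp 1 - 1)"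
      have E: "exp 1 \<le> E" "1 \<le> E"
        using e by (auto simp: E_def)
      have "exp 1 * t k \<le> E * t k" "1 * q \<le> E * q"
        using E t(1)[of k] assms(2) by (intro mult_right_mono; simp)+
      then have le: "exp 1 * t k + q \<le> E * (t k + q)"
        by (simp add: distrib_left)
      have "t k * q / (t k + q)\<^sup>2 = E * (t k * q) / (E * (t k + q) * (t k + q))"
        using E pos by (simp add: power2_eq_square)
      also have "\<dots> \<le> E * (t k * q) / ((exp 1 * t k + q) * (t k + q))"
        using E t(1)[of k] assms(2) pos le by (intro divide_left_mono mult_right_mono mult_pos_pos) auto
      finally show ?thesis
        unfolding E_def by (simp only: mult.assoc times_divide_eq_right)
    qed
    ultimately show ?thesis by simp
  qed
  then have "(\<Sum>k\<le>n. t k * q / (t k + q)\<^sup>2) \<le> (\<Sum>k\<le>n. 2 * (x (Suc k) - x k))"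
    by (intro sum_mono)
  also have "\<dots> = 2 * (x (Suc n) - x 0)"
    by (induction n) (simp_all add: algebra_simps)
  also have "\<dots> \<le> 2 * 1"
  proof -
    have "x (Suc n) \<le> 1" "0 \<le> x 0"
      using t(1)[of "Suc n"] t(1)[of 0] assms(2) by (auto simp: x_def divide_le_eq_1 add_pos_nonneg)
    then show ?thesis by simp
  qed
  finally show ?thesis by (simp add: t_def)
qed

text \<open>The constant depends on \<open>n\<close>, \<open>p\<close> and \<open>d\<close>. It
  serves for the decay at zero and infinity; the uniform bound comes from
  \<open>dyadic_sum_bound\<close>.\<close>

lemma pair_sum_bound:
  assumes "\<bar>\<beta>0\<bar> < \<theta>" "\<bar>\<beta>1\<bar> < \<theta>" "\<theta> \<le> pi" and p: "\<And>k. 0 < p k"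
  obtains C where "0 \<le> C" and "\<And>q \<psi>. 0 \<le> q \<Longrightarrow> \<theta> \<le> \<bar>\<psi>\<bar> \<Longrightarrow> \<bar>\<psi>\<bar> \<le> pi \<Longrightarrow>
    cmod (\<Sum>k\<le>n::nat. d k * pair_fun (complex_of_real (p k) * cis \<beta>1) (complex_of_real (p k) * cis \<beta>0)
      (complex_of_real q * cis \<psi>)) \<le> C * (q / (1 + q\<^sup>2))"
proof -
  obtain M where M: "0 < M" "\<And>p q \<psi>. 0 < p \<Longrightarrow> 0 \<le> q \<Longrightarrow> \<theta> \<le> \<bar>\<psi>\<bar> \<Longrightarrow> \<bar>\<psi>\<bar> \<le> pi \<Longrightarrow>
    cmod (pair_fun (complex_of_real p * cis \<beta>1) (complex_of_real p * cis \<beta>0) (complex_of_real q * cis \<psi>))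
      \<le> M * (p * q / (p + q)\<^sup>2)"
    using pair_fun_bound[OF assms(1-3)] by blast
  \<comment> \<open>With this minimum \<open>m k * (1 + q^2) <= (p k)^2 + q^2\<close>, which turns
    decay relative to \<open>p k\<close> into decay relative to 1.\<close>
  define m where "m k = min 1 ((p k)\<^sup>2)" for k
  have m: "0 < m k" for k
    using p[of k] by (simp add: m_def)
  have C0: "0 \<le> M * (p k / m k)" for k
    using M(1) p[of k] m[of k] by simp
  show ?thesis
  proof
    show "0 \<le> (\<Sum>k\<le>n. cmod (d k) * (M * (p k / m k)))"
      using C0 by (intro sum_nonneg mult_nonneg_nonneg[OF norm_ge_zero])
    fix q \<psi> :: real assume q: "0 \<le> q" and \<psi>: "\<theta> \<le> \<bar>\<psi>\<bar>" "\<bar>\<psi>\<bar> \<le> pi"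
    have "cmod (pair_fun (complex_of_real (p k) * cis \<beta>1) (complex_of_real (p k) * cis \<beta>0)
      (complex_of_real q * cis \<psi>)) \<le> M * (p k / m k) * (q / (1 + q\<^sup>2))" for k
    proof -
      have "m k * (1 + q\<^sup>2) \<le> (p k + q)\<^sup>2"
      proof -
        have "m k * (1 + q\<^sup>2) = m k * 1 + m k * q\<^sup>2"
          by (simp add: distrib_left)
        also have "\<dots> \<le> (p k)\<^sup>2 + 1 * q\<^sup>2"
          by (intro add_mono mult_right_mono) (auto simp: m_def)
        also have "\<dots> \<le> (p k + q)\<^sup>2"
          using p[of k] q by (simp add: power2_sum)
        finally show ?thesis .
      qed
      moreover have "0 < 1 + q\<^sup>2"
        by (simp add: add_pos_nonneg)
      ultimately have "p k * q / (p k + q)\<^sup>2 \<le> p k * q / (m k * (1 + q\<^sup>2))"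
        using p[of k] q m[of k] by (intro divide_left_mono mult_pos_pos) auto
      then have "M * (p k * q / (p k + q)\<^sup>2) \<le> M * (p k * q / (m k * (1 + q\<^sup>2)))"
        using M(1) by (intro mult_left_mono) auto
      with M(2)[OF p[of k] q \<psi>] show ?thesis
        by simp
    qed
    then have "cmod (\<Sum>k\<le>n. d k * pair_fun (complex_of_real (p k) * cis \<beta>1) (complex_of_real (p k) * cis \<beta>0)
      (complex_of_real q * cis \<psi>)) \<le> (\<Sum>k\<le>n. cmod (d k) * (M * (p k / m k) * (q / (1 + q\<^sup>2))))"
      unfolding norm_mult[symmetric] by (intro sum_norm_le) (simp only: norm_mult mult_left_mono norm_ge_zero)
    then show "cmod (\<Sum>k\<le>n. d k * pair_fun (complex_of_real (p k) * cis \<beta>1) (complex_of_real (p k) * cis \<beta>0)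
      (complex_of_real q * cis \<psi>)) \<le> (\<Sum>k\<le>n. cmod (d k) * (M * (p k / m k))) * (q / (1 + q\<^sup>2))"
      unfolding sum_distrib_right by (simp only: mult.assoc)
  qed
qed

lemma pair_sum_in_H0_inf:
  assumes \<beta>: "\<bar>\<beta>0\<bar> < \<theta>" "\<bar>\<beta>1\<bar> < \<theta>" and \<theta>: "\<theta> < pi" and p: "\<And>k. 0 < p k"
  shows "(\<lambda>z. \<Sum>k\<le>n::nat. d k * pair_fun (complex_of_real (p k) * cis \<beta>1) (complex_of_real (p k) * cis \<beta>0) z)
    \<in> H0_inf \<theta>" (is "?h \<in> _")
proof -
  obtain C where C: "0 \<le> C" and h: "\<And>q \<psi>. 0 \<le> q \<Longrightarrow> \<theta> \<le> \<bar>\<psi>\<bar> \<Longrightarrow> \<bar>\<psi>\<bar> \<le> pi \<Longrightarrow>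
      cmod (?h (complex_of_real q * cis \<psi>)) \<le> C * (q / (1 + q\<^sup>2))"
    by (rule pair_sum_bound[OF \<beta> less_imp_le[OF \<theta>] p, where n = n and d = d]) (rule that)
  \<comment> \<open>\<open>C + 1\<close> because membership in \<open>H0_inf\<close> asks for a
    positive constant.\<close>
  have bound: "cmod (?h z) \<le> (C + 1) * (cmod z / (1 + (cmod z)\<^sup>2)) powr 1" if "z \<in> - sector \<theta>" for z
  proof -
    have nn: "0 \<le> cmod z / (1 + (cmod z)\<^sup>2)" by (simp add: add_nonneg_nonneg)
    have "cmod (?h (complex_of_real (cmod z) * cis (Arg z))) \<le> C * (cmod z / (1 + (cmod z)\<^sup>2))"
      using not_in_sectorD[of z \<theta>] that by (intro h) auto
    then have "cmod (?h z) \<le> C * (cmod z / (1 + (cmod z)\<^sup>2))"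
      unfolding polar_decomposition[symmetric] .
    also have "\<dots> \<le> (C + 1) * (cmod z / (1 + (cmod z)\<^sup>2))"
      using nn by (intro mult_right_mono) auto
    finally show ?thesis
      using nn by simp
  qed
  have in_sector: "complex_of_real (p k) * cis \<beta>0 \<in> sector \<theta>" "complex_of_real (p k) * cis \<beta>1 \<in> sector \<theta>" for k
    using \<beta> \<theta> p[of k] by (auto intro!: sector_polarI)
  have "?h holomorphic_on - sector \<theta>"
    unfolding pair_fun_def using in_sector by (intro holomorphic_intros) auto
  moreover have "bounded (?h ` (- sector \<theta>))"
    unfolding bounded_iff
  proof (intro exI ballI)
    fix y assume "y \<in> ?h ` (- sector \<theta>)"
    then obtain z where z: "z \<in> - sector \<theta>" "y = ?h z" by blast
    have "2 * cmod z \<le> 1 + (cmod z)\<^sup>2"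
      using zero_le_power2[of "cmod z - 1"] by (simp add: power2_eq_square algebra_simps)
    then have "cmod z \<le> 1 + (cmod z)\<^sup>2"
      using norm_ge_zero[of z] by linarith
    then have "cmod z / (1 + (cmod z)\<^sup>2) \<le> 1"
      by (simp add: divide_le_eq_1 add_pos_nonneg)
    then have "(C + 1) * (cmod z / (1 + (cmod z)\<^sup>2)) powr 1 \<le> (C + 1) * 1"
      using C by (intro mult_left_mono) (auto simp: add_nonneg_nonneg)
    with bound[OF z(1)] show "norm y \<le> C + 1"
      by (simp add: z(2))
  qed
  moreover have "\<exists>c>0. \<exists>\<eta>>0. \<forall>z\<in>- sector \<theta>. cmod (?h z) \<le> c * (cmod z / (1 + (cmod z)\<^sup>2)) powr \<eta>"
    by (rule exI[of _ "C + 1"], rule conjI, use C in simp, rule exI[of _ 1], rule conjI, simp)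
      (use bound in blast)
  ultimately show ?thesis
    unfolding H0_inf_def by blast
qed

text \<open>The rays are joined through the complement of the sector, where the kernel has no pole,
  and \<open>z / (\<sigma> - z)\<close> tends to -1 at infinity. The ray at
  \<open>2 * pi - \<theta>\<close> is the ray at \<open>- \<theta>\<close>, whence the
  angle.\<close>

lemma cauchy_kernel_rotation:
  assumes "\<bar>\<beta>\<bar> < \<theta>" "\<theta> < pi" "0 < p"
  defines "\<sigma> \<equiv> complex_of_real p * cis \<beta>"
  shows "((\<lambda>b. integral {0..b} (\<lambda>r. cis \<theta> * (1 / (\<sigma> - complex_of_real r * cis \<theta>)))
       - integral {0..b} (\<lambda>r. cis (- \<theta>) * (1 / (\<sigma> - complex_of_real r * cis (- \<theta>)))))
     \<longlongrightarrow> \<i> * complex_of_real (2 * pi - 2 * \<theta>)) at_top"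
proof -
  have ne: "\<sigma> - w \<noteq> 0" if w_in: "w \<in> wedge \<theta> (2 * pi - \<theta>)" for w
  proof -
    obtain c where c: "0 < c" "\<And>r q \<psi>. 0 \<le> r \<Longrightarrow> 0 \<le> q \<Longrightarrow> \<theta> \<le> \<bar>\<psi>\<bar> \<Longrightarrow> \<bar>\<psi>\<bar> \<le> 2 * pi - \<theta> \<Longrightarrow>
        c * (r + q) \<le> cmod (complex_of_real r * cis \<beta> - complex_of_real q * cis \<psi>)"
      by (rule polar_distance_lower_bound[OF assms(1) less_imp_le[OF assms(2)]]) (rule that)
    obtain q s where w: "w = complex_of_real q * cis s" "0 \<le> q" "\<theta> \<le> s" "s \<le> 2 * pi - \<theta>"
      using w_in unfolding wedge_def atLeastAtMost_iff by blast
    have "0 < c * (p + q)"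
      using c(1) w \<open>0 < p\<close> by (intro mult_pos_pos) auto
    also have "\<dots> \<le> cmod (\<sigma> - w)"
      unfolding w(1) \<sigma>_def using w assms by (intro c(2)) auto
    finally show ?thesis by auto
  qed
  have "((\<lambda>b. integral {0..b} (\<lambda>r. cis (2 * pi - \<theta>) *\<^sub>C (1 / (\<sigma> - complex_of_real r * cis (2 * pi - \<theta>))))
       - integral {0..b} (\<lambda>r. cis \<theta> *\<^sub>C (1 / (\<sigma> - complex_of_real r * cis \<theta>))))
     \<longlongrightarrow> (\<i> * complex_of_real (2 * pi - \<theta> - \<theta>)) *\<^sub>C (-1)) at_top"
  proof (rule ray_rotation_limit[where D = "\<lambda>w. 1 / (\<sigma> - w)\<^sup>2"])
    show "\<theta> \<le> 2 * pi - \<theta>" using assms by simp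
    show "((\<lambda>z. 1 / (\<sigma> - z)) has_derivative (\<lambda>h. h *\<^sub>C (1 / (\<sigma> - w)\<^sup>2))) (at w within wedge \<theta> (2 * pi - \<theta>))"
      if "w \<in> wedge \<theta> (2 * pi - \<theta>)" for w
    proof -
      have "((\<lambda>z. 1 / (\<sigma> - z)) has_field_derivative 1 / (\<sigma> - w)\<^sup>2) (at w within wedge \<theta> (2 * pi - \<theta>))"
        using ne[OF that] by (auto intro!: derivative_eq_intros simp: power2_eq_square)
      then show ?thesis
        unfolding has_field_derivative_def
        by (rule has_derivative_eq_rhs) (simp add: fun_eq_iff scaleC_complex_def)
    qed
    show "continuous_on (wedge \<theta> (2 * pi - \<theta>)) (\<lambda>w. 1 / (\<sigma> - w)\<^sup>2)"
      using ne by (intro continuous_intros) auto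
    have "filterlim (\<lambda>z. \<sigma> + - z) at_infinity at_infinity"
      by (intro tendsto_add_filterlim_at_infinity[OF tendsto_const])
        (simp add: filterlim_at_infinity_conv_norm_at_top filterlim_norm_at_top)
    then have "((\<lambda>z. inverse (\<sigma> - z)) \<longlongrightarrow> 0) at_infinity"
      using filterlim_compose[OF tendsto_inverse_0] by simp
    then have "((\<lambda>z. \<sigma> * inverse (\<sigma> - z) - 1) \<longlongrightarrow> \<sigma> * 0 - 1) at_infinity"
      by (intro tendsto_intros)
    then have "((\<lambda>z. \<sigma> * inverse (\<sigma> - z) - 1) \<longlongrightarrow> -1) (inf at_infinity (principal (wedge \<theta> (2 * pi - \<theta>))))"
      by (simp add: tendsto_mono[OF inf_le1])
    moreover have "eventually (\<lambda>z. \<sigma> * inverse (\<sigma> - z) - 1 = z *\<^sub>C (1 / (\<sigma> - z)))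
        (inf at_infinity (principal (wedge \<theta> (2 * pi - \<theta>))))"
    proof -
      have "\<sigma> * inverse (\<sigma> - z) - 1 = z *\<^sub>C (1 / (\<sigma> - z))" if "z \<in> wedge \<theta> (2 * pi - \<theta>)" for z
        using ne[OF that] by (simp add: scaleC_complex_def divide_inverse[symmetric] divide_diff_eq_iff)
      then show ?thesis
        unfolding eventually_inf_principal by (intro always_eventually) blast
    qed
    ultimately show "((\<lambda>z. z *\<^sub>C (1 / (\<sigma> - z))) \<longlongrightarrow> -1) (inf at_infinity (principal (wedge \<theta> (2 * pi - \<theta>))))"
      by (rule Lim_transform_eventually)
  qed
  moreover have cis: "cis (2 * pi - \<theta>) = cis (- \<theta>)"
    by (simp add: complex_eq_iff cos_diff sin_diff)
  ultimately have "((\<lambda>b. integral {0..b} (\<lambda>r. cis (- \<theta>) * (1 / (\<sigma> - complex_of_real r * cis (- \<theta>))))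
       - integral {0..b} (\<lambda>r. cis \<theta> * (1 / (\<sigma> - complex_of_real r * cis \<theta>))))
     \<longlongrightarrow> - (\<i> * complex_of_real (2 * pi - 2 * \<theta>))) at_top"
    unfolding scaleC_complex_def cis by simp
  from tendsto_minus[OF this] show ?thesis by simp
qed

section \<open>Evaluation of the calculus on sums of kernel differences\<close>

context sectorial_operator
begin

text \<open>By the resolvent identity, \<open>\<tau> / (\<tau> - z) R z = 1 / (\<tau> - z) J \<tau> + R z (J \<tau>)\<close>.
  The rays are rotated into each other outside the sector for the first summand, which
  contributes the angle \<open>2 * pi - 2 * \<theta>\<close>, and inside it for the second one, which contributes
  \<open>2 * \<theta>\<close>; so no residues occur.\<close>

lemma H_calculus_pair_sum:
  fixes p :: "nat \<Rightarrow> real" and d :: "nat \<Rightarrow> complex" and n :: nat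
  assumes \<beta>: "\<bar>\<beta>0\<bar> < \<theta>" "\<bar>\<beta>1\<bar> < \<theta>" and p: "\<And>k. 0 < p k"
  defines "\<rho> \<equiv> \<lambda>k. complex_of_real (p k) * cis \<beta>0" and "\<sigma> \<equiv> \<lambda>k. complex_of_real (p k) * cis \<beta>1"
  shows "H_calculus \<theta> (\<lambda>z. \<Sum>k\<le>n. d k * pair_fun (\<sigma> k) (\<rho> k) z) A
    = (\<lambda>x. \<Sum>k\<le>n. d k *\<^sub>C (J (\<sigma> k) x - J (\<rho> k) x))"
proof
  fix x
  define h where "h z = (\<Sum>k\<le>n. d k * pair_fun (\<sigma> k) (\<rho> k) z)" for z
  define Y where "Y = (\<Sum>k\<le>n. d k *\<^sub>C (J (\<sigma> k) x - J (\<rho> k) x))"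
  define G where "G t r = cis t *\<^sub>C (h (complex_of_real r * cis t) *\<^sub>C R (complex_of_real r * cis t) x)"
    for t r
  have \<theta>_pos: "0 < \<theta>" using \<beta> by linarith
  obtain C where C: "0 \<le> C" and h_bound: "\<And>q \<psi>. 0 \<le> q \<Longrightarrow> \<theta> \<le> \<bar>\<psi>\<bar> \<Longrightarrow> \<bar>\<psi>\<bar> \<le> pi \<Longrightarrow>
      cmod (h (complex_of_real q * cis \<psi>)) \<le> C * (q / (1 + q\<^sup>2))"
    by (rule pair_sum_bound[where p = p and n = n and d = d, OF \<beta> less_imp_le[OF \<theta>(2)] p])
      (rule that[unfolded h_def \<sigma>_def \<rho>_def])
  have in_sector: "\<sigma> k \<in> sector \<theta>" "\<rho> k \<in> sector \<theta>" for k
    unfolding \<sigma>_def \<rho>_def using \<beta> \<theta> p[of k] by (auto intro!: sector_polarI)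
  have ray_in_sector: "complex_of_real r * cis t \<in> sector \<theta>" if "0 \<le> r" "\<bar>t\<bar> = \<theta>" for r t
    using that \<theta> by (intro sector_polarI) auto
  have pole_free: "complex_of_real (p k) * cis \<beta> \<noteq> complex_of_real r * cis t"
    if rt: "0 \<le> r" "\<bar>t\<bar> = \<theta>" "\<bar>\<beta>\<bar> < \<theta>" for r t k \<beta>
  proof -
    obtain c where c: "0 < c" "\<And>r q \<psi>. 0 \<le> r \<Longrightarrow> 0 \<le> q \<Longrightarrow> \<theta> \<le> \<bar>\<psi>\<bar> \<Longrightarrow> \<bar>\<psi>\<bar> \<le> 2 * pi - \<theta> \<Longrightarrow>
        c * (r + q) \<le> cmod (complex_of_real r * cis \<beta> - complex_of_real q * cis \<psi>)"
      by (rule polar_distance_lower_bound[OF \<open>\<bar>\<beta>\<bar> < \<theta>\<close> less_imp_le[OF \<theta>(2)]]) (rule that)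
    have "0 < c * (p k + r)"
      using c(1) p[of k] \<open>0 \<le> r\<close> by (intro mult_pos_pos) auto
    also have "\<dots> \<le> cmod (complex_of_real (p k) * cis \<beta> - complex_of_real r * cis t)"
      using p[of k] \<open>0 \<le> r\<close> \<open>\<bar>t\<bar> = \<theta>\<close> \<theta> by (intro c(2)) auto
    finally show ?thesis by auto
  qed
  have ne: "\<rho> k \<noteq> complex_of_real r * cis t" "\<sigma> k \<noteq> complex_of_real r * cis t"
    if "0 \<le> r" "\<bar>t\<bar> = \<theta>" for r t k
    unfolding \<rho>_def \<sigma>_def by (intro pole_free that \<beta>)+
  have h_cont: "isCont h (complex_of_real r * cis t)" if "0 \<le> r" "\<bar>t\<bar> = \<theta>" for r t
    unfolding h_def pair_fun_def using ne[OF that] by (intro continuous_intros) auto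
  have G_cont: "continuous_on {0..} (G t)" if "\<bar>t\<bar> = \<theta>" for t
  proof -
    have "continuous_on {0..} (\<lambda>r. h (complex_of_real r * cis t))"
      unfolding h_def pair_fun_def using ne[OF _ that] by (intro continuous_intros) auto
    then show ?thesis
      unfolding G_def
      by (intro scaleC.continuous_on continuous_on_R continuous_intros)
        (simp_all add: ray_in_sector[OF _ that])
  qed
  have G_bound: "norm (G t r) \<le> (C * K * norm x) / (1 + r\<^sup>2)" if "0 \<le> r" "\<bar>t\<bar> = \<theta>" for r t
  proof -
    have "norm (G t r) = cmod (h (complex_of_real r * cis t)) * norm (R (complex_of_real r * cis t) x)"
      by (simp add: G_def norm_scaleC)
    also have "\<dots> \<le> C * (r / (1 + r\<^sup>2)) * (K / (1 + cmod (complex_of_real r * cis t)) * norm x)"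
      using that \<theta> C by (intro mult_mono h_bound norm_R ray_in_sector) auto
    also have "\<dots> = (r / (1 + r)) * (C * K * norm x / (1 + r\<^sup>2))"
      using that by (simp add: norm_mult mult_ac)
    also have "\<dots> \<le> 1 * (C * K * norm x / (1 + r\<^sup>2))"
      using that C K by (intro mult_right_mono) (auto simp: divide_le_eq_1)
    finally show ?thesis by simp
  qed
  have ray: "ray_integral \<theta> h A t x = integral {0..} (G t)" if t: "\<bar>t\<bar> = \<theta>" for t
    unfolding ray_integral_def
  \<comment> \<open>One point may be dropped from the integral, and
    \<open>nontangential_limit_ray\<close> speaks of boundary points other than the apex.\<close>
  proof (rule integral_spike[of "{0}"])
    fix r :: real assume "r \<in> {0..} - {0}"
    then show "G t r = (nontangential_limit (- sector \<theta>) h (complex_of_real r * cis t) * cis t) *\<^sub>C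
        R (complex_of_real r * cis t) x"
      using t \<theta>(2) \<theta>_pos h_cont[of r t]
      by (subst nontangential_limit_ray) (auto simp: G_def scaleC_scaleC mult.commute)
  qed simp
  \<comment> \<open>\<open>s\<close> and \<open>T\<close> may grow logarithmically with
    \<open>b\<close>; what converges is their difference between the two rays.\<close>
  define s where "s t \<tau> b = integral {0..b} (\<lambda>r. cis t * (1 / (\<tau> - complex_of_real r * cis t)))" for t b \<tau>
  define T where "T t b = integral {0..b} (\<lambda>r. cis t *\<^sub>C R (complex_of_real r * cis t) Y)" for t b
  have partial: "integral {0..b} (G t)
      = (\<Sum>k\<le>n. d k *\<^sub>C (s t (\<sigma> k) b *\<^sub>C J (\<sigma> k) x - s t (\<rho> k) b *\<^sub>C J (\<rho> k) x)) + T t b"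
    if t: "\<bar>t\<bar> = \<theta>" for t b
  proof (rule integral_unique)
    have eq: "G t r = (\<Sum>k\<le>n. d k *\<^sub>C ((cis t * (1 / (\<sigma> k - complex_of_real r * cis t))) *\<^sub>C J (\<sigma> k) x
          - (cis t * (1 / (\<rho> k - complex_of_real r * cis t))) *\<^sub>C J (\<rho> k) x))
        + cis t *\<^sub>C R (complex_of_real r * cis t) Y" if r: "r \<in> {0..b}" for r
    proof -
      let ?z = "complex_of_real r * cis t"
      have z: "?z \<in> sector \<theta>"
        using r t by (intro ray_in_sector) auto
      have split: "(\<tau> / (\<tau> - ?z)) *\<^sub>C R ?z x = (1 / (\<tau> - ?z)) *\<^sub>C J \<tau> x + R ?z (J \<tau> x)"
        if "\<tau> \<in> sector \<theta>" "\<tau> \<noteq> ?z" for \<tau>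
      proof -
        have "R ?z x = R \<tau> x + (\<tau> - ?z) *\<^sub>C R ?z (R \<tau> x)"
          using resolvent_identity[OF z that(1), of x] by (simp add: algebra_simps)
        then have "(\<tau> / (\<tau> - ?z)) *\<^sub>C R ?z x
            = (\<tau> / (\<tau> - ?z)) *\<^sub>C R \<tau> x + (\<tau> / (\<tau> - ?z) * (\<tau> - ?z)) *\<^sub>C R ?z (R \<tau> x)"
          by (simp add: scaleC.add_right scaleC_scaleC)
        then show ?thesis
          using that z by (simp add: R_scaleC scaleC_scaleC)
      qed
      have "pair_fun (\<sigma> k) (\<rho> k) ?z *\<^sub>C R ?z x
          = (1 / (\<sigma> k - ?z)) *\<^sub>C J (\<sigma> k) x - (1 / (\<rho> k - ?z)) *\<^sub>C J (\<rho> k) x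
            + R ?z (J (\<sigma> k) x - J (\<rho> k) x)" for k
        using r t ne[of r t k] z in_sector[of k]
        by (simp add: pair_fun_def scaleC.diff_left split R_diff)
      then have "h ?z *\<^sub>C R ?z x
          = (\<Sum>k\<le>n. d k *\<^sub>C ((1 / (\<sigma> k - ?z)) *\<^sub>C J (\<sigma> k) x - (1 / (\<rho> k - ?z)) *\<^sub>C J (\<rho> k) x)
            + d k *\<^sub>C R ?z (J (\<sigma> k) x - J (\<rho> k) x))"
        by (simp add: h_def scaleC.sum_left scaleC.add_right flip: scaleC_scaleC)
      also have "\<dots> = (\<Sum>k\<le>n. d k *\<^sub>C ((1 / (\<sigma> k - ?z)) *\<^sub>C J (\<sigma> k) x - (1 / (\<rho> k - ?z)) *\<^sub>C J (\<rho> k) x))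
            + R ?z Y"
        by (simp add: Y_def sum.distrib R_sum[OF z] R_scaleC[OF z])
      finally show ?thesis
        by (simp add: G_def scaleC.add_right scaleC.sum_right scaleC.diff_right scaleC_scaleC mult_ac)
    qed
    have int_s: "((\<lambda>r. cis t * (1 / (\<tau> - complex_of_real r * cis t))) has_integral s t \<tau> b) {0..b}"
      if "\<And>r. 0 \<le> r \<Longrightarrow> \<tau> \<noteq> complex_of_real r * cis t" for \<tau>
      unfolding s_def using that
      by (intro integrable_integral integrable_continuous_real continuous_intros) auto
    have int_T: "((\<lambda>r. cis t *\<^sub>C R (complex_of_real r * cis t) Y) has_integral T t b) {0..b}"
      unfolding T_def
      by (intro integrable_integral integrable_continuous_real scaleC.continuous_on continuous_on_R
          continuous_intros) (simp_all add: ray_in_sector[OF _ t])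
    have "((\<lambda>r. (\<Sum>k\<le>n. d k *\<^sub>C ((cis t * (1 / (\<sigma> k - complex_of_real r * cis t))) *\<^sub>C J (\<sigma> k) x
          - (cis t * (1 / (\<rho> k - complex_of_real r * cis t))) *\<^sub>C J (\<rho> k) x))
        + cis t *\<^sub>C R (complex_of_real r * cis t) Y) has_integral
        (\<Sum>k\<le>n. d k *\<^sub>C (s t (\<sigma> k) b *\<^sub>C J (\<sigma> k) x - s t (\<rho> k) b *\<^sub>C J (\<rho> k) x)) + T t b) {0..b}"
      by (intro has_integral_add has_integral_sum has_integral_diff int_T
          has_integral_linear[OF _ scaleC.bounded_linear_right, unfolded o_def]
          has_integral_linear[OF int_s scaleC.bounded_linear_left, unfolded o_def])
        (use ne t in auto)
    then show "(G t has_integral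
        (\<Sum>k\<le>n. d k *\<^sub>C (s t (\<sigma> k) b *\<^sub>C J (\<sigma> k) x - s t (\<rho> k) b *\<^sub>C J (\<rho> k) x)) + T t b) {0..b}"
      by (rule has_integral_eq[rotated]) (rule eq[symmetric])
  qed
  define c where "c = \<i> * complex_of_real (2 * pi - 2 * \<theta>)"
  have lim_s: "((\<lambda>b. s \<theta> \<tau> b - s (- \<theta>) \<tau> b) \<longlongrightarrow> c) at_top" if \<tau>_in: "\<tau> \<in> range \<sigma> \<union> range \<rho>" for \<tau>
  proof -
    obtain k \<beta> where \<tau>: "\<tau> = complex_of_real (p k) * cis \<beta>" "\<bar>\<beta>\<bar> < \<theta>"
      using \<tau>_in \<beta> by (auto simp: \<sigma>_def \<rho>_def)
    show ?thesis
      unfolding s_def c_def \<tau>(1) by (rule cauchy_kernel_rotation[OF \<tau>(2) \<theta>(2) p])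
  qed
  have lim_T: "((\<lambda>b. T \<theta> b - T (- \<theta>) b) \<longlongrightarrow> (\<i> * complex_of_real (2 * \<theta>)) *\<^sub>C Y) at_top"
    using R_rotation[of "- \<theta>" \<theta> Y] \<theta> by (simp add: T_def)
  have lim_G: "((\<lambda>b. integral {0..b} (G t)) \<longlongrightarrow> integral {0..} (G t)) at_top" if "\<bar>t\<bar> = \<theta>" for t
    using that by (intro improper_integral_limit[OF G_cont G_bound]) auto
  have "((\<lambda>b. integral {0..b} (G \<theta>) - integral {0..b} (G (- \<theta>)))
      \<longlongrightarrow> integral {0..} (G \<theta>) - integral {0..} (G (- \<theta>))) at_top"
    using \<theta> by (intro tendsto_diff lim_G) auto
  moreover have "((\<lambda>b. integral {0..b} (G \<theta>) - integral {0..b} (G (- \<theta>)))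
      \<longlongrightarrow> (2 * of_real pi * \<i>) *\<^sub>C Y) at_top"
  proof -
    have "((\<lambda>b. (\<Sum>k\<le>n. d k *\<^sub>C ((s \<theta> (\<sigma> k) b - s (- \<theta>) (\<sigma> k) b) *\<^sub>C J (\<sigma> k) x
          - (s \<theta> (\<rho> k) b - s (- \<theta>) (\<rho> k) b) *\<^sub>C J (\<rho> k) x)) + (T \<theta> b - T (- \<theta>) b))
        \<longlongrightarrow> (\<Sum>k\<le>n. d k *\<^sub>C (c *\<^sub>C J (\<sigma> k) x - c *\<^sub>C J (\<rho> k) x)) + (\<i> * complex_of_real (2 * \<theta>)) *\<^sub>C Y) at_top"
      by (intro tendsto_add tendsto_sum tendsto_diff scaleC.tendsto tendsto_const lim_s lim_T) auto
    moreover have "(\<Sum>k\<le>n. d k *\<^sub>C ((s \<theta> (\<sigma> k) b - s (- \<theta>) (\<sigma> k) b) *\<^sub>C J (\<sigma> k) x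
          - (s \<theta> (\<rho> k) b - s (- \<theta>) (\<rho> k) b) *\<^sub>C J (\<rho> k) x)) + (T \<theta> b - T (- \<theta>) b)
        = integral {0..b} (G \<theta>) - integral {0..b} (G (- \<theta>))" for b
    proof -
      have "integral {0..b} (G \<theta>) - integral {0..b} (G (- \<theta>)) =
        (\<Sum>k\<le>n. d k *\<^sub>C (s \<theta> (\<sigma> k) b *\<^sub>C J (\<sigma> k) x - s \<theta> (\<rho> k) b *\<^sub>C J (\<rho> k) x)
          - d k *\<^sub>C (s (- \<theta>) (\<sigma> k) b *\<^sub>C J (\<sigma> k) x - s (- \<theta>) (\<rho> k) b *\<^sub>C J (\<rho> k) x))
        + (T \<theta> b - T (- \<theta>) b)"
        using \<theta> by (simp add: partial sum_subtractf)
      then show ?thesis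
        by (simp add: scaleC.diff_left scaleC.diff_right scaleC.add_right algebra_simps)
    qed
    moreover have "(\<Sum>k\<le>n. d k *\<^sub>C (c *\<^sub>C J (\<sigma> k) x - c *\<^sub>C J (\<rho> k) x)) + (\<i> * complex_of_real (2 * \<theta>)) *\<^sub>C Y
        = (2 * of_real pi * \<i>) *\<^sub>C Y"
    proof -
      have "(\<Sum>k\<le>n. d k *\<^sub>C (c *\<^sub>C J (\<sigma> k) x - c *\<^sub>C J (\<rho> k) x)) = c *\<^sub>C Y"
        by (simp add: Y_def scaleC.sum_right scaleC.diff_right scaleC_scaleC mult_ac)
      moreover have "c + \<i> * complex_of_real (2 * \<theta>) = 2 * of_real pi * \<i>"
        by (simp add: c_def algebra_simps)
      ultimately show ?thesis
        by (metis scaleC.add_left)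
    qed
    ultimately show ?thesis by simp
  qed
  ultimately have "integral {0..} (G \<theta>) - integral {0..} (G (- \<theta>)) = (2 * of_real pi * \<i>) *\<^sub>C Y"
    by (rule tendsto_unique[OF trivial_limit_at_top_linorder])
  then have "H_calculus \<theta> h A x = Y"
    using \<theta> ray[of \<theta>] ray[of "- \<theta>"] by (simp add: H_calculus_def scaleC_scaleC)
  then show "H_calculus \<theta> (\<lambda>z. \<Sum>k\<le>n. d k * pair_fun (\<sigma> k) (\<rho> k) z) A x
      = (\<Sum>k\<le>n. d k *\<^sub>C (J (\<sigma> k) x - J (\<rho> k) x))"
    by (simp add: h_def[abs_def] Y_def)
qed

end

subsection \<open>Bounds for sums over blocks\<close>

context sectorial_operator
begin

lemma pair_sum_bounded_linear:
  assumes "\<And>k. \<sigma> k \<in> sector \<theta>" "\<And>k. \<rho> k \<in> sector \<theta>"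
  shows "bounded_linear (\<lambda>x. \<Sum>k\<le>n::nat. d k *\<^sub>C (J (\<sigma> k) x - J (\<rho> k) x))"
  using assms
  by (intro bounded_linear_sum bounded_linear_compose[OF scaleC.bounded_linear_right]
      bounded_linear_sub R_bounded_linear)

text \<open>The supremum of the symbol stays below a constant for every choice of \<open>n\<close>,
  \<open>q\<close> and coefficients in the unit disc, since at each point the summands decay
  geometrically away from one scale. The calculus turns this into unconditional boundedness of the
  operator sums.\<close>

lemma pair_sum_norm_bound:
  assumes calc: "bounded_H_inf_calculus \<theta> A" and \<beta>: "\<bar>\<beta>0\<bar> < \<theta>" "\<bar>\<beta>1\<bar> < \<theta>"
  obtains M where "0 < M" and "\<And>(n::nat) q d x. 0 < q \<Longrightarrow> \<forall>k\<le>n. cmod (d k) \<le> 1 \<Longrightarrow>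
    norm (\<Sum>k\<le>n. d k *\<^sub>C (J (complex_of_real (q * exp (real k)) * cis \<beta>1) x
      - J (complex_of_real (q * exp (real k)) * cis \<beta>0) x)) \<le> M * norm x"
proof -
  obtain C where C: "0 < C" "\<And>f. f \<in> H0_inf \<theta> \<Longrightarrow>
      onorm (H_calculus \<theta> f A) \<le> C * (SUP z \<in> - sector \<theta>. cmod (f z))"
    using calc by (auto simp: bounded_H_inf_calculus_def)
  obtain M where M: "0 < M" "\<And>p q \<psi>. 0 < p \<Longrightarrow> 0 \<le> q \<Longrightarrow> \<theta> \<le> \<bar>\<psi>\<bar> \<Longrightarrow> \<bar>\<psi>\<bar> \<le> pi \<Longrightarrow>
    cmod (pair_fun (complex_of_real p * cis \<beta>1) (complex_of_real p * cis \<beta>0) (complex_of_real q * cis \<psi>))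
      \<le> M * (p * q / (p + q)\<^sup>2)"
    by (rule pair_fun_bound[OF \<beta> less_imp_le[OF \<theta>(2)]]) (rule that)
  show ?thesis
  proof
    show "0 < C * (M * 2)" using C M by simp
    fix n :: nat and q d x
    assume q: "0 < (q::real)" and d: "\<forall>k\<le>n. cmod (d k) \<le> 1"
    define p where "p k = q * exp (real k)" for k :: nat
    have p: "0 < p k" for k using q by (simp add: p_def)
    define h where "h z = (\<Sum>k\<le>n. d k * pair_fun (complex_of_real (p k) * cis \<beta>1) (complex_of_real (p k) * cis \<beta>0) z)" for z
    define F where "F x = (\<Sum>k\<le>n. d k *\<^sub>C (J (complex_of_real (p k) * cis \<beta>1) x
      - J (complex_of_real (p k) * cis \<beta>0) x))" for x
    have "cmod (h z) \<le> M * 2" if z: "z \<in> - sector \<theta>" for z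
    proof -
      have z': "\<theta> \<le> \<bar>Arg z\<bar>" "\<bar>Arg z\<bar> \<le> pi"
        using not_in_sectorD[of z \<theta>] z by auto
      have "cmod (h z) \<le> (\<Sum>k\<le>n. M * (p k * cmod z / (p k + cmod z)\<^sup>2))"
        unfolding h_def
      proof (intro sum_norm_le)
        fix k assume "k \<in> {..n}"
        then have k: "cmod (d k) \<le> 1" using d by simp
        have "cmod (pair_fun (complex_of_real (p k) * cis \<beta>1) (complex_of_real (p k) * cis \<beta>0) z)
            \<le> M * (p k * cmod z / (p k + cmod z)\<^sup>2)"
          using M(2)[OF p[of k] norm_ge_zero[of z] z'] unfolding polar_decomposition[symmetric] .
        from mult_mono[OF k this]
        show "norm (d k * pair_fun (complex_of_real (p k) * cis \<beta>1) (complex_of_real (p k) * cis \<beta>0) z)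
            \<le> M * (p k * cmod z / (p k + cmod z)\<^sup>2)"
          by (simp add: norm_mult)
      qed
      also have "\<dots> = M * (\<Sum>k\<le>n. p k * cmod z / (p k + cmod z)\<^sup>2)"
        by (simp only: sum_distrib_left)
      also have "\<dots> \<le> M * 2"
        using M(1) dyadic_sum_bound[OF q norm_ge_zero[of z], of n] by (intro mult_left_mono) (auto simp: p_def)
      finally show ?thesis .
    qed
    \<comment> \<open>Nonemptiness, so that a bound for every value bounds the supremum.\<close>
    moreover have "- sector \<theta> \<noteq> {}"
    proof -
      have "-1 \<in> - sector \<theta>"
        using \<theta> Arg_cis[of pi] by (simp add: sector_def)
      then show ?thesis by blast
    qed
    ultimately have "(SUP z \<in> - sector \<theta>. cmod (h z)) \<le> M * 2"
      by (intro cSUP_least)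
    moreover have "h \<in> H0_inf \<theta>"
      unfolding h_def[abs_def] by (intro pair_sum_in_H0_inf \<beta> \<theta> p)
    moreover have "H_calculus \<theta> h A = F"
      unfolding h_def[abs_def] F_def[abs_def] by (rule H_calculus_pair_sum[OF \<beta> p])
    ultimately have "onorm F \<le> C * (M * 2)"
      using C(1) by (metis (no_types, lifting) C(2) mult_left_mono less_imp_le order_trans)
    moreover have "norm (F x) \<le> onorm F * norm x"
      unfolding F_def[abs_def] using \<beta> \<theta> p
      by (intro onorm pair_sum_bounded_linear sector_polarI) (auto intro: less_imp_le)
    ultimately have "norm (F x) \<le> C * (M * 2) * norm x"
      by (meson mult_right_mono norm_ge_zero order_trans)
    then show "norm (\<Sum>k\<le>n. d k *\<^sub>C (J (complex_of_real (q * exp (real k)) * cis \<beta>1) x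
      - J (complex_of_real (q * exp (real k)) * cis \<beta>0) x)) \<le> C * (M * 2) * norm x"
      by (simp only: F_def p_def)
  qed
qed

lemma op_inv_one_plus:
  assumes z: "z \<in> sector \<theta>" "z \<noteq> 0"
  shows "op_inv (op_add op_id (op_scale (1 / z) A)) x = J z x"
proof -
  have "inv_into (op_dom A) (\<lambda>x. x + (1 / z) *\<^sub>C op_app A x) x = J z x"
  proof (rule inv_into_f_eq)
    show "inj_on (\<lambda>x. x + (1 / z) *\<^sub>C op_app A x) (op_dom A)"
    proof (rule inj_onI)
      fix u v assume uv: "u \<in> op_dom A" "v \<in> op_dom A"
        and "u + (1 / z) *\<^sub>C op_app A u = v + (1 / z) *\<^sub>C op_app A v"
      then have "z *\<^sub>C (u + (1 / z) *\<^sub>C op_app A u) = z *\<^sub>C (v + (1 / z) *\<^sub>C op_app A v)"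
        by simp
      then have "op_app A u + z *\<^sub>C u = op_app A v + z *\<^sub>C v"
        using z by (simp add: scaleC.add_right scaleC_scaleC add.commute)
      then show "u = v"
        using shifted_inv_app[OF sector_resolvent[OF z(1)]] uv by metis
    qed
    show "J z x \<in> op_dom A"
      using R_dom[OF z(1)] by (intro linear_operatorD(3)[OF linear])
    show "J z x + (1 / z) *\<^sub>C op_app A (J z x) = x"
      using z linear_operatorD(4)[OF linear R_dom[OF z(1), of x] R_dom[OF z(1)]]
      by (simp add: app_R scaleC_scaleC)
  qed
  then show ?thesis
    by (simp add: op_inv_def op_add_def op_id_def op_scale_def)
qed

text \<open>The reciprocal of \<open>q * exp k * cis \<alpha>\<close> is
  \<open>r * exp (- k) * cis (- \<alpha>)\<close> with \<open>r = 1 / q\<close>: the angle changes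
  sign, and the interval \<open>[1/e, 1]\<close> for \<open>r\<close> becomes the fundamental block
  \<open>[1, e]\<close> for \<open>q\<close>.\<close>

lemma T_sectorial_ray:
  assumes T: "A \<in> T_sectorial \<theta>" and \<alpha>: "\<bar>\<alpha>\<bar> \<le> \<theta>"
  obtains p C where "1 < p" "0 < C" and "\<And>(n::nat) q x. 1 \<le> q \<Longrightarrow> q \<le> exp 1 \<Longrightarrow>
    \<exists>a. (\<forall>k\<le>n. a k \<in> Linf_unit_ball) \<and>
      Lp_norm p (\<lambda>t. \<Sum>k\<le>n. cis (real k * t) *\<^sub>C J (complex_of_real (q * exp (real k)) * cis \<alpha>) (x k))
      \<le> C * Lp_norm p (\<lambda>t. \<Sum>k\<le>n. a k t *\<^sub>C x k)"
proof -
  obtain p where p: "1 < p" and "\<forall>\<phi>\<in>{-\<theta>..\<theta>}. \<exists>C>0. \<forall>(n::nat). \<forall>r\<in>{exp (-1)..1}. \<forall>x :: nat \<Rightarrow> 'a.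
      \<exists>a :: nat \<Rightarrow> real \<Rightarrow> complex. (\<forall>k\<le>n. a k \<in> Linf_unit_ball) \<and>
        Lp_norm p (\<lambda>t. \<Sum>k\<le>n. cis (real k * t) *\<^sub>C
          op_inv (op_add op_id (op_scale (complex_of_real (r * exp (- real k)) * cis \<phi>) A)) (x k))
        \<le> C * Lp_norm p (\<lambda>t. \<Sum>k\<le>n. a k t *\<^sub>C x k)"
    using T unfolding T_sectorial_def by blast
  moreover have "- \<alpha> \<in> {-\<theta>..\<theta>}"
    using \<alpha> by auto
  ultimately obtain C where C: "0 < C" "\<forall>(n::nat). \<forall>r\<in>{exp (-1)..1}. \<forall>x :: nat \<Rightarrow> 'a.
      \<exists>a :: nat \<Rightarrow> real \<Rightarrow> complex. (\<forall>k\<le>n. a k \<in> Linf_unit_ball) \<and>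
        Lp_norm p (\<lambda>t. \<Sum>k\<le>n. cis (real k * t) *\<^sub>C
          op_inv (op_add op_id (op_scale (complex_of_real (r * exp (- real k)) * cis (- \<alpha>)) A)) (x k))
        \<le> C * Lp_norm p (\<lambda>t. \<Sum>k\<le>n. a k t *\<^sub>C x k)"
    by blast
  show ?thesis
  proof (rule that[OF p C(1)])
    fix n :: nat and q :: real and x :: "nat \<Rightarrow> 'a"
    assume q: "1 \<le> q" "q \<le> exp 1"
    have "op_inv (op_add op_id (op_scale (complex_of_real (1 / q * exp (- real k)) * cis (- \<alpha>)) A)) y
        = J (complex_of_real (q * exp (real k)) * cis \<alpha>) y" for k :: nat and y
    proof -
      have "complex_of_real (1 / q * exp (- real k)) * cis (- \<alpha>)
          = 1 / (complex_of_real (q * exp (real k)) * cis \<alpha>)"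
        using q by (simp add: exp_minus cis_inverse[symmetric] field_simps)
      moreover have "complex_of_real (q * exp (real k)) * cis \<alpha> \<in> sector \<theta>"
        using q \<alpha> \<theta> by (intro sector_polarI) auto
      ultimately show ?thesis
        using q by (simp only:) (rule op_inv_one_plus, auto)
    qed
    moreover have "1 / q \<in> {exp (-1)..1}"
      using q by (auto simp: exp_minus field_simps)
    ultimately show "\<exists>a. (\<forall>k\<le>n. a k \<in> Linf_unit_ball) \<and>
      Lp_norm p (\<lambda>t. \<Sum>k\<le>n. cis (real k * t) *\<^sub>C J (complex_of_real (q * exp (real k)) * cis \<alpha>) (x k))
      \<le> C * Lp_norm p (\<lambda>t. \<Sum>k\<le>n. a k t *\<^sub>C x k)"
      using C(2)[rule_format, of "1 / q" n x] by (simp only:)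
  qed
qed

end

section \<open>Lp norms, Fourier orthogonality and exponential blocks\<close>

lemma Lp_norm_le_const:
  assumes p: "0 < p" and M: "0 \<le> M"
    and le: "AE t in lebesgue_on {0<..<2*pi}. norm (g t) \<le> M"
  shows "Lp_norm p g \<le> (2 * pi) powr (1 / p) * M"
proof -
  let ?L = "lebesgue_on {0<..<2*pi}"
  interpret finite_measure ?L
    by (rule finite_measure_lebesgue_on) (auto simp: fmeasurable_def)
  have "(\<integral>t. norm (g t) powr p \<partial>?L) \<le> M powr p * (2 * pi)"
  proof (cases "integrable ?L (\<lambda>t. norm (g t) powr p)")
    case True
    have "(\<integral>t. norm (g t) powr p \<partial>?L) \<le> (\<integral>t. M powr p \<partial>?L)"
    proof (intro integral_mono_AE True integrable_const)
      show "AE t in ?L. norm (g t) powr p \<le> M powr p"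
        using le by eventually_elim (use p in \<open>auto intro: powr_mono2\<close>)
    qed
    also have "\<dots> = M powr p * (2 * pi)"
      by (simp add: measure_restrict_space mult.commute)
    finally show ?thesis .
  next
    \<comment> \<open>Measurability of \<open>g\<close> is not assumed; if the function is not
      integrable, its Bochner integral is 0 by convention and the bound still holds.\<close>
    case False
    then show ?thesis by (simp add: not_integrable_integral_eq)
  qed
  then have "Lp_norm p g \<le> (M powr p * (2 * pi)) powr (1 / p)"
    unfolding Lp_norm_def using p by (intro powr_mono2) (auto intro: integral_nonneg_AE)
  also have "\<dots> = (2 * pi) powr (1 / p) * M"
    using p M by (simp add: powr_mult powr_powr mult.commute)
  finally show ?thesis .
qed

text \<open>In place of Hoelder's inequality: \<open>x <= l + x^p * l^(1 - p)\<close> holds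
  pointwise, by cases on \<open>x <= l\<close>, and integrates to at most
  \<open>2 * pi * l + l\<close>.\<close>

lemma integral_norm_le_Lp_norm:
  fixes g :: "real \<Rightarrow> 'a::banach"
  assumes g: "continuous_on {0..2*pi} g" and p: "1 < p" and l: "0 < l" and le: "Lp_norm p g \<le> l"
  shows "integral {0..2*pi} (\<lambda>t. norm (g t)) \<le> (2 * pi + 1) * l"
proof -
  let ?I = "{0<..<2*pi}"
  let ?f = "\<lambda>t. norm (g t) powr p"
  have f: "continuous_on {0..2*pi} ?f"
    using p g by (intro continuous_on_powr' continuous_intros) auto
  have "?f absolutely_integrable_on ?I"
    by (rule set_integrable_subset[OF absolutely_integrable_continuous_real[OF f]]) auto
  then have "integrable (lebesgue_on ?I) ?f"
    by (simp add: integrable_restrict_space set_integrable_def)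
  then have eq: "(\<integral>t. ?f t \<partial>lebesgue_on ?I) = integral {0..2*pi} ?f"
    by (subst lebesgue_integral_eq_integral) (auto simp: integral_open_interval_real)
  have "(integral {0..2*pi} ?f) powr (1 / p) \<le> l"
    using le by (simp add: Lp_norm_def eq)
  moreover have nonneg: "0 \<le> integral {0..2*pi} ?f"
    by (intro integral_nonneg integrable_continuous_real f) auto
  ultimately have "((integral {0..2*pi} ?f) powr (1 / p)) powr p \<le> l powr p"
    using p by (intro powr_mono2) auto
  then have int_le: "integral {0..2*pi} ?f \<le> l powr p"
    using p nonneg by (simp add: powr_powr)
  have pointwise: "norm (g t) \<le> l + ?f t * l powr (1 - p)" for t
  proof (cases "norm (g t) \<le> l")
    case True
    then show ?thesis by (simp add: add_increasing2)
  next
    case False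
    then have "norm (g t) = norm (g t) powr p * norm (g t) powr (1 - p)"
      using l by (simp add: powr_add[symmetric])
    also have "\<dots> \<le> norm (g t) powr p * l powr (1 - p)"
      using False l p by (intro mult_left_mono powr_mono2') auto
    finally show ?thesis using l by linarith
  qed
  have "integral {0..2*pi} (\<lambda>t. norm (g t)) \<le> integral {0..2*pi} (\<lambda>t. l + ?f t * l powr (1 - p))"
    by (intro integral_le integrable_continuous_real continuous_on_add continuous_on_mult
        continuous_on_const continuous_on_norm g f pointwise)
  also have "\<dots> = 2 * pi * l + integral {0..2*pi} ?f * l powr (1 - p)"
    by (subst integral_add)
      (auto intro!: integrable_continuous_real continuous_on_mult continuous_on_const f)
  also have "\<dots> \<le> 2 * pi * l + l powr p * l powr (1 - p)"
    using int_le by (intro add_left_mono mult_right_mono) auto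
  also have "\<dots> = (2 * pi + 1) * l"
    using l by (simp add: powr_add[symmetric] algebra_simps)
  finally show ?thesis .
qed

lemma has_integral_cis_int:
  "((\<lambda>t. cis (real_of_int m * t)) has_integral (if m = 0 then complex_of_real (2 * pi) else 0)) {0..2*pi}"
proof (cases "m = 0")
  case True
  have "((\<lambda>t::real. 1::complex) has_integral (2 * pi - 0) *\<^sub>R 1) {0..2*pi}"
    using has_integral_const_real[of "1::complex" 0 "2*pi"] by simp
  with True show ?thesis by (simp add: scaleR_conv_of_real)
next
  case False
  have "((\<lambda>t. cis (real_of_int m * t)) has_integral
      cis (real_of_int m * (2 * pi)) / (\<i> * of_int m) - cis (real_of_int m * 0) / (\<i> * of_int m)) {0..2*pi}"
  proof (rule fundamental_theorem_of_calculus)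
    fix t
    have "((\<lambda>t. cis (real_of_int m * t)) has_vector_derivative real_of_int m *\<^sub>R (\<i> * cis (real_of_int m * t)))
        (at t within {0..2*pi})"
      unfolding has_vector_derivative_def
      by (auto intro!: derivative_eq_intros simp: mult.commute)
    from has_vector_derivative_divide[OF this, of "\<i> * of_int m"]
    show "((\<lambda>t. cis (real_of_int m * t) / (\<i> * of_int m)) has_vector_derivative cis (real_of_int m * t))
        (at t within {0..2*pi})"
      using False by (simp add: scaleR_conv_of_real)
  qed simp
  moreover have "cis (real_of_int m * (2 * pi)) = 1"
    using cis_multiple_2pi[of "real_of_int m"] by (simp add: mult.commute)
  ultimately show ?thesis
    using False by simp
qed

text \<open>With \<open>w j k = g j (v k)\<close> this separates the two operator factors of each
  diagonal term into two sums that are estimated independently for fixed \<open>t\<close>.\<close>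

lemma fourier_orthogonality:
  fixes w :: "nat \<Rightarrow> nat \<Rightarrow> 'a::complex_banach"
  shows "((\<lambda>t. \<Sum>j\<le>n. \<Sum>k\<le>n. (cis (- real j * t) * cis (real k * t)) *\<^sub>C w j k)
    has_integral (2 * pi) *\<^sub>R (\<Sum>k\<le>n. w k k)) {0..2*pi}"
proof -
  have *: "((\<lambda>t. (cis (- real j * t) * cis (real k * t)) *\<^sub>C w j k) has_integral
      (if j = k then complex_of_real (2 * pi) else 0) *\<^sub>C w j k) {0..2*pi}" for j k
  proof -
    have "cis (- real j * t) * cis (real k * t) = cis (real_of_int (int k - int j) * t)" for t
      by (simp add: cis_mult algebra_simps)
    moreover have "int k - int j = 0 \<longleftrightarrow> j = k"
      by auto
    ultimately have "((\<lambda>t. cis (- real j * t) * cis (real k * t)) has_integral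
        (if j = k then complex_of_real (2 * pi) else 0)) {0..2*pi}"
      using has_integral_cis_int[of "int k - int j"] by (simp only:)
    from has_integral_linear[OF this scaleC.bounded_linear_left, unfolded o_def]
    show ?thesis .
  qed
  have "((\<lambda>t. \<Sum>j\<le>n. \<Sum>k\<le>n. (cis (- real j * t) * cis (real k * t)) *\<^sub>C w j k) has_integral
      (\<Sum>j\<le>n. \<Sum>k\<le>n. (if j = k then complex_of_real (2 * pi) else 0) *\<^sub>C w j k)) {0..2*pi}"
    by (intro has_integral_sum *) auto
  also have "(\<Sum>j\<le>n. \<Sum>k\<le>n. (if j = k then complex_of_real (2 * pi) else 0) *\<^sub>C w j k)
      = (\<Sum>j\<le>n. \<Sum>k\<le>n. if j = k then (2 * pi) *\<^sub>R w j k else 0)"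
    by (intro sum.cong refl) (simp add: scaleR_scaleC)
  also have "\<dots> = (2 * pi) *\<^sub>R (\<Sum>k\<le>n. w k k)"
    by (simp add: sum.delta scaleR_sum_right)
  finally show ?thesis .
qed

text \<open>The substitution \<open>r = exp k * q\<close> maps every block onto
  \<open>[1, e]\<close>, so that the sum over the blocks stands inside one integral and can be
  estimated for each fixed \<open>q\<close>.\<close>

lemma integral_exp_blocks:
  fixes N :: "real \<Rightarrow> 'a::banach"
  assumes N: "continuous_on {0..} N"
  shows "integral {0..exp (real (Suc n))} N
    = integral {0..1} N + integral {1..exp 1} (\<lambda>q. \<Sum>k\<le>n. exp (real k) *\<^sub>R N (exp (real k) * q))"
proof -
  have block: "integral {exp (real k)..exp (real (Suc k))} N
      = integral {1..exp 1} (\<lambda>q. exp (real k) *\<^sub>R N (exp (real k) * q))" for k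
  proof -
    have img: "(\<lambda>x. x / exp (real k)) ` {exp (real k)..exp (real (Suc k))} = {1..exp 1}"
      by (simp add: exp_diff[symmetric])
    have "(N has_integral integral {exp (real k)..exp (real (Suc k))} N) {exp (real k)..exp (real (Suc k))}"
      by (intro integrable_integral integrable_continuous_real continuous_on_subset[OF N])
        (auto intro: order_trans[OF exp_ge_zero])
    from has_integral_stretch_real[OF this, of "exp (real k)"]
    have "((\<lambda>q. N (exp (real k) * q)) has_integral
        (1 / exp (real k)) *\<^sub>R integral {exp (real k)..exp (real (Suc k))} N) {1..exp 1}"
      by (simp only: img) simp
    from has_integral_cmul[OF this, of "exp (real k)"]
    have "((\<lambda>q. exp (real k) *\<^sub>R N (exp (real k) * q)) has_integral
        integral {exp (real k)..exp (real (Suc k))} N) {1..exp 1}"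
      by simp
    then show ?thesis
      by (rule integral_unique[symmetric])
  qed
  have split: "integral {0..exp (real (Suc n))} N
    = integral {0..1} N + (\<Sum>k\<le>n. integral {exp (real k)..exp (real (Suc k))} N)" for n
  proof (induction n)
    case 0
    show ?case
      using Henstock_Kurzweil_Integration.integral_combine[of 0 1 "exp 1" N]
      by (simp add: integrable_continuous_real continuous_on_subset[OF N])
  next
    case (Suc n)
    have "integral {0..exp (real (Suc (Suc n)))} N = integral {0..exp (real (Suc n))} N
        + integral {exp (real (Suc n))..exp (real (Suc (Suc n)))} N"
      by (intro Henstock_Kurzweil_Integration.integral_combine[symmetric] integrable_continuous_real
          continuous_on_subset[OF N]) auto
    with Suc show ?case by (simp add: add.assoc)
  qed
  have "(\<Sum>k\<le>n. integral {1..exp 1} (\<lambda>q. exp (real k) *\<^sub>R N (exp (real k) * q)))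
      = integral {1..exp 1} (\<lambda>q. \<Sum>k\<le>n. exp (real k) *\<^sub>R N (exp (real k) * q))"
    by (intro integral_sum[symmetric] integrable_continuous_real continuous_intros
        continuous_on_compose2[OF N]) auto
  then show ?thesis
    unfolding split block by (simp only:)
qed

section \<open>Sums over blocks for a commuting pair\<close>

locale commuting_pair = SA: sectorial_operator A \<theta>A KA + SB: sectorial_operator B \<theta>B KB
  for A B :: "'a::complex_banach operator" and \<theta>A KA \<theta>B KB :: real +
  assumes comm: "z \<in> sector \<theta>A \<Longrightarrow> w \<in> sector \<theta>B \<Longrightarrow>
    shifted_inv A z (shifted_inv B w x) = shifted_inv B w (shifted_inv A z x)"
begin

text \<open>This is \<open>pair_fun\<close> at \<open>-B\<close> with both poles of modulus
  \<open>r\<close>, and 0 at \<open>r = 0\<close>.\<close>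

definition diff_J :: "real \<Rightarrow> real \<Rightarrow> real \<Rightarrow> 'a \<Rightarrow> 'a" where
  "diff_J b c r x = SB.J (complex_of_real r * cis b) x - SB.J (complex_of_real r * cis c) x"

text \<open>Both uses of the calculus take place at fixed \<open>t\<close>: the coefficients are the
  unknown values \<open>a k t\<close> in the first and the exponentials in the second. Hence the
  bound depends neither on \<open>n\<close> nor on \<open>q\<close>.\<close>

lemma block_bound:
  assumes T: "A \<in> T_sectorial \<theta>A" and H: "bounded_H_inf_calculus \<theta>B B"
    and \<alpha>: "\<bar>\<alpha>\<bar> \<le> \<theta>A" and \<beta>: "\<bar>\<beta>0\<bar> < \<theta>B" "\<bar>\<beta>1\<bar> < \<theta>B" "\<bar>\<beta>2\<bar> < \<theta>B" "\<bar>\<beta>3\<bar> < \<theta>B"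
  obtains M where "0 \<le> M" and "\<And>(n::nat) q y. 1 \<le> q \<Longrightarrow> q \<le> exp 1 \<Longrightarrow>
    norm (\<Sum>k\<le>n. SA.J (complex_of_real (q * exp (real k)) * cis \<alpha>)
      (diff_J \<beta>1 \<beta>0 (q * exp (real k)) (diff_J \<beta>3 \<beta>2 (q * exp (real k)) y))) \<le> M * norm y"
proof -
  obtain Mf where Mf: "0 < Mf" "\<And>(n::nat) q d x. 0 < q \<Longrightarrow> \<forall>k\<le>n. cmod (d k) \<le> 1 \<Longrightarrow>
      norm (\<Sum>k\<le>n. d k *\<^sub>C (SB.J (complex_of_real (q * exp (real k)) * cis \<beta>1) x
        - SB.J (complex_of_real (q * exp (real k)) * cis \<beta>0) x)) \<le> Mf * norm x"
    by (rule SB.pair_sum_norm_bound[OF H \<beta>(1,2)]) (rule that)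
  obtain Mg where Mg: "0 < Mg" "\<And>(n::nat) q d x. 0 < q \<Longrightarrow> \<forall>k\<le>n. cmod (d k) \<le> 1 \<Longrightarrow>
      norm (\<Sum>k\<le>n. d k *\<^sub>C (SB.J (complex_of_real (q * exp (real k)) * cis \<beta>3) x
        - SB.J (complex_of_real (q * exp (real k)) * cis \<beta>2) x)) \<le> Mg * norm x"
    by (rule SB.pair_sum_norm_bound[OF H \<beta>(3,4)]) (rule that)
  obtain p C where p: "1 < p" and C: "0 < C" and Lp: "\<And>(n::nat) q x. 1 \<le> q \<Longrightarrow> q \<le> exp 1 \<Longrightarrow>
    \<exists>a. (\<forall>k\<le>n. a k \<in> Linf_unit_ball) \<and>
      Lp_norm p (\<lambda>t. \<Sum>k\<le>n. cis (real k * t) *\<^sub>C SA.J (complex_of_real (q * exp (real k)) * cis \<alpha>) (x k))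
      \<le> C * Lp_norm p (\<lambda>t. \<Sum>k\<le>n. a k t *\<^sub>C x k)"
    by (rule SA.T_sectorial_ray[OF T \<alpha>]) (rule that)
  define L where "L = C * ((2 * pi) powr (1 / p) * Mf)"
  \<comment> \<open>Relative to the norm of \<open>y\<close>, \<open>L\<close> bounds the Lp norm of
    \<open>\<Phi>\<close> and \<open>2 * pi + 1\<close> passes to its L1 norm; \<open>Mg\<close> is
    the cost of the second factor, and dividing by \<open>2 * pi\<close> undoes the Fourier
    integral.\<close>
  define M where "M = Mg * ((2 * pi + 1) * L) / (2 * pi)"
  have L: "0 < L"
    using C Mf by (simp add: L_def)
  show ?thesis
  proof
    show "0 \<le> M"
      using L Mg by (simp add: M_def)
    fix n :: nat and q :: real and y
    assume q: "1 \<le> q" "q \<le> exp 1"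
    define z where "z k = complex_of_real (q * exp (real k)) * cis \<alpha>" for k :: nat
    define f where "f k = diff_J \<beta>1 \<beta>0 (q * exp (real k))" for k :: nat
    define g where "g k = diff_J \<beta>3 \<beta>2 (q * exp (real k))" for k :: nat
    define v where "v k = SA.J (z k) (f k y)" for k
    define \<Phi> where "\<Phi> t = (\<Sum>k\<le>n. cis (real k * t) *\<^sub>C v k)" for t
    have z: "z k \<in> sector \<theta>A" for k
      unfolding z_def using \<alpha> q SA.\<theta> by (intro sector_polarI) auto
    have in_B: "complex_of_real (q * exp (real k)) * cis b \<in> sector \<theta>B" if "\<bar>b\<bar> < \<theta>B" for b and k :: nat
      using that q SB.\<theta> by (intro sector_polarI) auto
    note B_sector = in_B[OF \<beta>(1)] in_B[OF \<beta>(2)] in_B[OF \<beta>(3)] in_B[OF \<beta>(4)]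
    have g_sum: "g j (\<Sum>k\<le>n. c k *\<^sub>C u k) = (\<Sum>k\<le>n. c k *\<^sub>C g j (u k))" for j c u
      unfolding g_def diff_J_def using B_sector[of j]
      by (simp add: SB.R_sum SB.R_scaleC scaleC.sum_right scaleC.diff_right scaleC_scaleC mult.commute
          sum_subtractf)
    have g_comm: "g k (v k) = SA.J (z k) (f k (g k y))" for k
      unfolding v_def g_def f_def diff_J_def using B_sector[of k] z[of k]
      by (simp add: SB.R_diff SB.R_scaleC SA.R_diff SA.R_scaleC comm scaleC.diff_right scaleC_scaleC
          mult_ac SB.R_commute)
    have eq: "(2 * pi) *\<^sub>R (\<Sum>k\<le>n. SA.J (z k) (f k (g k y)))
        = integral {0..2*pi} (\<lambda>t. \<Sum>j\<le>n. cis (- real j * t) *\<^sub>C g j (\<Phi> t))"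
    proof -
      have "(\<Sum>j\<le>n. cis (- real j * t) *\<^sub>C g j (\<Phi> t))
          = (\<Sum>j\<le>n. \<Sum>k\<le>n. (cis (- real j * t) * cis (real k * t)) *\<^sub>C g j (v k))" for t
        by (simp add: \<Phi>_def g_sum scaleC.sum_right scaleC_scaleC)
      then show ?thesis
        using integral_unique[OF fourier_orthogonality[of "\<lambda>j k. g j (v k)" n]]
        by (simp add: g_comm)
    qed
    have \<Phi>_cont: "continuous_on {0..2*pi} \<Phi>"
      unfolding \<Phi>_def by (intro continuous_intros scaleC.continuous_on)
    have \<Phi>_le: "integral {0..2*pi} (\<lambda>t. norm (\<Phi> t)) \<le> (2 * pi + 1) * (L * norm y)"
    \<comment> \<open>\<open>integral_norm_le_Lp_norm\<close> takes a positive bound, hence the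
      separate case.\<close>
    proof (cases "y = 0")
      case True
      have "f k 0 = 0" "SA.R (z k) 0 = 0" for k
        unfolding f_def diff_J_def using B_sector[of k] z[of k] by (simp_all add: SB.R_zero SA.R_zero)
      with True show ?thesis
        by (simp add: \<Phi>_def v_def)
    next
      case False
      obtain a where a: "\<forall>k\<le>n. a k \<in> Linf_unit_ball" and le: "Lp_norm p \<Phi> \<le> C * Lp_norm p (\<lambda>t. \<Sum>k\<le>n. a k t *\<^sub>C f k y)"
        using Lp[OF q, of n "\<lambda>k. f k y"] unfolding \<Phi>_def v_def z_def by blast
      \<comment> \<open>Finitely many null sets are discarded at once; elsewhere the values
        \<open>a k t\<close> are admissible coefficients for \<open>Mf\<close>.\<close>
      have "AE t in lebesgue_on {0<..<2*pi}. \<forall>k\<in>{..n}. cmod (a k t) \<le> 1"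
        using a by (intro AE_finite_allI) (auto simp: Linf_unit_ball_def)
      then have "AE t in lebesgue_on {0<..<2*pi}. norm (\<Sum>k\<le>n. a k t *\<^sub>C f k y) \<le> Mf * norm y"
        unfolding f_def diff_J_def by eventually_elim (rule Mf(2), use q in auto)
      then have "Lp_norm p (\<lambda>t. \<Sum>k\<le>n. a k t *\<^sub>C f k y) \<le> (2 * pi) powr (1 / p) * (Mf * norm y)"
        using p Mf by (intro Lp_norm_le_const) auto
      then have "C * Lp_norm p (\<lambda>t. \<Sum>k\<le>n. a k t *\<^sub>C f k y) \<le> C * ((2 * pi) powr (1 / p) * (Mf * norm y))"
        using C by (intro mult_left_mono) auto
      with le have "Lp_norm p \<Phi> \<le> L * norm y"
        by (simp add: L_def mult_ac)
      then show ?thesis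
        using False L by (intro integral_norm_le_Lp_norm[OF \<Phi>_cont p]) auto
    qed
    have "norm ((2 * pi) *\<^sub>R (\<Sum>k\<le>n. SA.J (z k) (f k (g k y)))) \<le> integral {0..2*pi} (\<lambda>t. Mg * norm (\<Phi> t))"
      unfolding eq
    proof (rule integral_norm_bound_integral)
      have "(\<lambda>t. \<Sum>j\<le>n. \<Sum>k\<le>n. (cis (- real j * t) * cis (real k * t)) *\<^sub>C g j (v k)) integrable_on {0..2*pi}"
        by (rule has_integral_integrable[OF fourier_orthogonality])
      then show "(\<lambda>t. \<Sum>j\<le>n. cis (- real j * t) *\<^sub>C g j (\<Phi> t)) integrable_on {0..2*pi}"
        by (simp add: \<Phi>_def g_sum scaleC.sum_right scaleC_scaleC)
      show "(\<lambda>t. Mg * norm (\<Phi> t)) integrable_on {0..2*pi}"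
        by (intro integrable_continuous_real continuous_intros \<Phi>_cont)
      show "norm (\<Sum>j\<le>n. cis (- real j * t) *\<^sub>C g j (\<Phi> t)) \<le> Mg * norm (\<Phi> t)" for t
        unfolding g_def diff_J_def using q by (intro Mg(2)) auto
    qed
    also have "\<dots> = Mg * integral {0..2*pi} (\<lambda>t. norm (\<Phi> t))"
      by simp
    also have "\<dots> \<le> Mg * ((2 * pi + 1) * (L * norm y))"
      using Mg \<Phi>_le by (intro mult_left_mono) auto
    finally have "norm (\<Sum>k\<le>n. SA.J (z k) (f k (g k y))) \<le> M * norm y"
      by (simp add: M_def pos_le_divide_eq mult_ac)
    then show "norm (\<Sum>k\<le>n. SA.J (complex_of_real (q * exp (real k)) * cis \<alpha>)
      (diff_J \<beta>1 \<beta>0 (q * exp (real k)) (diff_J \<beta>3 \<beta>2 (q * exp (real k)) y))) \<le> M * norm y"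
      by (simp only: z_def f_def g_def)
  qed
qed

definition block_kernel :: "real \<Rightarrow> real \<Rightarrow> real \<Rightarrow> real \<Rightarrow> real \<Rightarrow> real \<Rightarrow> 'a \<Rightarrow> 'a" where
  "block_kernel \<alpha> \<beta>0 \<beta>1 \<beta>2 \<beta>3 r y = cis \<alpha> *\<^sub>C
     SA.R (complex_of_real r * cis \<alpha>) (diff_J \<beta>1 \<beta>0 r (diff_J \<beta>3 \<beta>2 r y))"

lemma block_kernel_continuous:
  assumes "\<bar>\<alpha>\<bar> \<le> \<theta>A" "\<bar>\<beta>0\<bar> \<le> \<theta>B" "\<bar>\<beta>1\<bar> \<le> \<theta>B" "\<bar>\<beta>2\<bar> \<le> \<theta>B" "\<bar>\<beta>3\<bar> \<le> \<theta>B"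
  shows "continuous_on {0..} (\<lambda>r. block_kernel \<alpha> \<beta>0 \<beta>1 \<beta>2 \<beta>3 r y)"
  unfolding block_kernel_def diff_J_def using assms SA.\<theta> SB.\<theta>
  by (intro scaleC.continuous_on continuous_intros SA.continuous_on_R SB.continuous_on_R sector_polarI) auto

text \<open>Near the origin the resolvent bounds suffice. The truncation points are ends of blocks,
  so that the remainder consists of whole blocks.\<close>

lemma block_integral_bound:
  assumes T: "A \<in> T_sectorial \<theta>A" and H: "bounded_H_inf_calculus \<theta>B B"
    and \<alpha>: "\<bar>\<alpha>\<bar> \<le> \<theta>A" and \<beta>: "\<bar>\<beta>0\<bar> < \<theta>B" "\<bar>\<beta>1\<bar> < \<theta>B" "\<bar>\<beta>2\<bar> < \<theta>B" "\<bar>\<beta>3\<bar> < \<theta>B"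
  obtains M where "\<And>(n::nat) y. norm (integral {0..exp (real (Suc n))} (\<lambda>r. block_kernel \<alpha> \<beta>0 \<beta>1 \<beta>2 \<beta>3 r y)) \<le> M * norm y"
proof -
  obtain M where M: "0 \<le> M" "\<And>(n::nat) q y. 1 \<le> q \<Longrightarrow> q \<le> exp 1 \<Longrightarrow>
    norm (\<Sum>k\<le>n. SA.J (complex_of_real (q * exp (real k)) * cis \<alpha>)
      (diff_J \<beta>1 \<beta>0 (q * exp (real k)) (diff_J \<beta>3 \<beta>2 (q * exp (real k)) y))) \<le> M * norm y"
    by (rule block_bound[OF assms]) (rule that)
  let ?N = "\<lambda>y r. block_kernel \<alpha> \<beta>0 \<beta>1 \<beta>2 \<beta>3 r y"
  have cont: "continuous_on {0..} (?N y)" for y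
    using \<alpha> \<beta> by (intro block_kernel_continuous) auto
  show ?thesis
  proof
    fix n :: nat and y
    have diff_J_le: "norm (diff_J b c r u) \<le> 2 * KB * norm u" if "\<bar>b\<bar> < \<theta>B" "\<bar>c\<bar> < \<theta>B" "0 \<le> r" for b c r u
    proof -
      have "norm (diff_J b c r u) \<le> KB * norm u + KB * norm u"
        unfolding diff_J_def using that SB.\<theta>
        by (intro norm_triangle_le_diff add_mono SB.norm_J sector_polarI) auto
      then show ?thesis by simp
    qed
    have near: "norm (integral {0..1} (?N y)) \<le> (KA * (2 * KB * (2 * KB * norm y))) * (1 - 0)"
    proof (rule integral_bound)
      fix r :: real assume r: "r \<in> {0..1}"
      have "norm (?N y r) \<le> KA * norm (diff_J \<beta>1 \<beta>0 r (diff_J \<beta>3 \<beta>2 r y))"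
        unfolding block_kernel_def norm_scaleC using \<alpha> r SA.\<theta> by (auto intro!: SA.norm_R_le sector_polarI)
      also have "\<dots> \<le> KA * (2 * KB * norm (diff_J \<beta>3 \<beta>2 r y))"
        using SA.K \<beta> r by (intro mult_left_mono diff_J_le) auto
      also have "\<dots> \<le> KA * (2 * KB * (2 * KB * norm y))"
        using SA.K SB.K \<beta> r by (intro mult_left_mono diff_J_le) auto
      finally show "norm (?N y r) \<le> KA * (2 * KB * (2 * KB * norm y))" .
    qed (auto intro: continuous_on_subset[OF cont])
    have far: "norm (integral {1..exp 1} (\<lambda>q. \<Sum>k\<le>n. exp (real k) *\<^sub>R ?N y (exp (real k) * q)))
        \<le> (M * norm y) * (exp 1 - 1)"
    proof (rule integral_bound)
      show "continuous_on {1..exp 1} (\<lambda>q. \<Sum>k\<le>n. exp (real k) *\<^sub>R ?N y (exp (real k) * q))"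
        by (intro continuous_intros continuous_on_compose2[OF cont]) auto
      fix q :: real assume q: "q \<in> {1..exp 1}"
      \<comment> \<open>The Jacobian \<open>exp k\<close> together with \<open>cis \<alpha>\<close>
        completes the resolvent of \<open>A\<close> to \<open>J\<close>, up to the factor
        \<open>1 / q\<close>, which is at most 1.\<close>
      have "(\<Sum>k\<le>n. exp (real k) *\<^sub>R ?N y (exp (real k) * q)) = (1 / q) *\<^sub>R
          (\<Sum>k\<le>n. SA.J (complex_of_real (q * exp (real k)) * cis \<alpha>)
            (diff_J \<beta>1 \<beta>0 (q * exp (real k)) (diff_J \<beta>3 \<beta>2 (q * exp (real k)) y)))"
        unfolding scaleR_sum_right block_kernel_def
        using q by (intro sum.cong refl) (simp add: scaleR_scaleC scaleC_scaleC mult_ac)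
      also have "norm \<dots> \<le> 1 * (M * norm y)"
        unfolding norm_scaleR using q M(1) by (intro mult_mono M(2)) auto
      finally show "norm (\<Sum>k\<le>n. exp (real k) *\<^sub>R ?N y (exp (real k) * q)) \<le> M * norm y"
        by simp
    qed simp
    have "norm (integral {0..exp (real (Suc n))} (?N y))
        \<le> (KA * (2 * KB * (2 * KB * norm y))) * (1 - 0) + (M * norm y) * (exp 1 - 1)"
      unfolding integral_exp_blocks[OF cont] by (intro norm_triangle_mono near far)
    then show "norm (integral {0..exp (real (Suc n))} (?N y))
        \<le> (KA * (2 * KB * (2 * KB)) + M * (exp 1 - 1)) * norm y"
      by (simp add: algebra_simps)
  qed
qed

end

subsection \<open>Regrouping the contour integral\<close>

text \<open>The roots of the characteristic polynomial \<open>X^3 - s X^2 + s X - 1\<close> of the differences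
  are \<open>1\<close>, \<open>\<omega>\<close> and \<open>1 / \<omega>\<close>; \<open>u\<close> is its \<open>N\<close>-periodic solution
  with initial values \<open>0, 0, 1\<close>.\<close>

lemma cubic_telescope:
  fixes H :: "nat \<Rightarrow> 'a::complex_banach" and \<omega> s :: complex
  assumes \<omega>: "\<omega> \<noteq> 0" "\<omega> \<noteq> 1" "\<omega>\<^sup>2 \<noteq> 1" "\<omega> ^ N = 1" and N: "2 \<le> N"
    and s: "s = 1 + \<omega> + 1 / \<omega>"
  defines "u \<equiv> \<lambda>l::nat. \<omega>\<^sup>2 / ((\<omega>\<^sup>2 - 1) * (\<omega> - 1)) * (\<omega> ^ l / \<omega> - 1 - 1 / \<omega> + 1 / \<omega> ^ l)"
  shows "(\<Sum>l<N - 2. u (l + 2) *\<^sub>C (H (l + 3) - s *\<^sub>C H (l + 2) + s *\<^sub>C H (l + 1) - H l)) = H N - H 0"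
proof -
  have u0: "u 0 = 0" and u1: "u 1 = 0"
    using \<omega>(1) by (simp_all add: u_def)
  have u2: "u 2 = 1"
  proof -
    have "\<omega>\<^sup>2 / \<omega> - 1 - 1 / \<omega> + 1 / \<omega>\<^sup>2 = (\<omega>\<^sup>2 - 1) * (\<omega> - 1) / \<omega>\<^sup>2"
      using \<omega>(1) by (simp add: field_simps power2_eq_square)
    then show ?thesis
      using \<omega> by (simp add: u_def)
  qed
  have rec: "u (l + 3) = s * u (l + 2) - s * u (l + 1) + u l" for l
  proof -
    have "\<omega> ^ 3 - s * \<omega>\<^sup>2 + s * \<omega> - 1 = 0"
      using \<omega>(1) unfolding s by (simp add: field_simps power2_eq_square power3_eq_cube)
    then have r: "\<omega> ^ 3 = s * \<omega>\<^sup>2 - s * \<omega> + 1"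
      by (simp add: algebra_simps)
    have a: "\<omega> ^ (l + 3) / \<omega> = s * (\<omega> ^ (l + 2) / \<omega>) - s * (\<omega> ^ (l + 1) / \<omega>) + \<omega> ^ l / \<omega>"
    proof -
      have "\<omega> ^ (l + 3) = \<omega> ^ l * \<omega> ^ 3" by (simp add: power_add)
      also have "\<dots> = s * \<omega> ^ (l + 2) - s * \<omega> ^ (l + 1) + \<omega> ^ l"
        unfolding r by (simp add: power_add algebra_simps power2_eq_square)
      finally show ?thesis by (simp add: add_divide_distrib diff_divide_distrib)
    qed
    have b: "1 / \<omega> ^ (l + 3) = s * (1 / \<omega> ^ (l + 2)) - s * (1 / \<omega> ^ (l + 1)) + 1 / \<omega> ^ l"
    proof -
      have "1 = s * \<omega> - s * \<omega>\<^sup>2 + \<omega> ^ 3"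
        unfolding r by simp
      then have "1 / \<omega> ^ (l + 3) = (s * \<omega> - s * \<omega>\<^sup>2 + \<omega> ^ 3) / \<omega> ^ (l + 3)"
        by simp
      also have "\<dots> = s * (1 / \<omega> ^ (l + 2)) - s * (1 / \<omega> ^ (l + 1)) + 1 / \<omega> ^ l"
        using \<omega>(1) by (simp add: add_divide_distrib diff_divide_distrib power_add power2_eq_square power3_eq_cube mult_ac)
      finally show ?thesis .
    qed
    \<comment> \<open>New names for the powers and reciprocals turn the recurrence into a polynomial
      identity.\<close>
    define K p q k where "K = \<omega>\<^sup>2 / ((\<omega>\<^sup>2 - 1) * (\<omega> - 1))" and "p l = \<omega> ^ l / \<omega>"
      and "q l = 1 / \<omega> ^ l" and "k = 1 / \<omega>" for l :: nat
    have u: "u l = K * (p l - 1 - k + q l)" for l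
      by (simp add: u_def K_def p_def q_def k_def)
    show ?thesis
      using a b unfolding u p_def[symmetric] q_def[symmetric] by algebra
  qed
  have per: "u (l + N) = u l" for l
    using \<omega>(4) by (simp add: u_def power_add)
  \<comment> \<open>Summation by parts: the recurrence cancels the interior coefficients and leaves
    boundary terms at both ends.\<close>
  have partial: "(\<Sum>l<n. u (l + 2) *\<^sub>C (H (l + 3) - s *\<^sub>C H (l + 2) + s *\<^sub>C H (l + 1) - H l))
      = u (n + 1) *\<^sub>C H (n + 2) + (u n - s * u (n + 1)) *\<^sub>C H (n + 1) + u (n + 2) *\<^sub>C H n - H 0" for n
  proof (induction n)
    case 0
    then show ?case using u0 u1 u2 by (simp add: numeral_2_eq_2)
  next
    case (Suc n)
    have "u (Suc n + 2) = s * u (n + 2) - s * u (n + 1) + u n"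
      using rec[of n] by (simp add: numeral_3_eq_3)
    then have r: "u (Suc n + 2) *\<^sub>C H (Suc n)
        = (s * u (n + 2)) *\<^sub>C H (Suc n) - (s * u (n + 1)) *\<^sub>C H (Suc n) + u n *\<^sub>C H (Suc n)"
      by (simp only: scaleC.add_left scaleC.diff_left)
    show ?case
      unfolding sum.lessThan_Suc Suc.IH r
      by (simp add: scaleC_simps algebra_simps numeral_3_eq_3 numeral_2_eq_2)
  qed
  define n where "n = N - 2"
  have n: "n + 2 = N" using N by (simp add: n_def)
  have idx: "0 + N = n + 2" "1 + N = n + 3" "2 + N = n + 4"
    using n by simp_all
  \<comment> \<open>Periodicity gives \<open>u\<close> at \<open>N\<close>, \<open>N + 1\<close> and
    \<open>N + 2\<close>. Run backwards, the recurrence then gives 1 at \<open>N - 1\<close> and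
    \<open>s\<close> at \<open>N - 2\<close>, so that \<open>H N\<close> alone survives of the upper
    boundary terms.\<close>
  have "u (n + 2) = 0" "u (n + 3) = 0" "u (n + 4) = 1"
    using per[of 0] per[of 1] per[of 2] unfolding idx u0 u1 u2 .
  moreover from this have "u (n + 1) = 1"
  proof -
    have idx': "n + 1 + 3 = n + 4" "n + 1 + 2 = n + 3" "n + 1 + 1 = n + 2"
      by simp_all
    show ?thesis
      using rec[of "n + 1"] \<open>u (n + 2) = 0\<close> \<open>u (n + 3) = 0\<close> \<open>u (n + 4) = 1\<close> unfolding idx' by simp
  qed
  moreover from calculation have "u n = s"
    using rec[of n] by (simp add: algebra_simps)
  ultimately show ?thesis
    using partial[of n] n by (simp add: n_def[symmetric])
qed

section \<open>Partial fractions for products of resolvents\<close>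

context sectorial_operator
begin

lemma J_product:
  assumes "\<rho> \<in> sector \<theta>" "\<sigma> \<in> sector \<theta>" "\<rho> \<noteq> \<sigma>"
  shows "J \<rho> (J \<sigma> x) = (\<sigma> / (\<sigma> - \<rho>)) *\<^sub>C J \<rho> x - (\<rho> / (\<sigma> - \<rho>)) *\<^sub>C J \<sigma> x"
proof -
  have "(1 / (\<sigma> - \<rho>)) *\<^sub>C (R \<rho> x - R \<sigma> x) = R \<rho> (R \<sigma> x)"
    using resolvent_identity[OF assms(1,2)] assms(3) by (simp add: scaleC_scaleC)
  then have "J \<rho> (J \<sigma> x) = (\<rho> * \<sigma>) *\<^sub>C (1 / (\<sigma> - \<rho>)) *\<^sub>C (R \<rho> x - R \<sigma> x)"
    using assms by (simp add: R_scaleC scaleC_scaleC)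
  then show ?thesis
    by (simp add: scaleC.diff_right scaleC_scaleC mult_ac)
qed

end

context commuting_pair
begin

text \<open>The coefficient of the pole in direction \<open>b + 3 * \<delta>\<close> in the partial
  fraction expansion of the product of two first differences,
  \<open>1 / (\<omega>^3 - 1) - 1 / (\<omega>^2 - 1)\<close>.\<close>

definition cubic_factor :: "complex \<Rightarrow> complex" where
  "cubic_factor \<omega> = - \<omega>\<^sup>2 * (\<omega> - 1) / ((\<omega> ^ 3 - 1) * (\<omega>\<^sup>2 - 1))"

text \<open>In the spectral variable the product has simple poles in four directions and double
  zeros at 0 and at infinity. If \<open>a i\<close> is the coefficient of the kernel with pole
  \<open>c * \<omega>^i\<close>, double zeros mean that the sums of \<open>a i\<close>, of
  \<open>a i / \<omega>^i\<close> and of \<open>a i * \<omega>^i\<close> vanish. The polynomial with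
  coefficients \<open>a i\<close> thus has the roots 1, \<open>1 / \<omega>\<close> and
  \<open>\<omega>\<close>, which fixes it up to a factor.\<close>

lemma diff_J_product:
  fixes \<delta> b r :: real and y
  assumes sec: "\<bar>b\<bar> \<le> \<theta>B" "\<bar>b + \<delta>\<bar> \<le> \<theta>B" "\<bar>b + 2 * \<delta>\<bar> \<le> \<theta>B" "\<bar>b + 3 * \<delta>\<bar> \<le> \<theta>B" and r: "0 \<le> r"
    and \<omega>: "\<omega> = cis \<delta>" "\<omega> \<noteq> 1" "\<omega>\<^sup>2 \<noteq> 1" "\<omega> ^ 3 \<noteq> 1" and s: "s = 1 + \<omega> + 1 / \<omega>"
  defines "JJ \<equiv> \<lambda>i::nat. SB.J (complex_of_real r * cis (b + real i * \<delta>)) y"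
  shows "diff_J (b + \<delta>) b r (diff_J (b + 3 * \<delta>) (b + 2 * \<delta>) r y)
    = cubic_factor \<omega> *\<^sub>C (JJ 3 - s *\<^sub>C JJ 2 + s *\<^sub>C JJ 1 - JJ 0)"
proof (cases "r = 0")
  case True
  then show ?thesis
    by (simp add: diff_J_def JJ_def)
next
  case False
  have \<omega>0: "\<omega> \<noteq> 0" by (simp add: \<omega>(1))
  define c where "c = complex_of_real r * cis b"
  have c: "c \<noteq> 0" using False by (simp add: c_def)
  have dir: "complex_of_real r * cis (b + real i * \<delta>) = c * \<omega> ^ i" for i
    by (simp add: c_def \<omega>(1) Complex.DeMoivre cis_mult)
  have in_sec: "c * \<omega> ^ i \<in> sector \<theta>B" if "i \<in> {0, 1, 2, 3}" for i
    unfolding dir[symmetric] using that sec r SB.\<theta> by (intro sector_polarI) auto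
  have prod: "SB.J (c * \<omega> ^ i) (SB.J (c * \<omega> ^ j) y)
      = (\<omega> ^ j / (\<omega> ^ j - \<omega> ^ i)) *\<^sub>C JJ i - (\<omega> ^ i / (\<omega> ^ j - \<omega> ^ i)) *\<^sub>C JJ j"
    if "i \<in> {0, 1, 2, 3}" "j \<in> {0, 1, 2, 3}" "\<omega> ^ i \<noteq> \<omega> ^ j" for i j
  proof -
    have "c * \<omega> ^ i \<noteq> c * \<omega> ^ j" using c that by simp
    from SB.J_product[OF in_sec[OF that(1)] in_sec[OF that(2)] this, of y]
    have "SB.J (c * \<omega> ^ i) (SB.J (c * \<omega> ^ j) y)
      = (c * \<omega> ^ j / (c * \<omega> ^ j - c * \<omega> ^ i)) *\<^sub>C JJ i - (c * \<omega> ^ i / (c * \<omega> ^ j - c * \<omega> ^ i)) *\<^sub>C JJ j"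
      by (simp only: JJ_def dir)
    moreover have "c * \<omega> ^ k / (c * \<omega> ^ j - c * \<omega> ^ i) = \<omega> ^ k / (\<omega> ^ j - \<omega> ^ i)" for k
      using c by (simp add: right_diff_distrib[symmetric])
    ultimately show ?thesis by simp
  qed
  have ne: "\<omega> ^ 1 \<noteq> \<omega> ^ 3" "\<omega> ^ 1 \<noteq> \<omega> ^ 2" "\<omega> ^ 0 \<noteq> \<omega> ^ 3" "\<omega> ^ 0 \<noteq> \<omega> ^ 2"
    using \<omega> \<omega>0 by (auto simp: power2_eq_square power3_eq_cube)
  have i: "0 \<in> {0, 1, 2, 3::nat}" "1 \<in> {0, 1, 2, 3::nat}" "2 \<in> {0, 1, 2, 3::nat}" "3 \<in> {0, 1, 2, 3::nat}"
    by simp_all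
  \<comment> \<open>Cleared of the reciprocal, \<open>s\<close> enters the partial fraction
    identities polynomially.\<close>
  have \<omega>s: "\<omega> * s = \<omega>\<^sup>2 + \<omega> + 1"
    using \<omega>0 by (simp add: s distrib_left power2_eq_square)
  have dn: "\<omega> ^ 3 - \<omega> ^ 1 \<noteq> 0" "\<omega> ^ 2 - \<omega> ^ 1 \<noteq> 0" "\<omega> ^ 3 - \<omega> ^ 0 \<noteq> 0" "\<omega> ^ 2 - \<omega> ^ 0 \<noteq> 0"
    "(\<omega> ^ 3 - 1) * (\<omega>\<^sup>2 - 1) \<noteq> 0"
    using ne \<omega> by auto
  have dirs: "complex_of_real r * cis b = c * \<omega> ^ 0" "complex_of_real r * cis (b + \<delta>) = c * \<omega> ^ 1"
    "complex_of_real r * cis (b + 2 * \<delta>) = c * \<omega> ^ 2" "complex_of_real r * cis (b + 3 * \<delta>) = c * \<omega> ^ 3"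
    using dir[of 0] dir[of 1] dir[of 2] dir[of 3] by simp_all
  have "diff_J (b + \<delta>) b r (diff_J (b + 3 * \<delta>) (b + 2 * \<delta>) r y)
      = SB.J (c * \<omega> ^ 1) (SB.J (c * \<omega> ^ 3) y) - SB.J (c * \<omega> ^ 1) (SB.J (c * \<omega> ^ 2) y)
      - (SB.J (c * \<omega> ^ 0) (SB.J (c * \<omega> ^ 3) y) - SB.J (c * \<omega> ^ 0) (SB.J (c * \<omega> ^ 2) y))"
    unfolding diff_J_def dirs using in_sec[of 0] in_sec[of 1]
    by (simp only: SB.R_diff scaleC.diff_right insert_iff simp_thms)
  also have "\<dots> = (\<omega> ^ 3 / (\<omega> ^ 3 - \<omega> ^ 1) - \<omega> ^ 2 / (\<omega> ^ 2 - \<omega> ^ 1)) *\<^sub>C JJ 1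
      + (\<omega> ^ 1 / (\<omega> ^ 2 - \<omega> ^ 1) - \<omega> ^ 0 / (\<omega> ^ 2 - \<omega> ^ 0)) *\<^sub>C JJ 2
      + (\<omega> ^ 0 / (\<omega> ^ 3 - \<omega> ^ 0) - \<omega> ^ 1 / (\<omega> ^ 3 - \<omega> ^ 1)) *\<^sub>C JJ 3
      + (\<omega> ^ 2 / (\<omega> ^ 2 - \<omega> ^ 0) - \<omega> ^ 3 / (\<omega> ^ 3 - \<omega> ^ 0)) *\<^sub>C JJ 0"
    unfolding prod[OF i(2,4) ne(1)] prod[OF i(2,3) ne(2)] prod[OF i(1,4) ne(3)] prod[OF i(1,3) ne(4)]
    by (simp only: scaleC.diff_left) (simp only: algebra_simps)
  also have "\<omega> ^ 3 / (\<omega> ^ 3 - \<omega> ^ 1) - \<omega> ^ 2 / (\<omega> ^ 2 - \<omega> ^ 1) = cubic_factor \<omega> * s"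
    unfolding cubic_factor_def diff_frac_eq[OF dn(1,2)] times_divide_eq_left
    by (subst frac_eq_eq) (use dn in simp, use dn in simp, use \<omega>s in algebra)
  also have "\<omega> ^ 1 / (\<omega> ^ 2 - \<omega> ^ 1) - \<omega> ^ 0 / (\<omega> ^ 2 - \<omega> ^ 0) = - (cubic_factor \<omega> * s)"
    unfolding cubic_factor_def diff_frac_eq[OF dn(2,4)] times_divide_eq_left minus_divide_left
    by (subst frac_eq_eq) (use dn in simp, use dn in simp, use \<omega>s in algebra)
  also have "\<omega> ^ 0 / (\<omega> ^ 3 - \<omega> ^ 0) - \<omega> ^ 1 / (\<omega> ^ 3 - \<omega> ^ 1) = cubic_factor \<omega>"
    unfolding cubic_factor_def diff_frac_eq[OF dn(3,1)]
    by (subst frac_eq_eq) (use dn in simp, use dn in simp, algebra)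
  also have "\<omega> ^ 2 / (\<omega> ^ 2 - \<omega> ^ 0) - \<omega> ^ 3 / (\<omega> ^ 3 - \<omega> ^ 0) = - cubic_factor \<omega>"
    unfolding cubic_factor_def diff_frac_eq[OF dn(4,3)] minus_divide_left
    by (subst frac_eq_eq) (use dn in simp, use dn in simp, algebra)
  finally show ?thesis
    by (simp add: scaleC_simps algebra_simps)
qed

text \<open>The resolvent of \<open>A\<close> at \<open>z\<close> applied to \<open>J\<close> of
  \<open>B\<close> at \<open>cis e * z\<close>. For \<open>cis e = - 1\<close> this is
  \<open>(A + z)^{-1} - B (A + z)^{-1} (B - z)^{-1}\<close>, whose contour integral formally yields
  \<open>B (A + B)^{-1}\<close> up to a multiple of the identity.\<close>

definition ray_kernel :: "real \<Rightarrow> 'a \<Rightarrow> complex \<Rightarrow> 'a" where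
  "ray_kernel e y z = (cis e * z) *\<^sub>C SA.R z (SB.R (cis e * z) y)"

definition ray_kernel_integral :: "real \<Rightarrow> real \<Rightarrow> 'a \<Rightarrow> real \<Rightarrow> 'a" where
  "ray_kernel_integral \<alpha> e y b =
     integral {0..b} (\<lambda>r. cis \<alpha> *\<^sub>C ray_kernel e y (complex_of_real r * cis \<alpha>))"

text \<open>Since \<open>e\<close> is fixed, the point for \<open>B\<close> turns along with the
  ray. \<open>z\<close> times the kernel is a product of two operators \<open>J\<close> and tends to
  \<open>y\<close> at infinity, so the arc contributes its angle times \<open>y\<close>.\<close>

lemma ray_kernel_rotation:
  assumes \<alpha>: "\<alpha>' \<le> \<alpha>" "\<bar>\<alpha>\<bar> \<le> \<theta>A" "\<bar>\<alpha>'\<bar> \<le> \<theta>A" and e: "\<bar>\<alpha> + e\<bar> \<le> \<theta>B" "\<bar>\<alpha>' + e\<bar> \<le> \<theta>B"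
  shows "((\<lambda>b. ray_kernel_integral \<alpha> e y b - ray_kernel_integral \<alpha>' e y b)
    \<longlongrightarrow> (\<i> * complex_of_real (\<alpha> - \<alpha>')) *\<^sub>C y) at_top"
proof -
  define \<kappa> where "\<kappa> = cis e"
  define W where "W = wedge \<alpha>' \<alpha>"
  define P where "P z = SA.R z (SB.R (\<kappa> * z) y)" for z
  \<comment> \<open>\<open>Q w\<close> is the difference quotient of \<open>P\<close> at
    \<open>w\<close>, obtained by applying the two resolvent identities to one factor at a
    time.\<close>
  define Q where "Q w z = - \<kappa> *\<^sub>C SA.R z (SB.R (\<kappa> * z) (SB.R (\<kappa> * w) y))
    - SA.R z (SA.R w (SB.R (\<kappa> * w) y))" for w z
  have WA: "z \<in> sector \<theta>A" if "z \<in> W" for z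
    using that \<alpha> SA.\<theta> unfolding W_def wedge_def by (auto intro!: sector_polarI)
  have WB: "\<kappa> * z \<in> sector \<theta>B" if "z \<in> W" for z
  proof -
    obtain r s where z: "z = complex_of_real r * cis s" "0 \<le> r" "\<alpha>' \<le> s" "s \<le> \<alpha>"
      using \<open>z \<in> W\<close> unfolding W_def wedge_def by auto
    have eq: "\<kappa> * z = complex_of_real r * cis (s + e)"
      by (simp add: z(1) \<kappa>_def cis_mult[symmetric])
    show ?thesis
      unfolding eq using z(2-4) e SB.\<theta> by (intro sector_polarI) auto
  qed
  have P_diff: "P z - P w = (z - w) *\<^sub>C Q w z" if "z \<in> W" "w \<in> W" for z w
  proof -
    have "P z - P w = SA.R z (SB.R (\<kappa> * z) y - SB.R (\<kappa> * w) y)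
        + (SA.R z (SB.R (\<kappa> * w) y) - SA.R w (SB.R (\<kappa> * w) y))"
      using that WA by (simp add: P_def SA.R_diff)
    also have "\<dots> = SA.R z ((\<kappa> * w - \<kappa> * z) *\<^sub>C SB.R (\<kappa> * z) (SB.R (\<kappa> * w) y))
        + (w - z) *\<^sub>C SA.R z (SA.R w (SB.R (\<kappa> * w) y))"
      using that WA WB by (simp only: SB.resolvent_identity SA.resolvent_identity)
    also have "\<dots> = (\<kappa> * w - \<kappa> * z) *\<^sub>C SA.R z (SB.R (\<kappa> * z) (SB.R (\<kappa> * w) y))
        + (w - z) *\<^sub>C SA.R z (SA.R w (SB.R (\<kappa> * w) y))"
      using that WA by (simp only: SA.R_scaleC)
    also have "\<dots> = (z - w) *\<^sub>C Q w z"
      by (simp add: Q_def scaleC_simps algebra_simps)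
    finally show ?thesis .
  qed
  have cont_P: "continuous_on W P"
    unfolding P_def using WA WB by (intro SA.continuous_on_R SB.continuous_on_R continuous_intros) auto
  have cont_Q: "continuous_on W (Q w)" if "w \<in> W" for w
    unfolding Q_def using WA WB that
    by (intro SA.continuous_on_R SB.continuous_on_R continuous_intros scaleC.continuous_on) auto
  have cont_Q': "continuous_on W (\<lambda>w. Q w w)"
    unfolding Q_def using WA WB
    by (intro SA.continuous_on_R SB.continuous_on_R continuous_intros scaleC.continuous_on) auto
  define D where "D w z = \<kappa> *\<^sub>C (P z + w *\<^sub>C Q w z)" for w z
  have der: "((\<lambda>z. (\<kappa> * z) *\<^sub>C P z) has_derivative (\<lambda>h. h *\<^sub>C D w w)) (at w within W)" if w: "w \<in> W" for w
  proof (rule has_derivative_scaleC_quotient[where Q = "D w", OF _ _ w])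
    show "(\<kappa> * z) *\<^sub>C P z - (\<kappa> * w) *\<^sub>C P w = (z - w) *\<^sub>C D w z" if z: "z \<in> W" for z
    proof -
      have "(\<kappa> * z) *\<^sub>C P z - (\<kappa> * w) *\<^sub>C P w = ((z - w) * \<kappa>) *\<^sub>C P z + (\<kappa> * w) *\<^sub>C (P z - P w)"
        by (simp add: scaleC_simps algebra_simps)
      also have "\<dots> = (z - w) *\<^sub>C D w z"
        unfolding P_diff[OF z w] by (simp add: D_def scaleC_simps algebra_simps)
      finally show ?thesis .
    qed
    show "continuous_on W (D w)"
      unfolding D_def by (intro continuous_intros scaleC.continuous_on cont_P cont_Q[OF w])
  qed
  have lim: "((\<lambda>z. z *\<^sub>C (\<kappa> * z) *\<^sub>C P z) \<longlongrightarrow> y) (inf at_infinity (principal W))"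
  proof -
    let ?F = "inf at_infinity (principal W)"
    have A: "((\<lambda>z. SA.J z y) \<longlongrightarrow> y) ?F"
      by (rule filterlim_mono[OF SA.J_tendsto order_refl]) (use WA in \<open>intro inf_mono; auto\<close>)
    have "filterlim (\<lambda>z. \<kappa> * z) at_infinity at_infinity"
      unfolding filterlim_at_infinity_conv_norm_at_top
      by (simp add: norm_mult \<kappa>_def filterlim_norm_at_top)
    then have "filterlim (\<lambda>z. \<kappa> * z) (inf at_infinity (principal (sector \<theta>B))) ?F"
      unfolding filterlim_inf filterlim_principal
      by (auto intro: filterlim_mono[OF _ order_refl inf_le1] simp: eventually_inf_principal WB)
    from filterlim_compose[OF SB.J_tendsto this]
    have "((\<lambda>z. SB.J (\<kappa> * z) y) \<longlongrightarrow> y) ?F" .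
    then have B: "((\<lambda>z. KA * norm (SB.J (\<kappa> * z) y - y)) \<longlongrightarrow> 0) ?F"
      by (intro tendsto_mult_right_zero tendsto_norm_zero LIM_zero)
    have "((\<lambda>z. SA.J z (SB.J (\<kappa> * z) y - y)) \<longlongrightarrow> 0) ?F"
      by (rule Lim_null_comparison[OF _ B])
        (use SA.norm_J WA in \<open>auto simp: eventually_inf_principal intro!: always_eventually\<close>)
    from tendsto_add[OF this A] have "((\<lambda>z. SA.J z (SB.J (\<kappa> * z) y - y) + SA.J z y) \<longlongrightarrow> y) ?F"
      by simp
    moreover have "SA.J z (SB.J (\<kappa> * z) y - y) + SA.J z y = z *\<^sub>C (\<kappa> * z) *\<^sub>C P z" if "z \<in> W" for z
      using WA[OF that] by (simp add: P_def SA.R_diff SA.R_scaleC scaleC_simps)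
    then have "eventually (\<lambda>z. SA.J z (SB.J (\<kappa> * z) y - y) + SA.J z y = z *\<^sub>C (\<kappa> * z) *\<^sub>C P z) ?F"
      unfolding eventually_inf_principal by (intro always_eventually) blast
    ultimately show ?thesis
      by (rule Lim_transform_eventually)
  qed
  have cont_D: "continuous_on W (\<lambda>w. D w w)"
    unfolding D_def by (intro continuous_intros scaleC.continuous_on cont_P cont_Q')
  show ?thesis
    using ray_rotation_limit[OF \<alpha>(1) der[unfolded W_def] cont_D[unfolded W_def] lim[unfolded W_def]]
    unfolding ray_kernel_integral_def ray_kernel_def P_def \<kappa>_def .
qed

lemma ray_kernel_change:
  assumes "\<bar>\<alpha>\<bar> \<le> \<theta>A" "\<bar>\<alpha>'\<bar> \<le> \<theta>A" "\<bar>\<alpha> + e\<bar> \<le> \<theta>B" "\<bar>\<alpha>' + e\<bar> \<le> \<theta>B"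
  shows "((\<lambda>b. ray_kernel_integral \<alpha> e y b - ray_kernel_integral \<alpha>' e y b)
    \<longlongrightarrow> (\<i> * complex_of_real (\<alpha> - \<alpha>')) *\<^sub>C y) at_top"
proof (cases "\<alpha>' \<le> \<alpha>")
  case True
  then show ?thesis using assms by (intro ray_kernel_rotation) auto
next
  case False
  then have "((\<lambda>b. ray_kernel_integral \<alpha>' e y b - ray_kernel_integral \<alpha> e y b)
    \<longlongrightarrow> (\<i> * complex_of_real (\<alpha>' - \<alpha>)) *\<^sub>C y) at_top"
    using assms by (intro ray_kernel_rotation) auto
  from tendsto_minus[OF this] show ?thesis
    by (simp add: algebra_simps flip: scaleC.minus_left)
qed

text \<open>On the rays where \<open>cis e = - 1\<close> the kernel applied to \<open>A x + B x\<close> splits by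
  \<open>(A + z) + (B - z) = A + B\<close>.\<close>

lemma ray_kernel_sum:
  assumes z: "z \<in> sector \<theta>A" "- z \<in> sector \<theta>B" and x: "x \<in> op_dom A" "x \<in> op_dom B" and e: "cis e = - 1"
  shows "ray_kernel e (op_app A x + op_app B x) z = SA.R z (op_app A x) - SB.R (- z) (op_app B x)"
proof -
  have "SA.R z (SB.R (- z) (op_app A x + op_app B x))
      = SB.R (- z) (SA.R z (op_app A x)) + SA.R z (SB.R (- z) (op_app B x))"
    using z by (simp add: SA.R_add SB.R_add comm)
  also have "\<dots> = SB.R (- z) x + SA.R z x"
    using z x by (simp add: SA.R_app SB.R_app SA.R_add SA.R_diff SB.R_diff SA.R_scaleC SB.R_scaleC comm
        scaleC.minus_left)
  finally show ?thesis
    using z x by (simp add: ray_kernel_def e SA.R_app SB.R_app scaleC_simps)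
qed

text \<open>The kernel splits into a resolvent of \<open>A\<close> on the rays at
  \<open>\<theta>A\<close> and \<open>- \<theta>A\<close> and one of \<open>B\<close> on the rays at
  \<open>\<gamma>\<close> and \<open>- \<gamma>\<close>. Each pair is joined inside its own sector,
  possible for \<open>B\<close> because \<open>pi - \<theta>A <= \<theta>B\<close>; the arcs give
  \<open>- 2 i \<theta>A A x + 2 i (pi - \<theta>A) B x\<close>.\<close>

lemma ray_kernel_endpoints:
  assumes x: "x \<in> op_dom A" "x \<in> op_dom B" and sum: "pi \<le> \<theta>A + \<theta>B"
  defines "y \<equiv> op_app A x + op_app B x"
  shows "((\<lambda>b. ray_kernel_integral (- \<theta>A) pi y b - ray_kernel_integral \<theta>A (- pi) y b)
    \<longlongrightarrow> (2 * of_real pi * \<i>) *\<^sub>C op_app B x - (\<i> * complex_of_real (2 * \<theta>A)) *\<^sub>C y) at_top"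
proof -
  define \<gamma> where "\<gamma> = pi - \<theta>A"
  have \<gamma>: "- \<gamma> \<le> \<gamma>" "- \<theta>B \<le> - \<gamma>" "\<gamma> \<le> \<theta>B"
    using sum SA.\<theta> by (auto simp: \<gamma>_def)
  have cis\<gamma>: "cis \<gamma> = - cis (- \<theta>A)" "cis (- \<gamma>) = - cis \<theta>A"
    by (simp_all add: \<gamma>_def complex_eq_iff)
  define IA where "IA t b = integral {0..b} (\<lambda>r. cis t *\<^sub>C SA.R (complex_of_real r * cis t) (op_app A x))" for t b
  define IB where "IB t b = integral {0..b} (\<lambda>r. cis t *\<^sub>C SB.R (complex_of_real r * cis t) (op_app B x))" for t b
  have split: "ray_kernel_integral \<alpha> e y b = IA \<alpha> b + IB \<beta> b"
    if "\<bar>\<alpha>\<bar> = \<theta>A" "\<bar>\<beta>\<bar> = \<gamma>" "cis \<beta> = - cis \<alpha>" "cis e = - 1" for \<alpha> \<beta> e b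
  proof -
    have kernel: "cis \<alpha> *\<^sub>C ray_kernel e y (complex_of_real r * cis \<alpha>)
        = cis \<alpha> *\<^sub>C SA.R (complex_of_real r * cis \<alpha>) (op_app A x)
          + cis \<beta> *\<^sub>C SB.R (complex_of_real r * cis \<beta>) (op_app B x)" if "r \<in> {0..b}" for r
    proof -
      have "complex_of_real r * cis \<alpha> \<in> sector \<theta>A" "complex_of_real r * cis \<beta> \<in> sector \<theta>B"
        using that \<open>\<bar>\<alpha>\<bar> = \<theta>A\<close> \<open>\<bar>\<beta>\<bar> = \<gamma>\<close> \<gamma> SA.\<theta> SB.\<theta> by (auto intro!: sector_polarI)
      then show ?thesis
        using \<open>cis \<beta> = - cis \<alpha>\<close> \<open>cis e = - 1\<close>
        by (simp add: y_def ray_kernel_sum x scaleC_simps)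
    qed
    have "ray_kernel_integral \<alpha> e y b = integral {0..b}
        (\<lambda>r. cis \<alpha> *\<^sub>C SA.R (complex_of_real r * cis \<alpha>) (op_app A x)
          + cis \<beta> *\<^sub>C SB.R (complex_of_real r * cis \<beta>) (op_app B x))"
      unfolding ray_kernel_integral_def by (intro integral_cong kernel)
    also have "\<dots> = IA \<alpha> b + IB \<beta> b"
      unfolding IA_def IB_def
    proof (intro integral_add integrable_continuous_real scaleC.continuous_on continuous_intros
        SA.continuous_on_R SB.continuous_on_R)
      show "complex_of_real r * cis \<alpha> \<in> sector \<theta>A" "complex_of_real r * cis \<beta> \<in> sector \<theta>B"
        if "r \<in> {0..b}" for r
        using that \<open>\<bar>\<alpha>\<bar> = \<theta>A\<close> \<open>\<bar>\<beta>\<bar> = \<gamma>\<close> \<gamma> SA.\<theta> SB.\<theta> by (auto intro!: sector_polarI)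
    qed
    finally show ?thesis .
  qed
  have "((\<lambda>b. - (IA \<theta>A b - IA (- \<theta>A) b) + (IB \<gamma> b - IB (- \<gamma>) b))
    \<longlongrightarrow> - ((\<i> * complex_of_real (\<theta>A - - \<theta>A)) *\<^sub>C op_app A x)
        + (\<i> * complex_of_real (\<gamma> - - \<gamma>)) *\<^sub>C op_app B x) at_top"
    unfolding IA_def IB_def using \<gamma> SA.\<theta>
    by (intro tendsto_add tendsto_minus SA.R_rotation SB.R_rotation) auto
  moreover have "- (IA \<theta>A b - IA (- \<theta>A) b) + (IB \<gamma> b - IB (- \<gamma>) b)
      = ray_kernel_integral (- \<theta>A) pi y b - ray_kernel_integral \<theta>A (- pi) y b" for b
    using split[of "- \<theta>A" \<gamma> pi b] split[of \<theta>A "- \<gamma>" "- pi" b] cis\<gamma> \<gamma> SA.\<theta>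
    by (simp add: complex_eq_iff)
  moreover have "- ((\<i> * complex_of_real (\<theta>A - - \<theta>A)) *\<^sub>C op_app A x)
        + (\<i> * complex_of_real (\<gamma> - - \<gamma>)) *\<^sub>C op_app B x
      = (2 * of_real pi * \<i>) *\<^sub>C op_app B x - (\<i> * complex_of_real (2 * \<theta>A)) *\<^sub>C y"
    by (simp add: y_def \<gamma>_def scaleC_simps algebra_simps)
  ultimately show ?thesis by simp
qed

lemma ray_kernel_continuous:
  assumes "\<bar>\<alpha>\<bar> \<le> \<theta>A" "\<bar>\<alpha> + e\<bar> \<le> \<theta>B"
  shows "continuous_on {0..b} (\<lambda>r. cis \<alpha> *\<^sub>C ray_kernel e y (complex_of_real r * cis \<alpha>))"
proof -
  have A: "complex_of_real r * cis \<alpha> \<in> sector \<theta>A" if "r \<in> {0..b}" for r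
    using that assms SA.\<theta> by (intro sector_polarI) auto
  have B: "cis e * (complex_of_real r * cis \<alpha>) \<in> sector \<theta>B" if "r \<in> {0..b}" for r
  proof -
    have eq: "cis e * (complex_of_real r * cis \<alpha>) = complex_of_real r * cis (\<alpha> + e)"
      by (simp add: cis_mult[symmetric])
    show ?thesis
      unfolding eq using that assms SB.\<theta> by (intro sector_polarI) auto
  qed
  show ?thesis
    unfolding ray_kernel_def
    by (intro scaleC.continuous_on continuous_intros SA.continuous_on_R SB.continuous_on_R A B)
qed

text \<open>All four kernels share the point \<open>z\<close>, so the resolvent of \<open>A\<close>
  factors out and \<open>diff_J_product\<close> applies to what remains. This is why the rays of one
  difference have to be aligned.\<close>

lemma block_kernel_ray_kernel:
  fixes \<delta> \<alpha> e r :: real and y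
  assumes \<alpha>: "\<bar>\<alpha>\<bar> \<le> \<theta>A" and \<beta>: "\<bar>\<alpha> + e\<bar> \<le> \<theta>B" "\<bar>\<alpha> + e + \<delta>\<bar> \<le> \<theta>B" "\<bar>\<alpha> + e + 2 * \<delta>\<bar> \<le> \<theta>B"
    "\<bar>\<alpha> + e + 3 * \<delta>\<bar> \<le> \<theta>B" and r: "0 \<le> r"
    and \<omega>: "\<omega> = cis \<delta>" "\<omega> \<noteq> 1" "\<omega>\<^sup>2 \<noteq> 1" "\<omega> ^ 3 \<noteq> 1" and s: "s = 1 + \<omega> + 1 / \<omega>"
  defines "K \<equiv> \<lambda>i::nat. cis \<alpha> *\<^sub>C ray_kernel (e + real i * \<delta>) y (complex_of_real r * cis \<alpha>)"
  shows "block_kernel \<alpha> (\<alpha> + e) (\<alpha> + e + \<delta>) (\<alpha> + e + 2 * \<delta>) (\<alpha> + e + 3 * \<delta>) r y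
    = cubic_factor \<omega> *\<^sub>C (K 3 - s *\<^sub>C K 2 + s *\<^sub>C K 1 - K 0)"
proof -
  let ?z = "complex_of_real r * cis \<alpha>"
  define JJ where "JJ i = SB.J (complex_of_real r * cis (\<alpha> + e + real i * \<delta>)) y" for i :: nat
  have z: "?z \<in> sector \<theta>A"
    using \<alpha> r SA.\<theta> by (intro sector_polarI) auto
  have K: "K i = cis \<alpha> *\<^sub>C SA.R ?z (JJ i)" for i
  proof -
    have eq: "cis (e + real i * \<delta>) * ?z = complex_of_real r * cis (\<alpha> + e + real i * \<delta>)"
      by (simp add: cis_mult[symmetric])
    show ?thesis
      unfolding K_def JJ_def ray_kernel_def eq by (simp only: SA.R_scaleC[OF z])
  qed
  show ?thesis
    unfolding block_kernel_def diff_J_product[OF \<beta> r \<omega> s] K JJ_def[symmetric]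
    using z by (simp add: SA.R_scaleC SA.R_diff SA.R_add scaleC_simps mult_ac)
qed

text \<open>\<open>V b\<close> stands for a truncation of \<open>2 pi i B (A + B)^{-1}\<close>. Its
  limit is available only on the range of \<open>A + B\<close>, where the uniform bound becomes an a
  priori estimate; additivity and commutation allow working with \<open>V b\<close> on vectors not
  yet known to lie in that range.\<close>

lemma approximate_inverse:
  assumes T: "A \<in> T_sectorial \<theta>A" and H: "bounded_H_inf_calculus \<theta>B B" and sum: "pi < \<theta>A + \<theta>B"
  obtains V :: "real \<Rightarrow> 'a \<Rightarrow> 'a" and M :: real
  where "\<And>(n::nat) y. norm (V (exp (real (Suc n))) y) \<le> M * norm y"
    and "\<And>x. x \<in> op_dom A \<Longrightarrow> x \<in> op_dom B \<Longrightarrow>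
      ((\<lambda>b. V b (op_app A x + op_app B x)) \<longlongrightarrow> (2 * of_real pi * \<i>) *\<^sub>C op_app B x) at_top"
    and "\<And>b x y. V b (x + y) = V b x + V b y"
    and "\<And>b S y. bounded_linear S \<Longrightarrow> \<forall>c x. S (c *\<^sub>C x) = c *\<^sub>C S x \<Longrightarrow>
      \<forall>z\<in>sector \<theta>A. \<forall>x. S (SA.R z x) = SA.R z (S x) \<Longrightarrow>
      \<forall>z\<in>sector \<theta>B. \<forall>x. S (SB.R z x) = SB.R z (S x) \<Longrightarrow> V b (S y) = S (V b y)"
proof -
  define gap where "gap = \<theta>A + \<theta>B - pi"
  have gap: "0 < gap" using sum by (simp add: gap_def)
  obtain N0 :: nat where N0: "6 * pi / gap < real N0"
    using reals_Archimedean2 by blast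
  \<comment> \<open>More than \<open>6 * pi / gap\<close> steps give
    \<open>3 * \<delta> < gap\<close>; at least 4 steps make \<open>\<omega>\<close>, its square and
    its cube differ from 1.\<close>
  define N where "N = max N0 4"
  define \<delta> where "\<delta> = 2 * pi / real N"
  have N: "4 \<le> N" "6 * pi / gap < real N"
    using N0 by (auto simp: N_def)
  have \<delta>: "0 < \<delta>" "real N * \<delta> = 2 * pi"
    using N by (auto simp: \<delta>_def)
  have \<delta>_gap: "3 * \<delta> < gap"
    using N gap by (simp add: \<delta>_def field_simps)
  define \<omega> where "\<omega> = cis \<delta>"
  have \<omega>_pow: "\<omega> ^ k \<noteq> 1" if "0 < k" "k < N" for k
  proof
    assume "\<omega> ^ k = 1"
    then have "cis (real k * \<delta>) = 1"
      by (simp add: \<omega>_def Complex.DeMoivre)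
    then obtain m :: int where m: "real k * \<delta> = 2 * pi * of_int m"
      by (auto simp: complex_eq_iff cos_one_2pi_int mult_ac)
    have "0 < real k * \<delta>"
      using that \<delta> by simp
    moreover have "real k * \<delta> < real N * \<delta>"
      using that \<delta>(1) by (intro mult_strict_right_mono) auto
    ultimately have "0 < m" "m < 1"
      unfolding m \<delta>(2) using pi_gt_zero by (simp_all add: zero_less_mult_iff)
    then show False by simp
  qed
  have \<omega>: "\<omega> \<noteq> 1" "\<omega>\<^sup>2 \<noteq> 1" "\<omega> ^ 3 \<noteq> 1" "\<omega> \<noteq> 0" "\<omega> ^ N = 1"
    using \<omega>_pow[of 1] \<omega>_pow[of 2] \<omega>_pow[of 3] N \<delta>
    by (auto simp: \<omega>_def Complex.DeMoivre)
  define s where "s = 1 + \<omega> + 1 / \<omega>"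
  define \<kappa> where "\<kappa> = cubic_factor \<omega>"
  have \<kappa>: "\<kappa> \<noteq> 0"
    using \<omega> by (simp add: \<kappa>_def cubic_factor_def)
  define u where "u l = \<omega>\<^sup>2 / ((\<omega>\<^sup>2 - 1) * (\<omega> - 1)) * (\<omega> ^ l / \<omega> - 1 - 1 / \<omega> + 1 / \<omega> ^ l)" for l :: nat
  have telescope: "(\<Sum>l<N - 2. u (l + 2) *\<^sub>C (F (l + 3) - s *\<^sub>C F (l + 2) + s *\<^sub>C F (l + 1) - F l)) = F N - F 0"
    for F :: "nat \<Rightarrow> 'a"
    unfolding u_def using N by (intro cubic_telescope \<omega>) (simp_all add: s_def)
  \<comment> \<open>The slope for which \<open>\<bar>e\<bar> \<le> pi\<close> gives both \<open>\<bar>\<tau> * e\<bar> \<le> \<theta>A\<close> and \<open>\<bar>e - \<tau> * e\<bar> \<le> pi - \<theta>A < \<theta>B\<close>.\<close>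
  define \<tau> where "\<tau> = \<theta>A / pi"
  have \<tau>: "0 \<le> \<tau>" "\<tau> \<le> 1" "\<tau> * pi = \<theta>A"
    using SA.\<theta> by (auto simp: \<tau>_def)
  define e where "e m = - pi + real m * \<delta>" for m :: nat
  define \<alpha> where "\<alpha> l = - \<tau> * e l" for l :: nat
  have e_abs: "\<bar>e m\<bar> \<le> pi" if "m \<le> N" for m
  proof -
    have "real m * \<delta> \<le> real N * \<delta>" "0 \<le> real m * \<delta>"
      using that \<delta>(1) by (auto intro: mult_right_mono)
    then show ?thesis
      unfolding e_def \<delta>(2) by linarith
  qed
  have \<alpha>_abs: "\<bar>\<alpha> m\<bar> \<le> \<theta>A" if "m \<le> N" for m
    using mult_left_mono[OF e_abs[OF that] \<tau>(1)] \<tau> by (simp add: \<alpha>_def abs_mult)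
  have \<alpha>e_abs: "\<bar>\<alpha> m + e m\<bar> \<le> pi - \<theta>A" if "m \<le> N" for m
  proof -
    have eq: "\<alpha> m + e m = (1 - \<tau>) * e m"
      by (simp add: \<alpha>_def algebra_simps)
    have "\<bar>\<alpha> m + e m\<bar> = (1 - \<tau>) * \<bar>e m\<bar>"
      unfolding eq using \<tau> by (simp add: abs_mult)
    moreover have "(1 - \<tau>) * \<bar>e m\<bar> \<le> (1 - \<tau>) * pi"
      using \<tau> e_abs[OF that] by (intro mult_left_mono) auto
    moreover have "(1 - \<tau>) * pi = pi - \<theta>A"
      using \<tau>(3) by (simp add: algebra_simps)
    ultimately show ?thesis by linarith
  qed
  have e_add: "e (l + i) = e l + real i * \<delta>" for l i
    by (simp add: e_def algebra_simps)
  \<comment> \<open>The base direction is at most \<open>pi - \<theta>A\<close> in modulus, and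
    \<open>3 * \<delta>\<close> more stays below \<open>pi - \<theta>A + gap = \<theta>B\<close>,
    strictly, as the calculus of \<open>B\<close> requires.\<close>
  have dir: "\<bar>\<alpha> l + e l\<bar> < \<theta>B" "\<bar>\<alpha> l + e l + \<delta>\<bar> < \<theta>B" "\<bar>\<alpha> l + e l + 2 * \<delta>\<bar> < \<theta>B"
    "\<bar>\<alpha> l + e l + 3 * \<delta>\<bar> < \<theta>B" if "l < N - 2" for l
    using \<alpha>e_abs[of l, OF order.strict_implies_order[OF less_le_trans[OF that diff_le_self]]]
      \<delta>(1) \<delta>_gap unfolding gap_def by linarith+
  have dir': "\<bar>\<alpha> l + e (l + i)\<bar> \<le> \<theta>B" if "l < N - 2" "i \<in> {0, 1, 2, 3}" for l i
    using dir[OF that(1)] that(2) unfolding e_add by auto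
  have \<alpha>_abs': "\<bar>\<alpha> l\<bar> \<le> \<theta>A" if "l < N - 2" for l
    using that by (intro \<alpha>_abs) simp
  define W where "W l b y = integral {0..b} (\<lambda>r. block_kernel (\<alpha> l) (\<alpha> l + e l) (\<alpha> l + e l + \<delta>)
    (\<alpha> l + e l + 2 * \<delta>) (\<alpha> l + e l + 3 * \<delta>) r y)" for l b y
  have W_cont: "continuous_on {0..b} (\<lambda>r. block_kernel (\<alpha> l) (\<alpha> l + e l) (\<alpha> l + e l + \<delta>)
    (\<alpha> l + e l + 2 * \<delta>) (\<alpha> l + e l + 3 * \<delta>) r y)" if "l < N - 2" for l b y
    using dir[OF that] \<alpha>_abs'[OF that]
    by (intro continuous_on_subset[OF block_kernel_continuous]) auto
  \<comment> \<open>The weights of \<open>cubic_telescope\<close>; dividing by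
    \<open>\<kappa>\<close> removes the factor between a block kernel and the third
    difference.\<close>
  define V where "V b y = (\<Sum>l<N - 2. (u (l + 2) / \<kappa>) *\<^sub>C W l b y)" for b y
  have "\<exists>M. \<forall>(n::nat) y. norm (W l (exp (real (Suc n))) y) \<le> M * norm y" if l: "l < N - 2" for l
  proof -
    obtain M where "\<And>(n::nat) y. norm (W l (exp (real (Suc n))) y) \<le> M * norm y"
      by (rule block_integral_bound[OF T H \<alpha>_abs'[OF l] dir[OF l]]) (rule that[unfolded W_def])
    then show ?thesis by blast
  qed
  then obtain MW where MW: "\<And>l (n::nat) y. l < N - 2 \<Longrightarrow> norm (W l (exp (real (Suc n))) y) \<le> MW l * norm y"
    by metis
  have bound: "norm (V (exp (real (Suc n))) y) \<le> (\<Sum>l<N - 2. cmod (u (l + 2) / \<kappa>) * MW l) * norm y" for n :: nat and y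
  proof -
    have "norm (V (exp (real (Suc n))) y) \<le> (\<Sum>l<N - 2. cmod (u (l + 2) / \<kappa>) * (MW l * norm y))"
      unfolding V_def norm_scaleC[symmetric]
      by (intro sum_norm_le) (unfold norm_scaleC, intro mult_left_mono MW, auto)
    then show ?thesis by (simp add: sum_distrib_right mult.assoc)
  qed
  have W_rays: "W l b y = \<kappa> *\<^sub>C (ray_kernel_integral (\<alpha> l) (e (l + 3)) y b
      - s *\<^sub>C ray_kernel_integral (\<alpha> l) (e (l + 2)) y b
      + s *\<^sub>C ray_kernel_integral (\<alpha> l) (e (l + 1)) y b - ray_kernel_integral (\<alpha> l) (e (l + 0)) y b)"
    if l: "l < N - 2" for l b y
  proof -
    let ?K = "\<lambda>i r. cis (\<alpha> l) *\<^sub>C ray_kernel (e (l + i)) y (complex_of_real r * cis (\<alpha> l))"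
    have K: "(?K i has_integral ray_kernel_integral (\<alpha> l) (e (l + i)) y b) {0..b}" if "i \<in> {0, 1, 2, 3}" for i
      unfolding ray_kernel_integral_def 
      by (intro integrable_integral integrable_continuous_real ray_kernel_continuous
          \<alpha>_abs' dir' l that)
    have "((\<lambda>r. \<kappa> *\<^sub>C (?K 3 r - s *\<^sub>C ?K 2 r + s *\<^sub>C ?K 1 r - ?K 0 r)) has_integral
      \<kappa> *\<^sub>C (ray_kernel_integral (\<alpha> l) (e (l + 3)) y b
      - s *\<^sub>C ray_kernel_integral (\<alpha> l) (e (l + 2)) y b
      + s *\<^sub>C ray_kernel_integral (\<alpha> l) (e (l + 1)) y b - ray_kernel_integral (\<alpha> l) (e (l + 0)) y b)) {0..b}"
      by (intro has_integral_linear[OF _ scaleC.bounded_linear_right, unfolded o_def]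
          has_integral_diff has_integral_add K) auto
    moreover have "\<kappa> *\<^sub>C (?K 3 r - s *\<^sub>C ?K 2 r + s *\<^sub>C ?K 1 r - ?K 0 r) = block_kernel (\<alpha> l) (\<alpha> l + e l)
        (\<alpha> l + e l + \<delta>) (\<alpha> l + e l + 2 * \<delta>) (\<alpha> l + e l + 3 * \<delta>) r y" if "r \<in> {0..b}" for r
      unfolding \<kappa>_def e_add using \<alpha>_abs'[OF l] dir[OF l] that
      by (intro block_kernel_ray_kernel[symmetric] \<omega> \<omega>_def s_def) auto
    ultimately have "((\<lambda>r. block_kernel (\<alpha> l) (\<alpha> l + e l)
        (\<alpha> l + e l + \<delta>) (\<alpha> l + e l + 2 * \<delta>) (\<alpha> l + e l + 3 * \<delta>) r y) has_integral
      \<kappa> *\<^sub>C (ray_kernel_integral (\<alpha> l) (e (l + 3)) y b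
      - s *\<^sub>C ray_kernel_integral (\<alpha> l) (e (l + 2)) y b
      + s *\<^sub>C ray_kernel_integral (\<alpha> l) (e (l + 1)) y b - ray_kernel_integral (\<alpha> l) (e (l + 0)) y b)) {0..b}"
      by (rule has_integral_eq[rotated])
    then show ?thesis
      unfolding W_def by (rule integral_unique)
  qed
  define I where "I m y b = ray_kernel_integral (\<alpha> m) (e m) y b" for m y b
  \<comment> \<open>The cost of moving a ray from \<open>\<alpha> (l + i)\<close> to
    \<open>\<alpha> l\<close> is a difference of values of \<open>X\<close>, so that it telescopes
    like the kernels.\<close>
  define X where "X m y = (\<i> * complex_of_real (\<tau> * e m)) *\<^sub>C y" for m :: nat and y :: 'a
  have ray_lim: "((\<lambda>b. ray_kernel_integral (\<alpha> l) (e (l + i)) y b - I (l + i) y b)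
      \<longlongrightarrow> X (l + i) y - X l y) at_top" if "l < N - 2" "i \<in> {0, 1, 2, 3}" for l i y
  proof -
    have "((\<lambda>b. ray_kernel_integral (\<alpha> l) (e (l + i)) y b - I (l + i) y b)
      \<longlongrightarrow> (\<i> * complex_of_real (\<alpha> l - \<alpha> (l + i))) *\<^sub>C y) at_top"
      unfolding I_def
    proof (rule ray_kernel_change)
      have "l + i \<le> N" using that by auto
      then show "\<bar>\<alpha> l\<bar> \<le> \<theta>A" "\<bar>\<alpha> (l + i)\<bar> \<le> \<theta>A" "\<bar>\<alpha> (l + i) + e (l + i)\<bar> \<le> \<theta>B"
        using \<alpha>_abs[of l] \<alpha>_abs[of "l + i"] \<alpha>e_abs[of "l + i"] gap by (auto simp: gap_def)
      show "\<bar>\<alpha> l + e (l + i)\<bar> \<le> \<theta>B"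
        by (rule dir'[OF that])
    qed
    moreover have "(\<i> * complex_of_real (\<alpha> l - \<alpha> (l + i))) *\<^sub>C y = X (l + i) y - X l y"
      by (simp add: X_def \<alpha>_def scaleC_simps algebra_simps)
    ultimately show ?thesis by simp
  qed
  have V_lim: "((\<lambda>b. V b y - (I N y b - I 0 y b)) \<longlongrightarrow> X N y - X 0 y) at_top" for y
  proof -
    define E where "E l i b = ray_kernel_integral (\<alpha> l) (e (l + i)) y b - I (l + i) y b" for l i b
    have E_lim: "(E l i \<longlongrightarrow> X (l + i) y - X l y) at_top" if "l < N - 2" "i \<in> {0, 1, 2, 3}" for l i
      unfolding E_def by (rule ray_lim[OF that])
    have "((\<lambda>b. \<Sum>l<N - 2. u (l + 2) *\<^sub>C (E l 3 b - s *\<^sub>C E l 2 b + s *\<^sub>C E l 1 b - E l 0 b))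
      \<longlongrightarrow> (\<Sum>l<N - 2. u (l + 2) *\<^sub>C ((X (l + 3) y - X l y) - s *\<^sub>C (X (l + 2) y - X l y)
        + s *\<^sub>C (X (l + 1) y - X l y) - (X (l + 0) y - X l y)))) at_top"
      by (intro tendsto_sum tendsto_add tendsto_diff tendsto_const scaleC.tendsto E_lim) auto
    also have "(\<Sum>l<N - 2. u (l + 2) *\<^sub>C ((X (l + 3) y - X l y) - s *\<^sub>C (X (l + 2) y - X l y)
        + s *\<^sub>C (X (l + 1) y - X l y) - (X (l + 0) y - X l y))) = X N y - X 0 y"
      \<comment> \<open>The terms \<open>X l y\<close> drop out because the coefficients 1,
        \<open>- s\<close>, \<open>s\<close>, -1 sum to zero.\<close>
      unfolding telescope[of "\<lambda>m. X m y", symmetric]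
      by (intro sum.cong refl arg_cong[where f = "scaleC _"]) (simp add: scaleC.diff_right algebra_simps)
    also have "(\<lambda>b. \<Sum>l<N - 2. u (l + 2) *\<^sub>C (E l 3 b - s *\<^sub>C E l 2 b + s *\<^sub>C E l 1 b - E l 0 b))
      = (\<lambda>b. V b y - (I N y b - I 0 y b))"
    proof
      fix b
      have "V b y = (\<Sum>l<N - 2. u (l + 2) *\<^sub>C (ray_kernel_integral (\<alpha> l) (e (l + 3)) y b
        - s *\<^sub>C ray_kernel_integral (\<alpha> l) (e (l + 2)) y b
        + s *\<^sub>C ray_kernel_integral (\<alpha> l) (e (l + 1)) y b - ray_kernel_integral (\<alpha> l) (e (l + 0)) y b))"
        unfolding V_def using \<kappa> by (intro sum.cong refl) (simp add: W_rays scaleC_scaleC)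
      then have "V b y - (I N y b - I 0 y b) = (\<Sum>l<N - 2.
          u (l + 2) *\<^sub>C (ray_kernel_integral (\<alpha> l) (e (l + 3)) y b
        - s *\<^sub>C ray_kernel_integral (\<alpha> l) (e (l + 2)) y b
        + s *\<^sub>C ray_kernel_integral (\<alpha> l) (e (l + 1)) y b - ray_kernel_integral (\<alpha> l) (e (l + 0)) y b)
        - u (l + 2) *\<^sub>C (I (l + 3) y b - s *\<^sub>C I (l + 2) y b + s *\<^sub>C I (l + 1) y b - I l y b))"
        unfolding telescope[of "\<lambda>m. I m y b", symmetric] by (simp only: sum_subtractf)
      also have "\<dots> = (\<Sum>l<N - 2. u (l + 2) *\<^sub>C (E l 3 b - s *\<^sub>C E l 2 b + s *\<^sub>C E l 1 b - E l 0 b))"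
        unfolding scaleC.diff_right[symmetric] E_def
        by (intro sum.cong refl arg_cong[where f = "scaleC _"]) (simp add: scaleC.diff_right algebra_simps)
      finally show "(\<Sum>l<N - 2. u (l + 2) *\<^sub>C (E l 3 b - s *\<^sub>C E l 2 b + s *\<^sub>C E l 1 b - E l 0 b))
        = V b y - (I N y b - I 0 y b)" by (rule sym)
    qed
    finally show ?thesis .
  qed
  have ends: "e 0 = - pi" "e N = pi" "\<alpha> 0 = \<theta>A" "\<alpha> N = - \<theta>A"
    using \<delta> \<tau> by (simp_all add: e_def \<alpha>_def)
  have limit: "((\<lambda>b. V b (op_app A x + op_app B x)) \<longlongrightarrow> (2 * of_real pi * \<i>) *\<^sub>C op_app B x) at_top"
    if x: "x \<in> op_dom A" "x \<in> op_dom B" for x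
  proof -
    let ?y = "op_app A x + op_app B x"
    have "((\<lambda>b. (V b ?y - (I N ?y b - I 0 ?y b)) + (I N ?y b - I 0 ?y b))
      \<longlongrightarrow> (X N ?y - X 0 ?y) + ((2 * of_real pi * \<i>) *\<^sub>C op_app B x - (\<i> * complex_of_real (2 * \<theta>A)) *\<^sub>C ?y)) at_top"
      using ray_kernel_endpoints[OF x] sum by (intro tendsto_add V_lim) (auto simp: I_def ends)
    \<comment> \<open>The multiples of the identity collected from the rotations cancel the one in
      \<open>ray_kernel_endpoints\<close>, leaving \<open>B x\<close> alone.\<close>
    moreover have "X N ?y - X 0 ?y = (\<i> * complex_of_real (2 * \<theta>A)) *\<^sub>C ?y"
    proof -
      have "complex_of_real \<tau> * of_real pi = of_real \<theta>A"
        by (simp add: \<tau>(3)[symmetric])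
      then show ?thesis
        by (simp add: X_def ends flip: scaleC.diff_left) (simp add: algebra_simps)
    qed
    ultimately show ?thesis by simp
  qed
  have add: "V b (x + y) = V b x + V b y" for b x y
  proof -
    have "W l b (x + y) = W l b x + W l b y" if l: "l < N - 2" for l
    proof -
      have "block_kernel (\<alpha> l) (\<alpha> l + e l) (\<alpha> l + e l + \<delta>) (\<alpha> l + e l + 2 * \<delta>) (\<alpha> l + e l + 3 * \<delta>) r (x + y)
        = block_kernel (\<alpha> l) (\<alpha> l + e l) (\<alpha> l + e l + \<delta>) (\<alpha> l + e l + 2 * \<delta>) (\<alpha> l + e l + 3 * \<delta>) r x
        + block_kernel (\<alpha> l) (\<alpha> l + e l) (\<alpha> l + e l + \<delta>) (\<alpha> l + e l + 2 * \<delta>) (\<alpha> l + e l + 3 * \<delta>) r y"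
        if r: "r \<in> {0..b}" for r
      proof -
        have "complex_of_real r * cis (\<alpha> l) \<in> sector \<theta>A"
          using r \<alpha>_abs'[OF l] SA.\<theta> by (intro sector_polarI) auto
        moreover have "complex_of_real r * cis t \<in> sector \<theta>B" if "\<bar>t\<bar> < \<theta>B" for t
          using r that SB.\<theta> by (intro sector_polarI) auto
        ultimately show ?thesis
          using dir[OF l] unfolding block_kernel_def diff_J_def
          by (simp add: SA.R_add SB.R_add SA.R_diff SB.R_diff scaleC.add_right scaleC.diff_right
              SA.R_scaleC SB.R_scaleC)
      qed
      then have "W l b (x + y) = integral {0..b} (\<lambda>r.
          block_kernel (\<alpha> l) (\<alpha> l + e l) (\<alpha> l + e l + \<delta>) (\<alpha> l + e l + 2 * \<delta>) (\<alpha> l + e l + 3 * \<delta>) r x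
        + block_kernel (\<alpha> l) (\<alpha> l + e l) (\<alpha> l + e l + \<delta>) (\<alpha> l + e l + 2 * \<delta>) (\<alpha> l + e l + 3 * \<delta>) r y)"
        unfolding W_def by (intro integral_cong)
      also have "\<dots> = W l b x + W l b y"
        unfolding W_def by (intro integral_add integrable_continuous_real W_cont l)
      finally show ?thesis .
    qed
    then show ?thesis
      by (simp add: V_def scaleC.add_right sum.distrib)
  qed
  have commute: "V b (S y) = S (V b y)"
    if S: "bounded_linear S" "\<forall>c x. S (c *\<^sub>C x) = c *\<^sub>C S x"
      and SA: "\<forall>z\<in>sector \<theta>A. \<forall>x. S (SA.R z x) = SA.R z (S x)"
      and SB: "\<forall>z\<in>sector \<theta>B. \<forall>x. S (SB.R z x) = SB.R z (S x)" for b S y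
  proof -
    note lin = linear_diff[OF bounded_linear.linear[OF S(1)]]
    have "W l b (S y) = S (W l b y)" if l: "l < N - 2" for l
    proof -
      have "block_kernel (\<alpha> l) (\<alpha> l + e l) (\<alpha> l + e l + \<delta>) (\<alpha> l + e l + 2 * \<delta>) (\<alpha> l + e l + 3 * \<delta>) r (S y)
        = S (block_kernel (\<alpha> l) (\<alpha> l + e l) (\<alpha> l + e l + \<delta>) (\<alpha> l + e l + 2 * \<delta>) (\<alpha> l + e l + 3 * \<delta>) r y)"
        if r: "r \<in> {0..b}" for r
      proof -
        have "complex_of_real r * cis (\<alpha> l) \<in> sector \<theta>A"
          using r \<alpha>_abs'[OF l] SA.\<theta> by (intro sector_polarI) auto
        moreover have "complex_of_real r * cis t \<in> sector \<theta>B" if "\<bar>t\<bar> < \<theta>B" for t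
          using r that SB.\<theta> by (intro sector_polarI) auto
        ultimately show ?thesis
          using dir[OF l] unfolding block_kernel_def diff_J_def by (simp add: S(2) SA SB lin)
      qed
      then have "W l b (S y) = integral {0..b} (\<lambda>r. S (block_kernel (\<alpha> l) (\<alpha> l + e l) (\<alpha> l + e l + \<delta>)
          (\<alpha> l + e l + 2 * \<delta>) (\<alpha> l + e l + 3 * \<delta>) r y))"
        unfolding W_def by (intro integral_cong)
      also have "\<dots> = S (W l b y)"
        unfolding W_def
        by (intro integral_linear[OF _ S(1), unfolded o_def] integrable_continuous_real W_cont l)
      finally show ?thesis .
    qed
    then show ?thesis
      by (simp add: V_def S(2) linear_sum[OF bounded_linear.linear[OF S(1)]])
  qed
  show ?thesis
    by (rule that[OF bound limit add commute])
qed

end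

subsection \<open>Closedness and invertibility of the sum\<close>

context commuting_pair
begin

text \<open>The norm of \<open>A x + B x\<close> controls that of \<open>B x\<close> and,
  \<open>B\<close> being invertible, that of \<open>x\<close>; this gives injectivity and a closed
  range. Approximate solutions built from \<open>V\<close> show that the range contains the dense
  set of all \<open>A^{-1} B^{-1} v\<close>.\<close>

lemma sum_closed_invertible:
  assumes T: "A \<in> T_sectorial \<theta>A" and H: "bounded_H_inf_calculus \<theta>B B" and sum: "pi < \<theta>A + \<theta>B"
  shows "closed_operator (op_add A B) \<and> 0 \<in> resolvent_set (op_add A B)"
proof -
  obtain V M where V_bound: "\<And>(n::nat) y. norm (V (exp (real (Suc n))) y) \<le> M * norm y"
    and V_lim: "\<And>x. x \<in> op_dom A \<Longrightarrow> x \<in> op_dom B \<Longrightarrow>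
      ((\<lambda>b. V b (op_app A x + op_app B x)) \<longlongrightarrow> (2 * of_real pi * \<i>) *\<^sub>C op_app B x) at_top"
    and V_add: "\<And>b x y. V b (x + y) = V b x + V b y"
    and V_comm: "\<And>b S y. bounded_linear S \<Longrightarrow> \<forall>c x. S (c *\<^sub>C x) = c *\<^sub>C S x \<Longrightarrow>
      \<forall>z\<in>sector \<theta>A. \<forall>x. S (SA.R z x) = SA.R z (S x) \<Longrightarrow>
      \<forall>z\<in>sector \<theta>B. \<forall>x. S (SB.R z x) = SB.R z (S x) \<Longrightarrow> V b (S y) = S (V b y)"
    by (rule approximate_inverse[OF assms]) (rule that)
  define D where "D = op_dom A \<inter> op_dom B"
  define F where "F x = op_app A x + op_app B x" for x
  note zA = SA.zero_in_sector and zB = SB.zero_in_sector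
  note linA = linear_operatorD[OF SA.linear] and linB = linear_operatorD[OF SB.linear]
  have D_add: "x + y \<in> D" "F (x + y) = F x + F y" if "x \<in> D" "y \<in> D" for x y
    using that linA(1,2) linB(1,2) by (simp_all add: D_def F_def)
  have D_diff: "x - y \<in> D" "F (x - y) = F x - F y" if "x \<in> D" "y \<in> D" for x y
    using that linA(5,6) linB(5,6) by (simp_all add: D_def F_def)
  have D_scaleC: "c *\<^sub>C x \<in> D" "F (c *\<^sub>C x) = c *\<^sub>C F x" if "x \<in> D" for c x
    using that linA(3,4)[of x x c] linB(3,4)[of x x c] by (simp_all add: D_def F_def scaleC.add_right)
  have A0: "SA.R 0 (op_app A x) = x" if "x \<in> D" for x
    using that SA.R_app[OF zA] by (simp add: D_def)
  have B0: "SB.R 0 (op_app B x) = x" if "x \<in> D" for x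
    using that SB.R_app[OF zB] by (simp add: D_def)
  have exp_seq: "filterlim (\<lambda>n. exp (real (Suc n))) at_top sequentially"
    by (intro filterlim_compose[OF exp_at_top] filterlim_compose[OF filterlim_real_sequentially] filterlim_Suc)
  have V_seq: "(\<lambda>n. V (exp (real (Suc n))) (F x)) \<longlonglongrightarrow> (2 * of_real pi * \<i>) *\<^sub>C op_app B x"
    if "x \<in> D" for x
    using filterlim_compose[OF V_lim exp_seq, of x] that by (simp add: D_def F_def)
  define C where "C = \<bar>M\<bar> / (2 * pi)"
  have C: "0 \<le> C" by (simp add: C_def)
  have B_le: "norm (op_app B x) \<le> C * norm (F x)" if "x \<in> D" for x
  proof -
    have "norm ((2 * of_real pi * \<i>) *\<^sub>C op_app B x) \<le> M * norm (F x)"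
      by (rule Lim_norm_ubound[OF sequentially_bot V_seq[OF that]]) (intro always_eventually allI V_bound)
    then have "2 * pi * norm (op_app B x) \<le> M * norm (F x)"
      by (simp add: norm_scaleC norm_mult)
    also have "\<dots> \<le> \<bar>M\<bar> * norm (F x)"
      by (intro mult_right_mono) auto
    finally show ?thesis
      by (simp add: C_def pos_le_divide_eq mult_ac)
  qed
  \<comment> \<open>Convergence of \<open>F (X n)\<close> makes \<open>B (X n)\<close> Cauchy and
    hence \<open>A (X n)\<close> convergent; the bounded inverses of \<open>A\<close> and
    \<open>B\<close> both compute the limit of \<open>X\<close>, which therefore lies in both
    domains.\<close>
  have closed_range: "\<exists>x\<in>D. F x = y \<and> X \<longlonglongrightarrow> x" if X: "\<And>n. X n \<in> D" and lim: "(\<lambda>n. F (X n)) \<longlonglongrightarrow> y" for X y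
  proof -
    have "Cauchy (\<lambda>n. op_app B (X n))"
    proof (rule CauchyI)
      fix e :: real assume e: "0 < e"
      have "Cauchy (\<lambda>n. F (X n))"
        using lim by (rule LIMSEQ_imp_Cauchy)
      then obtain k where k: "\<And>m n. k \<le> m \<Longrightarrow> k \<le> n \<Longrightarrow> norm (F (X m) - F (X n)) < e / (C + 1)"
        using CauchyD[of "\<lambda>n. F (X n)" "e / (C + 1)"] e C by fastforce
      have "norm (op_app B (X m) - op_app B (X n)) < e" if "k \<le> m" "k \<le> n" for m n
      proof -
        have "norm (op_app B (X m) - op_app B (X n)) = norm (op_app B (X m - X n))"
          using X linB(6) by (simp add: D_def)
        also have "\<dots> \<le> C * norm (F (X m) - F (X n))"
          using B_le[OF D_diff(1)[OF X X]] by (simp add: D_diff X)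
        also have "\<dots> \<le> C * (e / (C + 1))"
          using k[OF that] C by (intro mult_left_mono) auto
        also have "\<dots> < e"
          using e C by (simp add: field_simps)
        finally show ?thesis .
      qed
      then show "\<exists>k. \<forall>m\<ge>k. \<forall>n\<ge>k. norm (op_app B (X m) - op_app B (X n)) < e"
        by blast
    qed
    then obtain b where b: "(\<lambda>n. op_app B (X n)) \<longlonglongrightarrow> b"
      using Cauchy_convergent convergent_def by blast
    have "(\<lambda>n. F (X n) - op_app B (X n)) \<longlonglongrightarrow> y - b"
      by (intro tendsto_diff lim b)
    then have a: "(\<lambda>n. op_app A (X n)) \<longlonglongrightarrow> y - b"
      by (simp add: F_def)
    have XA: "X \<longlonglongrightarrow> SA.R 0 (y - b)"
      using bounded_linear.tendsto[OF SA.R_bounded_linear[OF zA] a] by (simp add: A0 X)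
    have XB: "X \<longlonglongrightarrow> SB.R 0 b"
      using bounded_linear.tendsto[OF SB.R_bounded_linear[OF zB] b] by (simp add: B0 X)
    have eq: "SA.R 0 (y - b) = SB.R 0 b"
      by (rule LIMSEQ_unique[OF XA XB])
    have "op_app A (SB.R 0 b) = y - b" "SB.R 0 b \<in> op_dom A"
      using SA.app_R[OF zA, of "y - b"] SA.R_dom[OF zA, of "y - b"] by (simp_all add: eq)
    then show ?thesis
      using SB.app_R[OF zB, of b] SB.R_dom[OF zB, of b] XB by (intro bexI[of _ "SB.R 0 b"]) (auto simp: F_def D_def)
  qed
  have nice: "\<exists>x\<in>D. F x = SA.R 0 (SB.R 0 v)" for v
  proof -
    define u where "u = SA.R 0 (SB.R 0 v)"
    have u': "u = SB.R 0 (SA.R 0 v)"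
      unfolding u_def by (rule comm[OF zA zB])
    have u: "u \<in> D" "op_app A u = SB.R 0 v" "op_app B u = SA.R 0 v"
      using SA.R_dom[OF zA, of "SB.R 0 v"] SB.R_dom[OF zB, of "SA.R 0 v"]
        SA.app_R[OF zA, of "SB.R 0 v"] SB.app_R[OF zB, of "SA.R 0 v"]
      by (auto simp: D_def u_def[symmetric] u'[symmetric])
    \<comment> \<open>As \<open>V\<close> stands for \<open>2 pi i B (A + B)^{-1}\<close>,
      \<open>w n\<close> approximates \<open>2 pi i (A + B)^{-1} u\<close>. Commuting the resolvents
      contained in \<open>u\<close> past \<open>V\<close> puts \<open>w n\<close> into both domains,
      and \<open>F (w n)\<close> is \<open>B^{-1} V (F u)\<close>, which tends to
      \<open>2 pi i u\<close>.\<close>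
    define w where "w n = SB.R 0 (V (exp (real (Suc n))) u)" for n :: nat
    have VA: "V b (SA.R 0 t) = SA.R 0 (V b t)" for b t
      by (rule V_comm) (simp_all add: SA.R_bounded_linear zA SA.R_scaleC SA.R_commute comm)
    have VB: "V b (SB.R 0 t) = SB.R 0 (V b t)" for b t
      by (rule V_comm) (simp_all add: SB.R_bounded_linear zB SB.R_scaleC SB.R_commute comm)
    have w: "w n \<in> D \<and> F (w n) = SB.R 0 (V (exp (real (Suc n))) (op_app A u + op_app B u))" for n
    proof -
      let ?b = "exp (real (Suc n))"
      have wA: "w n = SA.R 0 (SB.R 0 (V ?b (SB.R 0 v)))"
        unfolding w_def u_def VA by (rule comm[OF zA zB, symmetric])
      have "w n \<in> op_dom A" "op_app A (w n) = SB.R 0 (V ?b (SB.R 0 v))"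
        unfolding wA using SA.R_dom[OF zA] SA.app_R[OF zA] by simp_all
      moreover have "w n \<in> op_dom B" "op_app B (w n) = SB.R 0 (V ?b (SA.R 0 v))"
        unfolding w_def using SB.R_dom[OF zB] SB.app_R[OF zB] by (simp_all add: u' VB)
      ultimately show ?thesis
        by (simp add: D_def F_def u V_add SB.R_add[OF zB])
    qed
    define X where "X n = (1 / (2 * of_real pi * \<i>)) *\<^sub>C w n" for n
    have "(\<lambda>n. V (exp (real (Suc n))) (op_app A u + op_app B u)) \<longlonglongrightarrow> (2 * of_real pi * \<i>) *\<^sub>C op_app B u"
      using V_seq[OF u(1)] by (simp only: F_def)
    from bounded_linear.tendsto[OF SB.R_bounded_linear[OF zB] this]
    have "(\<lambda>n. F (w n)) \<longlonglongrightarrow> (2 * of_real pi * \<i>) *\<^sub>C u"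
      using u by (simp add: w SB.R_scaleC[OF zB] u'[symmetric])
    then have "(\<lambda>n. (1 / (2 * of_real pi * \<i>)) *\<^sub>C F (w n)) \<longlonglongrightarrow>
        (1 / (2 * of_real pi * \<i>)) *\<^sub>C ((2 * of_real pi * \<i>) *\<^sub>C u)"
      by (intro scaleC.tendsto tendsto_const)
    then have "(\<lambda>n. F (X n)) \<longlonglongrightarrow> u"
      by (simp add: X_def D_scaleC w scaleC_scaleC)
    moreover have "X n \<in> D" for n
      by (simp add: X_def D_scaleC w)
    ultimately show ?thesis
      using closed_range[of X u] by (auto simp: u_def)
  qed
  have dense: "closure (range (\<lambda>v. SA.R 0 (SB.R 0 v))) = UNIV"
  proof -
    \<comment> \<open>First \<open>y\<close> is approximated by some \<open>a\<close> in the domain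
      of \<open>A\<close>, then \<open>A a\<close> by some \<open>b\<close> in that of
      \<open>B\<close>; the factor \<open>KA\<close> accounts for applying \<open>A^{-1}\<close> to
      the second error.\<close>
    have "\<exists>v. dist (SA.R 0 (SB.R 0 v)) y < e" if "0 < e" for y and e :: real
    proof -
      have "y \<in> closure (op_dom A)" by (simp add: SA.dense)
      then obtain a where a: "a \<in> op_dom A" "dist a y < e / 2"
        using \<open>0 < e\<close> unfolding closure_approachable by (meson half_gt_zero)
      have "op_app A a \<in> closure (op_dom B)" by (simp add: SB.dense)
      moreover have "0 < e / (2 * KA)" using \<open>0 < e\<close> SA.K by simp
      ultimately obtain b where b: "b \<in> op_dom B" "dist b (op_app A a) < e / (2 * KA)"
        unfolding closure_approachable by blast
      have a_eq: "SA.R 0 (op_app A a) = a" and b_eq: "SB.R 0 (op_app B b) = b"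
        using SA.R_app[OF zA a(1)] SB.R_app[OF zB b(1)] by simp_all
      have "dist (SA.R 0 b) a = norm (SA.R 0 (b - op_app A a))"
        by (simp add: dist_norm SA.R_diff[OF zA] a_eq)
      also have "\<dots> \<le> KA * norm (b - op_app A a)"
        by (rule SA.norm_R_le[OF zA])
      also have "\<dots> < KA * (e / (2 * KA))"
        using b(2) SA.K by (intro mult_strict_left_mono) (auto simp: dist_norm)
      also have "\<dots> = e / 2"
        using SA.K by simp
      finally have "dist (SA.R 0 (SB.R 0 (op_app B b))) y < e"
        using a(2) dist_triangle[of "SA.R 0 b" y a] by (simp add: b_eq)
      then show ?thesis by blast
    qed
    then show ?thesis
      by (auto simp: closure_approachable)
  qed
  have surj: "\<exists>x\<in>D. F x = y" for y
  proof -
    have "y \<in> closure (range (\<lambda>v. SA.R 0 (SB.R 0 v)))" by (simp add: dense)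
    then obtain U where U: "\<And>n. U n \<in> range (\<lambda>v. SA.R 0 (SB.R 0 v))" "U \<longlonglongrightarrow> y"
      unfolding closure_sequential by blast
    have "\<exists>x\<in>D. F x = U n" for n
      using U(1)[of n] nice by auto
    then obtain X where X: "\<And>n. X n \<in> D" "\<And>n. F (X n) = U n"
      by metis
    then show ?thesis
      using closed_range[of X y] U(2) by auto
  qed
  have norm_le: "norm x \<le> KB * C * norm (F x)" if "x \<in> D" for x
  proof -
    have "norm x \<le> KB * norm (op_app B x)"
      using SB.norm_R_le[OF zB, of "op_app B x"] by (simp add: B0 that)
    also have "\<dots> \<le> KB * (C * norm (F x))"
      using SB.K by (intro mult_left_mono B_le that) auto
    finally show ?thesis by simp
  qed
  \<comment> \<open>The sign comes from \<open>resolvent_set\<close>, which at 0 speaks of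
    \<open>0 - (A + B)\<close>.\<close>
  have inj: "inj_on (\<lambda>x. - F x) D"
  proof (rule inj_onI)
    fix x y assume xy: "x \<in> D" "y \<in> D" "- F x = - F y"
    then have "F (x - y) = 0" by (simp add: D_diff)
    with norm_le[OF D_diff(1)[OF xy(1,2)]] show "x = y" by simp
  qed
  have bij: "bij_betw (\<lambda>x. - F x) D UNIV"
    unfolding bij_betw_def
  proof (intro conjI inj set_eqI iffI UNIV_I)
    fix y
    obtain x where "x \<in> D" "F x = - y" using surj by blast
    then show "y \<in> (\<lambda>x. - F x) ` D" by (intro image_eqI[of _ _ x]) auto
  qed
  define G where "G = inv_into D (\<lambda>x. - F x)"
  have G: "G y \<in> D" "F (G y) = - y" for y
    using bij_betw_inv_into_right[OF bij, of y] bij_betwE[OF bij_betw_inv_into[OF bij]]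
    by (auto simp: G_def minus_equation_iff)
  have G_eq: "G y = x" if "x \<in> D" "F x = - y" for x y
    unfolding G_def using that inj by (intro inv_into_f_eq) auto
  have "bounded_linear G"
  proof (rule bounded_linear_intro)
    show "G (x + y) = G x + G y" for x y
      by (rule G_eq) (simp_all add: D_add G)
    show "G (r *\<^sub>R x) = r *\<^sub>R G x" for r x
      by (rule G_eq) (simp_all add: D_scaleC G scaleR_scaleC scaleC.minus_right)
    show "norm (G x) \<le> norm x * (KB * C)" for x
      using norm_le[OF G(1), of x] by (simp add: G mult_ac)
  qed
  with bij have "0 \<in> resolvent_set (op_add A B)"
    by (simp add: resolvent_set_def op_add_def op_scale_def op_id_def op_neg_def op_inv_def
        G_def D_def F_def)
  moreover have "closed_operator (op_add A B)"
  proof -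
    have "closed {(x, F x) | x. x \<in> D}"
      unfolding closed_sequential_limits
    proof (intro allI impI, elim conjE)
      fix P :: "nat \<Rightarrow> 'a \<times> 'a" and l
      assume P: "\<forall>n. P n \<in> {(x, F x) | x. x \<in> D}" and lim: "P \<longlonglongrightarrow> l"
      have P': "fst (P n) \<in> D" "snd (P n) = F (fst (P n))" for n
        using P[rule_format, of n] by auto
      have "(\<lambda>n. F (fst (P n))) \<longlonglongrightarrow> snd l"
        using tendsto_snd[OF lim] by (simp add: P')
      then obtain x where x: "x \<in> D" "F x = snd l" "(\<lambda>n. fst (P n)) \<longlonglongrightarrow> x"
        using closed_range[of "\<lambda>n. fst (P n)" "snd l"] P' by auto
      have "fst l = x"
        by (rule LIMSEQ_unique[OF tendsto_fst[OF lim] x(3)])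
      then have "l = (x, F x)"
        by (simp add: x(2) prod_eq_iff)
      with x(1) show "l \<in> {(x, F x) | x. x \<in> D}" by blast
    qed
    then show ?thesis
      by (simp add: closed_operator_def op_graph_def op_add_def D_def F_def)
  qed
  ultimately show ?thesis by simp
qed

end

section \<open>From the hypotheses of the theorem to a commuting pair\<close>

lemma op_add_commute: "op_add A B = op_add B A"
  by (simp add: op_add_def Int_commute add.commute)

text \<open>\<open>shifted_inv_commute\<close> is applied once for each operator, passing from the
  single given pair of points to arbitrary ones.\<close>

lemma resolvents_commute:
  assumes A: "linear_operator A" and B: "linear_operator B" and comm: "resolvent_commuting A B"
    and z: "z \<in> resolvent_set (op_neg A)" and w: "w \<in> resolvent_set (op_neg B)"
  shows "shifted_inv A z (shifted_inv B w x) = shifted_inv B w (shifted_inv A z x)"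
proof -
  obtain l m where l: "l \<in> resolvent_set (op_neg A)" and m: "m \<in> resolvent_set (op_neg B)"
    and eq: "shifted_inv A l \<circ> shifted_inv B m = shifted_inv B m \<circ> shifted_inv A l"
    using comm by (auto simp: resolvent_commuting_def)
  have diff: "shifted_inv A z (x - y) = shifted_inv A z x - shifted_inv A z y"
    "shifted_inv B m (x - y) = shifted_inv B m x - shifted_inv B m y" for x y
    using z m by (simp_all add: resolvent_set_op_neg linear_diff bounded_linear.linear)
  have "shifted_inv B m (shifted_inv A z x) = shifted_inv A z (shifted_inv B m x)" for x
    using fun_cong[OF eq]
    by (intro shifted_inv_commute[OF A l z, of "shifted_inv B m"] diff shifted_inv_scaleC[OF B m]) (simp add: o_def)
  then show ?thesis
    by (intro shifted_inv_commute[OF B m w, of "shifted_inv A z"] diff shifted_inv_scaleC[OF A z]) simp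
qed

lemma T_sectorial_plus_H_inf:
  fixes A B :: "'a::complex_banach operator"
  assumes "\<theta>A \<in> {0..<pi}" "\<theta>B \<in> {0..<pi}" "\<theta>A + \<theta>B > pi"
    and "A \<in> sectorial \<theta>A" "B \<in> sectorial \<theta>B" and comm: "resolvent_commuting A B"
    and T: "A \<in> T_sectorial \<theta>A" and H: "bounded_H_inf_calculus \<theta>B B"
  shows "closed_operator (op_add A B) \<and> 0 \<in> resolvent_set (op_add A B)"
proof -
  obtain KA where "sectorial_operator A \<theta>A KA"
    using assms by (auto elim: sectorialE)
  then interpret SA: sectorial_operator A \<theta>A KA .
  obtain KB where "sectorial_operator B \<theta>B KB"
    using assms by (auto elim: sectorialE)
  then interpret SB: sectorial_operator B \<theta>B KB .
  interpret commuting_pair A B \<theta>A KA \<theta>B KB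
    by unfold_locales (intro resolvents_commute SA.linear SB.linear comm SA.sector_resolvent SB.sector_resolvent)
  show ?thesis
    using T H assms(3) by (intro sum_closed_invertible) auto
qed

theorem theorem2p6:
  fixes A B :: "'a::complex_banach operator" and \<theta>\<^sub>A \<theta>\<^sub>B :: real
  assumes "\<theta>\<^sub>A \<in> {0..<pi}" and "\<theta>\<^sub>B \<in> {0..<pi}" and "\<theta>\<^sub>A + \<theta>\<^sub>B > pi"
    and "A \<in> sectorial \<theta>\<^sub>A" and "B \<in> sectorial \<theta>\<^sub>B"
    and "resolvent_commuting A B"
    and "(A \<in> T_sectorial \<theta>\<^sub>A \<and> bounded_H_inf_calculus \<theta>\<^sub>B B) \<or>
         (B \<in> T_sectorial \<theta>\<^sub>B \<and> bounded_H_inf_calculus \<theta>\<^sub>A A)"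
  shows "closed_operator (op_add A B) \<and> 0 \<in> resolvent_set (op_add A B)"
  using assms(7)
proof (elim disjE conjE)
  assume "A \<in> T_sectorial \<theta>\<^sub>A" "bounded_H_inf_calculus \<theta>\<^sub>B B"
  then show ?thesis
    by (intro T_sectorial_plus_H_inf[OF assms(1-6)])
next
  assume *: "B \<in> T_sectorial \<theta>\<^sub>B" "bounded_H_inf_calculus \<theta>\<^sub>A A"
  have "resolvent_commuting B A"
    using assms(6) unfolding resolvent_commuting_def by metis
  then show ?thesis
    unfolding op_add_commute[of A B] using assms *
    by (intro T_sectorial_plus_H_inf[of \<theta>\<^sub>B \<theta>\<^sub>A]) auto
qed

end
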